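(* Let $k\ge0$ and $f\in L^1_{\mathrm{loc}}(\mathbb R_+^n,\omega_k)$. Suppose that $\mathcal L_kf(\underline s)$ exists for some $s\in\mathbb R$ (i.e. $\int_{\mathbb R_+^n}|f(x)|E_k^A(-x,\underline s)\omega_k(x)dx<\infty$), and that $y\mapsto\mathcal L_kf(\underline s+iy)$ belongs to $L^1(\mathbb R^n,\omega_k)$. Then $f$ has a continuous representative $f_0$, and for all $x\in\mathbb R^n$ $$\frac{1}{c_k^2}\int_{\mathbb R^n}\mathcal L_kf(\underline s+iy)\,E_k^A(x,\underline s+iy)\,\omega_k(y)\,dy=\begin{cases}f_0(x)&\text{if }x>0,\\0&\text{otherwise},\end{cases}$$ (the left side is written in the paper as $\frac{(-i)^n}{c_k^2}\int_{\mathrm{Re}\,z=\underline s}\mathcal L_kf(z)E_k^A(x,z)\omega_k(z)dz$ with $dz$ an $n$-fold line integral).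
   Context: Let $n\ge1$, $k\ge0$. For $s\in\mathbb C$, $\underline s=(s,\ldots,s)\in\mathbb C^n$; $x>0$ means $x_i>0$ for all $i$; $\mathbb R_+=]0,\infty[$. $\langle x,y\rangle=\sum_ix_iy_i$ (bilinear on $\mathbb C^n$). Dunkl operators: $T_i(k)=\frac{\partial}{\partial x_i}+k\sum_{j\ne i}\frac{1}{x_i-x_j}(1-\sigma_{ij})$, $\sigma_{ij}$ exchanging coordinates $x_i,x_j$. The Dunkl kernel $E_k^A$ is defined by: for $y\in\mathbb C^n$, $E_k^A(\cdot,y)$ is the unique analytic $f$ on $\mathbb R^n$ with $T_i(k)f=y_if$ ($i=1..n$), $f(0)=1$; it extends holomorphically to $\mathbb C^n\times\mathbb C^n$. Weight $\omega_k(z)=\prod_{1\le i<j\le n}|z_i-z_j|^{2k}$ for $z\in\mathbb C^n$. Constant $c_k=\int_{\mathbb R^n}e^{-|x|^2/2}\omega_k(x)dx$. Laplace transform: $\mathcal L_kf(z)=\int_{\mathbb R_+^n}f(x)E_k^A(-x,z)\omega_k(x)dx$, where it exists. *)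

theory Defs
  imports "HOL-Analysis.Analysis"
begin

definition swapv :: "'n \<Rightarrow> 'n \<Rightarrow> 'a^'n::finite \<Rightarrow> 'a^'n" where
  "swapv i j x = (\<chi> l. x $ (if l = i then j else if l = j then i else l))"

definition Rplus :: "(real^'n::finite) set" where
  "Rplus = {x. \<forall>i. 0 < x $ i}"

definition real_analytic_Rn :: "(real^'n::finite \<Rightarrow> complex) \<Rightarrow> bool" where
  "real_analytic_Rn f \<longleftrightarrow> (\<forall>a. \<exists>r>0. \<exists>c :: ('n \<Rightarrow> nat) \<Rightarrow> complex.
      \<forall>x \<in> ball a r.
        ((\<lambda>\<alpha>. c \<alpha> * (\<Prod>i\<in>UNIV. complex_of_real ((x $ i - a $ i) ^ \<alpha> i))) has_sum f x) UNIV)"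

text \<open>T_i(k) f = y_i f for all i (at points where the difference quotients are defined;
  for analytic f the Dunkl operator is the continuous extension from these points).\<close>
definition dunkl_eigen :: "real \<Rightarrow> complex^'n::finite \<Rightarrow> (real^'n \<Rightarrow> complex) \<Rightarrow> bool" where
  "dunkl_eigen k y f \<longleftrightarrow> (\<forall>i x. (\<forall>j. j \<noteq> i \<longrightarrow> x $ i \<noteq> x $ j) \<longrightarrow>
      (\<exists>D. ((\<lambda>t. f (x + t *\<^sub>R axis i 1)) has_vector_derivative D) (at 0) \<and>
           D + complex_of_real k * (\<Sum>j\<in>UNIV - {i}. (f x - f (swapv i j x)) / complex_of_real (x $ i - x $ j))
             = y $ i * f x))"

definition dunklA :: "real \<Rightarrow> real^'n::finite \<Rightarrow> complex^'n \<Rightarrow> complex" where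
  "dunklA k x y = (THE f. real_analytic_Rn f \<and> dunkl_eigen k y f \<and> f 0 = 1) x"

definition apow :: "real \<Rightarrow> real \<Rightarrow> real" where
  "apow t a = (if t = 0 then (if a = 0 then 1 else 0) else \<bar>t\<bar> powr a)"

text \<open>omega_k(x) = prod_{i<j} |x_i - x_j|^{2k} = prod_{i \<noteq> j} |x_i - x_j|^k.\<close>
definition omega :: "real \<Rightarrow> real^'n::finite \<Rightarrow> real" where
  "omega k x = (\<Prod>p \<in> {p :: 'n \<times> 'n. fst p \<noteq> snd p}. apow (x $ fst p - x $ snd p) k)"

definition c_const :: "real \<Rightarrow> 'n::finite itself \<Rightarrow> real" where
  "c_const k _ = integral\<^sup>L lborel (\<lambda>x :: real^'n. exp (- (norm x)\<^sup>2 / 2) * omega k x)"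

definition laplaceA :: "real \<Rightarrow> (real^'n::finite \<Rightarrow> complex) \<Rightarrow> complex^'n \<Rightarrow> complex" where
  "laplaceA k f z = (LINT x : Rplus | lborel. f x * dunklA k (- x) z * complex_of_real (omega k x))"

definition line_pt :: "real \<Rightarrow> real^'n::finite \<Rightarrow> complex^'n" where
  "line_pt s y = (\<chi> i. Complex s (y $ i))"

definition loc_int_w :: "real \<Rightarrow> (real^'n::finite \<Rightarrow> complex) \<Rightarrow> bool" where
  "loc_int_w k f \<longleftrightarrow> (\<forall>K. compact K \<and> K \<subseteq> Rplus \<longrightarrow>
      set_integrable lborel K (\<lambda>x. complex_of_real (omega k x) * f x))"

end

theory Submission
  imports Defs "HOL-Probability.Characteristic_Functions"
begin

text \<open>
  The homogeneous components $e_m$ of the Dunkl kernel satisfy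
  $(m + k \sum_{a<b} (1 - \sigma_{ab})) e_m = \langle x, y\rangle e_{m-1}$. For $k \geq 0$ the operator on the
  left obeys a minimum principle on every orbit of the symmetric group, hence is invertible with a positive
  inverse of norm $1/m$. This yields existence, the bound $|e_m| \leq (|x|_\infty |y|_1)^m / m!$, the symmetry
  $e_m(x,y) = e_m(y,x)$ and, as the $T_i$ commute, the eigenvalue equations. Along rays the kernel solves a
  linear system whose reflection part is dissipative; a Gronwall estimate for the sum of $|f|^2$ over an orbit
  gives both the uniqueness of the kernel and the boundedness of $E(x, iy)$.

  Because $E(x, \underline s + iy) = e^{s \sum x_i} E(x, iy)$, the Laplace transform on $\underline s + i R^n$ is the Dunkl
  transform of $g(x) = f(x) e^{-s \sum x_i}$, extended by $0$, and the claim is $L^1$ inversion for it. The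
  antisymmetry of $T_j$ shows that the Dunkl transform maps $p\,e^{-|x|^2/2}$ to some $q\,e^{-|y|^2/2}$ and is
  inverted there. By Fubini, $g$ and the inverse transform of its transform have the same integrals
  against all $p\,e^{-|x|^2/2}\omega_k$, so their difference times $e^{-|x|^2/2} \omega_k$ has vanishing moments, hence
  vanishing Fourier transform. The inverse transform is continuous and vanishes a.e. off the orthant,
  hence everywhere off the open orthant.
\<close>

section \<open>Coordinate permutations and the minimum principle\<close>

text \<open>The kernel is given by a definite description among real analytic functions, so its
  value is known only once an analytic solution has been exhibited and shown to be the only one;
  this is why power series expansions at every centre are carried along. The eigenvalue equations
  are singular on the hyperplanes x_i = x_j, which shapes the proof in three ways. Derivatives of
  the kernel are computed off the hyperplanes and the resulting identities are extended by
  continuity; Euler's identity, in which the singular denominators cancel, replaces the single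
  equations wherever possible; and the weight is regularised before integrating by parts. On one
  orbit of the symmetric group the identities become finite linear systems, and there the sign of k
  is exploited. Inversion is tested against polynomials times Gaussians, where it is pure algebra
  with the operators T_j and multiplication by coordinates; the price is a moment problem, which the
  Gaussian factor makes determinate. The transform from p to q and the one back contribute one
  factor c_k each, whence the square in the claim.\<close>

definition tr :: "'n \<Rightarrow> 'n \<Rightarrow> 'n \<Rightarrow> 'n" where
  "tr a b l = (if l = a then b else if l = b then a else l)"

text \<open>\<open>w\<close> may be any self-map of the index set. Precomposition reverses the
  order, so swapping coordinates of \<open>pm w x\<close> amounts to composing \<open>w\<close> with
  a transposition on the right.\<close>

definition pm :: "('n \<Rightarrow> 'n) \<Rightarrow> 'a^'n::finite \<Rightarrow> 'a^'n" where
  "pm w x = (\<chi> l. x $ w l)"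

lemma pm_nth [simp]: "pm w x $ l = x $ w l"
  by (simp add: pm_def)

lemma swapv_eq_pm: "swapv a b = pm (tr a b)"
  by (simp add: fun_eq_iff swapv_def pm_def tr_def)

lemma swapv_nth [simp]: "swapv a b x $ l = x $ tr a b l"
  by (simp add: swapv_eq_pm)

lemma pm_pm: "pm v (pm w x) = pm (w \<circ> v) x"
  by (simp add: vec_eq_iff)

lemma pm_id [simp]: "pm id x = x"
  by (simp add: vec_eq_iff)

lemma tr_tr [simp]: "tr a b (tr a b l) = l"
  by (simp add: tr_def)

lemma tr_o_tr [simp]: "tr a b \<circ> tr a b = id" "tr a b \<circ> (tr a b \<circ> w) = w" "w \<circ> tr a b \<circ> tr a b = w"
  by (simp_all add: fun_eq_iff)

lemma tr_self [simp]: "tr a a = id"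
  by (simp add: fun_eq_iff tr_def)

lemma tr_commute: "tr a b = tr b a"
  by (simp add: fun_eq_iff tr_def)

lemma tr_left [simp]: "tr a b a = b" and tr_right [simp]: "tr a b b = a"
  by (simp_all add: tr_def)

lemma tr_other: "l \<noteq> a \<Longrightarrow> l \<noteq> b \<Longrightarrow> tr a b l = l"
  by (simp add: tr_def)

lemma tr_inj [simp]: "tr a b i = tr a b j \<longleftrightarrow> i = j"
  by (metis tr_tr)

lemma tr_conj: "tr a b \<circ> tr i j = tr (tr a b i) (tr a b j) \<circ> tr a b"
  by (auto simp: fun_eq_iff tr_def)

lemma bij_tr: "bij (tr a b)"
  by (metis bijI' tr_tr)

lemma swapv_swapv [simp]: "swapv a b (swapv a b x) = x"
  by (simp add: vec_eq_iff)

lemma swapv_self [simp]: "swapv a a x = x"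
  by (simp add: vec_eq_iff)

lemma swapv_commute: "swapv a b x = swapv b a x"
  by (simp add: swapv_eq_pm tr_commute)

lemma swapv_swapv_conj:
  "swapv i j (swapv a b x) = swapv a b (swapv (tr a b i) (tr a b j) x)"
  by (simp only: swapv_eq_pm pm_pm tr_conj[of a b i j])

lemma swapv_eq_same: "x $ a = x $ b \<Longrightarrow> swapv a b x = x"
  by (simp add: vec_eq_iff tr_def)

lemma inner_swapv: "swapv a b x \<bullet> swapv a b (y::real^'n::finite) = x \<bullet> y"
proof -
  have "(\<Sum>l\<in>UNIV. x $ tr a b l * y $ tr a b l) = (\<Sum>l\<in>UNIV. x $ l * y $ l)"
    by (rule sum.reindex_bij_betw[OF bij_tr])
  thus ?thesis by (simp add: inner_vec_def)
qed

lemma sum_swapv: "(\<Sum>l\<in>UNIV. g (swapv a b x $ l)) = (\<Sum>l\<in>UNIV. g (x $ l))"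
proof -
  have "(\<Sum>l\<in>UNIV. g (x $ tr a b l)) = (\<Sum>l\<in>UNIV. g (x $ l))"
    by (rule sum.reindex_bij_betw[OF bij_tr])
  thus ?thesis by simp
qed

lemma norm_swapv [simp]: "norm (swapv a b x) = norm (x::real^'n::finite)"
  by (simp add: norm_eq_sqrt_inner inner_swapv)

text \<open>At a point where \<open>u\<close> is minimal every difference is \<le> 0, so the
  hypothesis leaves m u \<ge> 0 there. The maps \<open>\<phi> a b\<close> are arbitrary: they will
  be left or right compositions with transpositions on a set of maps, and a joint action on indices
  and maps.\<close>

lemma min_principle:
  fixes u :: "'x::finite \<Rightarrow> real" and \<phi> :: "'a::finite \<Rightarrow> 'b::finite \<Rightarrow> 'x \<Rightarrow> 'x"
  assumes m: "m > 0" and c: "c \<ge> 0"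
    and L: "\<And>x. m * u x + c * (\<Sum>a\<in>UNIV. \<Sum>b\<in>UNIV. u x - u (\<phi> a b x)) \<ge> 0"
  shows "u x \<ge> 0"
proof -
  have "\<exists>x0. \<forall>x. u x0 \<le> u x"
    using arg_min_if_finite(2)[of UNIV u] by (metis UNIV_I UNIV_not_empty finite not_le)
  then obtain x0 where x0: "\<And>x. u x0 \<le> u x" by blast
  have "(\<Sum>a\<in>UNIV. \<Sum>b\<in>UNIV. u x0 - u (\<phi> a b x0)) \<le> 0"
    by (intro sum_nonpos) (simp add: x0)
  hence "c * (\<Sum>a\<in>UNIV. \<Sum>b\<in>UNIV. u x0 - u (\<phi> a b x0)) \<le> 0"
    using c by (simp add: mult_nonneg_nonpos)
  with L[of x0] have "m * u x0 \<ge> 0" by linarith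
  with m x0[of x] show ?thesis by (simp add: zero_le_mult_iff)
qed

lemma zero_principle:
  fixes u :: "'x::finite \<Rightarrow> real" and \<phi> :: "'a::finite \<Rightarrow> 'b::finite \<Rightarrow> 'x \<Rightarrow> 'x"
  assumes m: "m > 0" and c: "c \<ge> 0"
    and L: "\<And>x. m * u x + c * (\<Sum>a\<in>UNIV. \<Sum>b\<in>UNIV. u x - u (\<phi> a b x)) = 0"
  shows "u x = 0"
proof -
  have "u x \<ge> 0" using min_principle[OF m c, of u \<phi>] L by simp
  moreover have "- u x \<ge> 0"
  proof (rule min_principle[OF m c, of "\<lambda>x. - u x" \<phi>])
    fix x
    have "(\<Sum>a\<in>UNIV. \<Sum>b\<in>UNIV. - u x - - u (\<phi> a b x)) = - (\<Sum>a\<in>UNIV. \<Sum>b\<in>UNIV. u x - u (\<phi> a b x))"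
      by (simp add: sum_negf[symmetric])
    with L[of x] show "0 \<le> m * - u x + c * (\<Sum>a\<in>UNIV. \<Sum>b\<in>UNIV. - u x - - u (\<phi> a b x))"
      by (simp add: minus_mult_right[symmetric] del: minus_mult_right)
  qed
  ultimately show ?thesis by simp
qed

lemma zero_principle_complex:
  fixes u :: "'x::finite \<Rightarrow> complex" and \<phi> :: "'a::finite \<Rightarrow> 'b::finite \<Rightarrow> 'x \<Rightarrow> 'x"
  assumes m: "m > 0" and c: "c \<ge> 0"
    and L: "\<And>x. of_real m * u x + of_real c * (\<Sum>a\<in>UNIV. \<Sum>b\<in>UNIV. u x - u (\<phi> a b x)) = 0"
  shows "u x = 0"
proof -
  have "Re (u x) = 0"
  proof (rule zero_principle[OF m c, where \<phi> = \<phi>])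
    fix x show "m * Re (u x) + c * (\<Sum>a\<in>UNIV. \<Sum>b\<in>UNIV. Re (u x) - Re (u (\<phi> a b x))) = 0"
      using arg_cong[OF L[of x], of Re] by simp
  qed
  moreover have "Im (u x) = 0"
  proof (rule zero_principle[OF m c, where \<phi> = \<phi>])
    fix x show "m * Im (u x) + c * (\<Sum>a\<in>UNIV. \<Sum>b\<in>UNIV. Im (u x) - Im (u (\<phi> a b x))) = 0"
      using arg_cong[OF L[of x], of Im] by simp
  qed
  ultimately show ?thesis by (simp add: complex_eq_iff)
qed

text \<open>The inverse of $m + \kappa \sum_{a,b} (1 - \sigma_{ab})$ is a positive combination of coordinate
  substitutions. All maps $w$ on the index set are admitted instead of permutations only, so that the
  weights live on a finite type; they vanish off the permutations (\<open>rweight_not_bij\<close>).\<close>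

definition resolvent_weights :: "real \<Rightarrow> real \<Rightarrow> (('n::finite \<Rightarrow> 'n) \<Rightarrow> real) \<Rightarrow> bool" where
  "resolvent_weights \<kappa> m c \<longleftrightarrow> (\<forall>w. 0 \<le> c w) \<and> (\<Sum>w\<in>UNIV. c w) = 1 / m \<and>
     (\<forall>w. m * c w + \<kappa> * (\<Sum>a\<in>UNIV. \<Sum>b\<in>UNIV. c w - c (tr a b \<circ> w)) = (if w = id then 1 else 0))"

lemma bij_comp_tr: "bij (\<lambda>w. tr a b \<circ> w)" "bij (\<lambda>w. w \<circ> tr a b)"
  by (rule o_bij[of "\<lambda>w. tr a b \<circ> w"]; simp add: fun_eq_iff)
     (rule o_bij[of "\<lambda>w. w \<circ> tr a b"]; simp add: fun_eq_iff)

text \<open>The system is square with trivial kernel by the zero principle, hence solvable; the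
  minimum principle gives the sign because the right-hand side, a point mass at \<open>id\<close>,
  is nonnegative. Summing the equations over \<open>w\<close> annihilates all differences, since
  composition with a transposition permutes the maps, and leaves the total mass 1/m.\<close>

lemma resolvent_weights_exist:
  assumes m: "m > 0" and c: "\<kappa> \<ge> 0"
  shows "\<exists>c :: ('n::finite \<Rightarrow> 'n) \<Rightarrow> real. resolvent_weights \<kappa> m c"
proof -
  define L :: "real^('n\<Rightarrow>'n) \<Rightarrow> real^('n\<Rightarrow>'n)" where
    "L = (\<lambda>v. \<chi> w. m * v $ w + \<kappa> * (\<Sum>a\<in>UNIV. \<Sum>b\<in>UNIV. v $ w - v $ (tr a b \<circ> w)))"
  have lin: "linear L"
    by (rule linearI)
       (simp_all add: L_def vec_eq_iff algebra_simps sum.distrib sum_subtractf sum_distrib_left)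
  have "inj L"
  proof (subst linear_injective_0[OF lin], intro allI impI)
    fix v assume "L v = 0"
    hence "m * v $ w + \<kappa> * (\<Sum>a\<in>UNIV. \<Sum>b\<in>UNIV. v $ w - v $ (tr a b \<circ> w)) = 0" for w
      by (simp add: L_def vec_eq_iff)
    from zero_principle[OF m c, where u = "\<lambda>w. v $ w" and \<phi> = "\<lambda>a b w. tr a b \<circ> w", OF this] show "v = 0"
      by (simp add: vec_eq_iff)
  qed
  hence "surj L" using linear_injective_imp_surjective lin by blast
  then obtain v where v: "L v = (\<chi> w. if w = id then 1 else 0)"
    by (metis surjD)
  define c where "c w = v $ w" for w
  have eq: "m * c w + \<kappa> * (\<Sum>a\<in>UNIV. \<Sum>b\<in>UNIV. c w - c (tr a b \<circ> w)) = (if w = id then 1 else 0)" for w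
    using v by (simp add: L_def vec_eq_iff c_def)
  have pos: "0 \<le> c w" for w
    by (rule min_principle[OF m \<open>\<kappa> \<ge> 0\<close>, where u = c and x = w and \<phi> = "\<lambda>a b w. tr a b \<circ> w"]) (simp add: eq)
  have "(\<Sum>w\<in>UNIV. m * c w + \<kappa> * (\<Sum>a\<in>UNIV. \<Sum>b\<in>UNIV. c w - c (tr a b \<circ> w))) = 1"
    by (simp add: eq)
  moreover have "(\<Sum>w\<in>UNIV. (\<Sum>a\<in>UNIV. \<Sum>b\<in>UNIV. c w - c (tr a b \<circ> w))) =
     (\<Sum>a\<in>UNIV. \<Sum>b\<in>UNIV. \<Sum>w\<in>UNIV. c w - c (tr a b \<circ> w))"
    by (subst sum.swap, rule sum.cong[OF refl], rule sum.swap)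
  moreover have "(\<Sum>w\<in>UNIV. c w - c (tr a b \<circ> w)) = 0" for a b
    using sum.reindex_bij_betw[OF bij_comp_tr(1), of c a b] by (simp add: sum_subtractf)
  ultimately have "m * (\<Sum>w\<in>UNIV. c w) = 1"
    by (simp add: sum.distrib sum_distrib_left[symmetric])
  hence "(\<Sum>w\<in>UNIV. c w) = 1 / m" using m by (simp add: field_simps)
  hence "resolvent_weights \<kappa> m c" unfolding resolvent_weights_def using pos eq by blast
  thus ?thesis by blast
qed

definition rweight :: "real \<Rightarrow> nat \<Rightarrow> ('n::finite \<Rightarrow> 'n) \<Rightarrow> real" where
  "rweight k m = (SOME c. resolvent_weights (k / 2) (real m) c)"

text \<open>The component of degree $m$ of $x \mapsto E_k^A(x, y)$. Since $\sum_j x_j T_j$ acts on it as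
  $m + k \sum_{a<b} (1 - \sigma_{ab})$, the eigenvalue equations force this recursion. The parameter
  $\kappa = k/2$ is due to summation over ordered pairs.\<close>

fun dunkl_e :: "real \<Rightarrow> nat \<Rightarrow> real^'n::finite \<Rightarrow> real^'n \<Rightarrow> real" where
  "dunkl_e k 0 x y = 1"
| "dunkl_e k (Suc m) x y = (\<Sum>w\<in>UNIV. rweight k (Suc m) w * (pm w x \<bullet> y) * dunkl_e k m (pm w x) y)"

section \<open>Components of the kernel: recursion, equivariance, symmetry and growth\<close>

locale dunkl =
  fixes k :: real
  assumes k_nonneg: "k \<ge> 0"
begin

abbreviation e where "e \<equiv> dunkl_e k"

lemma rweight_resolvent:
  assumes "m > 0"
  shows "resolvent_weights (k / 2) (real m) (rweight k m :: ('n::finite \<Rightarrow> 'n) \<Rightarrow> real)"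
  unfolding rweight_def using someI_ex[OF resolvent_weights_exist[of "real m" "k/2"]] k_nonneg assms by simp

text \<open>Substituting \<open>tr a b \<circ> w\<close> for \<open>w\<close> in the sum that
  defines \<open>e (Suc m)\<close> moves a swap of \<open>x\<close> onto the weights. The operator
  then acts on the weights alone and turns them into the point mass at \<open>id\<close>.\<close>

lemma e_recursion:
  "real (Suc m) * e (Suc m) x y + k / 2 * (\<Sum>a\<in>UNIV. \<Sum>b\<in>UNIV. e (Suc m) x y - e (Suc m) (swapv a b x) y)
     = (x \<bullet> y) * e m x y" for x y :: "real^'n::finite"
proof -
  let ?c = "rweight k (Suc m) :: ('n \<Rightarrow> 'n) \<Rightarrow> real"
  define v where "v w = (pm w x \<bullet> y) * e m (pm w x) y" for w
  have rw': "real (Suc m) * ?c w + k / 2 * (\<Sum>a\<in>UNIV. \<Sum>b\<in>UNIV. ?c w - ?c (tr a b \<circ> w)) = (if w = id then 1 else 0)" for w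
    using rweight_resolvent[of "Suc m"] unfolding resolvent_weights_def by blast
  have 1: "e (Suc m) x y = (\<Sum>w\<in>UNIV. ?c w * v w)"
    by (simp add: v_def mult.assoc)
  have 2: "e (Suc m) (swapv a b x) y = (\<Sum>w\<in>UNIV. ?c (tr a b \<circ> w) * v w)" for a b
  proof -
    have "e (Suc m) (swapv a b x) y = (\<Sum>w\<in>UNIV. ?c w * v (tr a b \<circ> w))"
      by (simp add: v_def mult.assoc swapv_eq_pm pm_pm)
    also have "\<dots> = (\<Sum>w\<in>UNIV. ?c (tr a b \<circ> w) * v (tr a b \<circ> (tr a b \<circ> w)))"
      by (rule sum.reindex_bij_betw[OF bij_comp_tr(1), symmetric])
    finally show ?thesis by simp
  qed
  have "real (Suc m) * e (Suc m) x y + k / 2 * (\<Sum>a\<in>UNIV. \<Sum>b\<in>UNIV. e (Suc m) x y - e (Suc m) (swapv a b x) y)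
     = (\<Sum>w\<in>UNIV. real (Suc m) * (?c w * v w)) + k / 2 * (\<Sum>a\<in>UNIV. \<Sum>b\<in>UNIV. \<Sum>w\<in>UNIV. (?c w - ?c (tr a b \<circ> w)) * v w)"
    unfolding 2 unfolding 1 by (simp add: sum_subtractf left_diff_distrib sum_distrib_left)
  also have "(\<Sum>a\<in>UNIV. \<Sum>b\<in>UNIV. \<Sum>w\<in>UNIV. (?c w - ?c (tr a b \<circ> w)) * v w)
     = (\<Sum>w\<in>UNIV. \<Sum>a\<in>UNIV. \<Sum>b\<in>UNIV. (?c w - ?c (tr a b \<circ> w)) * v w)"
    by (subst (2) sum.swap, rule sum.cong[OF refl], rule sum.swap)
  also have "(\<Sum>w\<in>UNIV. real (Suc m) * (?c w * v w)) + k / 2 * \<dots>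
     = (\<Sum>w\<in>UNIV. (real (Suc m) * ?c w + k / 2 * (\<Sum>a\<in>UNIV. \<Sum>b\<in>UNIV. ?c w - ?c (tr a b \<circ> w))) * v w)"
    by (simp only: sum_distrib_left sum_distrib_right sum.distrib ring_distribs mult.assoc)
  also have "\<dots> = v id"
    unfolding rw' by (simp add: if_distrib[of "\<lambda>c. c * _"] cong: if_cong)
  finally show ?thesis by (simp add: v_def)
qed

text \<open>The equation at \<open>x\<close> couples only values on the orbit of \<open>x\<close>.
  Pulled back along \<open>w \<mapsto> pm w x\<close>, the difference of the two functions lives on
  a finite type, where the zero principle applies.\<close>

lemma radial_unique:
  fixes u1 u2 :: "real^'n::finite \<Rightarrow> real"
  assumes m: "m > 0"
    and eq: "\<And>x. m * u1 x + k / 2 * (\<Sum>a\<in>UNIV. \<Sum>b\<in>UNIV. u1 x - u1 (swapv a b x))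
          = m * u2 x + k / 2 * (\<Sum>a\<in>UNIV. \<Sum>b\<in>UNIV. u2 x - u2 (swapv a b x))"
  shows "u1 x = u2 x"
proof -
  define u where "u w = u1 (pm w x) - u2 (pm w x)" for w
  have "u id = 0"
  proof (rule zero_principle[OF m, where c = "k/2" and u = u and x = id and \<phi> = "\<lambda>a b w. w \<circ> tr a b"])
    show "0 \<le> k / 2" using k_nonneg by simp
    fix w
    have p: "pm (w \<circ> tr a b) x = swapv a b (pm w x)" for a b by (simp add: swapv_eq_pm pm_pm)
    show "m * u w + k / 2 * (\<Sum>a\<in>UNIV. \<Sum>b\<in>UNIV. u w - u (w \<circ> tr a b)) = 0"
      using eq[of "pm w x"] by (simp add: u_def p sum_subtractf sum.distrib algebra_simps)
  qed
  thus ?thesis by (simp add: u_def)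
qed

lemma sum_tr_conj: "(\<Sum>a\<in>UNIV. \<Sum>b\<in>UNIV. g (tr i j a) (tr i j b)) = (\<Sum>a\<in>UNIV. \<Sum>b\<in>UNIV. g a b)"
  for g :: "'n::finite \<Rightarrow> 'n \<Rightarrow> 'a::comm_monoid_add"
proof -
  have "(\<Sum>a\<in>UNIV. \<Sum>b\<in>UNIV. g (tr i j a) (tr i j b)) = (\<Sum>a\<in>UNIV. \<Sum>b\<in>UNIV. g (tr i j a) b)"
    by (intro sum.cong refl sum.reindex_bij_betw[OF bij_tr])
  also have "\<dots> = (\<Sum>a\<in>UNIV. \<Sum>b\<in>UNIV. g a b)"
    by (rule sum.reindex_bij_betw[OF bij_tr])
  finally show ?thesis .
qed

text \<open>Conjugation by a transposition only permutes the pairs (a, b) in the reflection sum, so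
  the simultaneously swapped component solves the same recursion.\<close>

lemma e_equivariant: "e m (swapv i j x) (swapv i j y) = e m x (y :: real^'n::finite)"
proof (induction m arbitrary: x)
  case (Suc m)
  show ?case
  proof (rule radial_unique[of "real (Suc m)" "\<lambda>x. e (Suc m) (swapv i j x) (swapv i j y)" "\<lambda>x. e (Suc m) x y"])
    fix x
    let ?g = "\<lambda>a b. e (Suc m) (swapv i j x) (swapv i j y) - e (Suc m) (swapv a b (swapv i j x)) (swapv i j y)"
    have "(\<Sum>a\<in>UNIV. \<Sum>b\<in>UNIV. e (Suc m) (swapv i j x) (swapv i j y) - e (Suc m) (swapv i j (swapv a b x)) (swapv i j y))
      = (\<Sum>a\<in>UNIV. \<Sum>b\<in>UNIV. ?g (tr i j a) (tr i j b))"
      by (intro sum.cong refl) (subst (2) swapv_swapv_conj, simp)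
    also have "\<dots> = (\<Sum>a\<in>UNIV. \<Sum>b\<in>UNIV. ?g a b)"
      by (rule sum_tr_conj)
    finally show "real (Suc m) * e (Suc m) (swapv i j x) (swapv i j y) + k / 2 *
         (\<Sum>a\<in>UNIV. \<Sum>b\<in>UNIV. e (Suc m) (swapv i j x) (swapv i j y) - e (Suc m) (swapv i j (swapv a b x)) (swapv i j y))
       = real (Suc m) * e (Suc m) x y + k / 2 * (\<Sum>a\<in>UNIV. \<Sum>b\<in>UNIV. e (Suc m) x y - e (Suc m) (swapv a b x) y)"
      unfolding e_recursion using e_recursion[of m "swapv i j x" "swapv i j y"]
      by (simp only: inner_swapv Suc.IH)
  qed simp
qed simp

lemma e_swapv_right: "e m x (swapv i j y) = e m (swapv i j x) y"
  using e_equivariant[of m i j "swapv i j x" y] by simp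

text \<open>By equivariance, swapping \<open>x\<close> and swapping \<open>y\<close> have the same
  effect. The recursion in the first argument is therefore also one in the second, and both sides
  solve it with the same right-hand side.\<close>

lemma e_sym: "e m x y = e m y (x :: real^'n::finite)"
proof (induction m arbitrary: x y)
  case (Suc m)
  show ?case
  proof (rule radial_unique[of "real (Suc m)" "\<lambda>x. e (Suc m) x y" "\<lambda>x. e (Suc m) y x"])
    fix x :: "real^'n"
    show "real (Suc m) * e (Suc m) x y + k / 2 * (\<Sum>a\<in>UNIV. \<Sum>b\<in>UNIV. e (Suc m) x y - e (Suc m) (swapv a b x) y)
       = real (Suc m) * e (Suc m) y x + k / 2 * (\<Sum>a\<in>UNIV. \<Sum>b\<in>UNIV. e (Suc m) y x - e (Suc m) y (swapv a b x))"
      unfolding e_swapv_right e_recursion by (simp only: inner_commute Suc.IH)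
  qed simp
qed simp

lemma e_scale: "e m (t *\<^sub>R x) y = t ^ m * e m x y"
proof (induction m arbitrary: x)
  case (Suc m)
  have p: "pm w (t *\<^sub>R x) = t *\<^sub>R pm w x" for w by (simp add: vec_eq_iff)
  show ?case by (simp add: p Suc.IH sum_distrib_left mult_ac)
qed simp

text \<open>The bound on \<open>x\<close> is in the maximum norm because that norm does not grow
  under \<open>pm w\<close> for any map \<open>w\<close>. The factorial collects the total masses
  1/1, ..., 1/m of the weights.\<close>

lemma e_bound:
  fixes x y :: "real^'n::finite"
  assumes X: "\<And>i. \<bar>x $ i\<bar> \<le> X"
  shows "\<bar>e m x y\<bar> \<le> (X * (\<Sum>i\<in>UNIV. \<bar>y $ i\<bar>)) ^ m / fact m"
  using X
proof (induction m arbitrary: x)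
  case (Suc m)
  let ?Y = "\<Sum>i\<in>UNIV. \<bar>y $ i\<bar>"
  have X0: "X \<ge> 0" using Suc.prems by (meson abs_ge_zero order_trans)
  have nn: "rweight k (Suc m) w \<ge> 0" for w :: "'n \<Rightarrow> 'n"
    using rweight_resolvent[of "Suc m"] unfolding resolvent_weights_def by auto
  have s1: "(\<Sum>w\<in>UNIV. rweight k (Suc m) (w::'n \<Rightarrow> 'n)) = 1 / real (Suc m)"
    using rweight_resolvent[of "Suc m"] unfolding resolvent_weights_def by auto
  have in1: "\<bar>pm w x \<bullet> y\<bar> \<le> X * ?Y" for w
  proof -
    have "\<bar>pm w x \<bullet> y\<bar> \<le> (\<Sum>i\<in>UNIV. \<bar>x $ w i * y $ i\<bar>)"
      unfolding inner_vec_def by (simp add: sum_abs)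
    also have "\<dots> \<le> (\<Sum>i\<in>UNIV. X * \<bar>y $ i\<bar>)"
      by (intro sum_mono) (simp add: abs_mult mult_right_mono Suc.prems)
    finally show ?thesis by (simp add: sum_distrib_left)
  qed
  have "\<bar>e (Suc m) x y\<bar> \<le> (\<Sum>w\<in>UNIV. \<bar>rweight k (Suc m) w * (pm w x \<bullet> y) * e m (pm w x) y\<bar>)"
    by (simp add: sum_abs)
  also have "\<dots> \<le> (\<Sum>w\<in>(UNIV::('n\<Rightarrow>'n) set). rweight k (Suc m) w * ((X * ?Y) * ((X * ?Y) ^ m / fact m)))"
  proof (rule sum_mono)
    fix w :: "'n \<Rightarrow> 'n"
    have "\<bar>e m (pm w x) y\<bar> \<le> (X * ?Y) ^ m / fact m"
      by (rule Suc.IH) (simp add: Suc.prems)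
    hence "\<bar>pm w x \<bullet> y\<bar> * \<bar>e m (pm w x) y\<bar> \<le> (X * ?Y) * ((X * ?Y) ^ m / fact m)"
      using X0 by (intro mult_mono in1) (auto intro!: mult_nonneg_nonneg sum_nonneg)
    hence "rweight k (Suc m) w * (\<bar>pm w x \<bullet> y\<bar> * \<bar>e m (pm w x) y\<bar>) \<le> rweight k (Suc m) w * ((X * ?Y) * ((X * ?Y) ^ m / fact m))"
      by (rule mult_left_mono) (rule nn)
    thus "\<bar>rweight k (Suc m) w * (pm w x \<bullet> y) * e m (pm w x) y\<bar> \<le> rweight k (Suc m) w * ((X * ?Y) * ((X * ?Y) ^ m / fact m))"
      using nn[of w] by (simp only: abs_mult mult.assoc abs_of_nonneg)
  qed
  also have "\<dots> = (\<Sum>w\<in>(UNIV::('n\<Rightarrow>'n) set). rweight k (Suc m) w) * ((X * ?Y) * ((X * ?Y) ^ m / fact m))"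
    by (rule sum_distrib_right[symmetric])
  also have "\<dots> = (X * ?Y) ^ Suc m / fact (Suc m)"
    unfolding s1 by (simp add: field_simps)
  finally show ?case .
qed simp

end

section \<open>Dunkl operators on polynomials\<close>

declare dunkl_e.simps(2) [simp del]

definition pd :: "'n::finite \<Rightarrow> (real^'n \<Rightarrow> complex) \<Rightarrow> real^'n \<Rightarrow> complex" where
  "pd i p x = vector_derivative (\<lambda>t. p (x + t *\<^sub>R axis i 1)) (at 0)"

text \<open>On the hyperplane $x_i = x_j$ this is the limit of the difference quotient of a smooth function.\<close>

definition divdiff :: "'n::finite \<Rightarrow> 'n \<Rightarrow> (real^'n \<Rightarrow> complex) \<Rightarrow> real^'n \<Rightarrow> complex" where
  "divdiff i j p x = (if x $ i = x $ j then pd i p x - pd j p x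
     else (p x - p (swapv i j x)) / of_real (x $ i - x $ j))"

definition dunkl_op :: "real \<Rightarrow> 'n::finite \<Rightarrow> (real^'n \<Rightarrow> complex) \<Rightarrow> real^'n \<Rightarrow> complex" where
  "dunkl_op k i p x = pd i p x + of_real k * (\<Sum>j\<in>UNIV - {i}. divdiff i j p x)"

text \<open>Products are generated by single coordinates only, so that an operator identity on
  polynomials follows by induction from the commutator with multiplication by one
  coordinate.\<close>

inductive cpoly :: "(real^'n::finite \<Rightarrow> complex) \<Rightarrow> bool" where
  cpoly_const: "cpoly (\<lambda>_. c)"
| cpoly_add: "cpoly p \<Longrightarrow> cpoly q \<Longrightarrow> cpoly (\<lambda>x. p x + q x)"
| cpoly_coord: "cpoly p \<Longrightarrow> cpoly (\<lambda>x. of_real (x $ l) * p x)"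

inductive hpoly :: "nat \<Rightarrow> (real^'n::finite \<Rightarrow> complex) \<Rightarrow> bool" where
  hpoly_const: "hpoly 0 (\<lambda>_. c)"
| hpoly_zero: "hpoly m (\<lambda>_. 0)"
| hpoly_add: "hpoly m p \<Longrightarrow> hpoly m q \<Longrightarrow> hpoly m (\<lambda>x. p x + q x)"
| hpoly_coord: "hpoly m p \<Longrightarrow> hpoly (Suc m) (\<lambda>x. of_real (x $ l) * p x)"

lemma hpoly_imp_cpoly: "hpoly m p \<Longrightarrow> cpoly p"
  by (induction rule: hpoly.induct) (auto intro: cpoly.intros)

lemma hpoly_cmult: "hpoly m p \<Longrightarrow> hpoly m (\<lambda>x. c * p x)"
proof (induction rule: hpoly.induct)
  case (hpoly_add m p q) thus ?case by (simp add: distrib_left hpoly.hpoly_add)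
next
  case (hpoly_coord m p l) 
  from hpoly.hpoly_coord[OF this(2), of l] show ?case by (simp add: mult_ac)
qed (auto intro: hpoly.intros)

lemma hpoly_uminus: "hpoly m p \<Longrightarrow> hpoly m (\<lambda>x. - p x)"
  using hpoly_cmult[of m p "-1"] by simp

lemma hpoly_diff: "hpoly m p \<Longrightarrow> hpoly m q \<Longrightarrow> hpoly m (\<lambda>x. p x - q x)"
  using hpoly_add[of m p "\<lambda>x. -1 * q x"] hpoly_cmult[of m q "-1"] by simp

lemma hpoly_sum: "(\<And>i. i \<in> A \<Longrightarrow> hpoly m (p i)) \<Longrightarrow> hpoly m (\<lambda>x. \<Sum>i\<in>A. p i x)"
  by (induction A rule: infinite_finite_induct) (auto intro: hpoly_zero hpoly_add)

lemma hpoly_pm: "hpoly m p \<Longrightarrow> hpoly m (\<lambda>x. p (pm w x))"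
proof (induction rule: hpoly.induct)
  case (hpoly_coord m p l) 
  from hpoly.hpoly_coord[OF this(2), of "w l"] show ?case by simp
qed (auto intro: hpoly.intros)

lemma hpoly_swapv: "hpoly m p \<Longrightarrow> hpoly m (\<lambda>x. p (swapv a b x))"
  unfolding swapv_eq_pm by (rule hpoly_pm)

lemma cpoly_cmult: "cpoly p \<Longrightarrow> cpoly (\<lambda>x. c * p x)"
proof (induction rule: cpoly.induct)
  case (cpoly_add p q) thus ?case by (simp add: distrib_left cpoly.cpoly_add)
next
  case (cpoly_coord p l) 
  from cpoly.cpoly_coord[OF this(2), of l] show ?case by (simp add: mult_ac)
qed (auto intro: cpoly.intros)

lemma cpoly_uminus: "cpoly p \<Longrightarrow> cpoly (\<lambda>x. - p x)"
  using cpoly_cmult[of p "-1"] by simp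

lemma cpoly_diff: "cpoly p \<Longrightarrow> cpoly q \<Longrightarrow> cpoly (\<lambda>x. p x - q x)"
  using cpoly_add[of p "\<lambda>x. -1 * q x"] cpoly_cmult[of q "-1"] by simp

lemma cpoly_sum: "(\<And>i. i \<in> A \<Longrightarrow> cpoly (p i)) \<Longrightarrow> cpoly (\<lambda>x. \<Sum>i\<in>A. p i x)"
  by (induction A rule: infinite_finite_induct) (auto intro: cpoly_const cpoly_add)

lemma cpoly_pm: "cpoly p \<Longrightarrow> cpoly (\<lambda>x. p (pm w x))"
proof (induction rule: cpoly.induct)
  case (cpoly_coord p l) 
  from cpoly.cpoly_coord[OF this(2), of "w l"] show ?case by simp
qed (auto intro: cpoly.intros)

lemma cpoly_swapv: "cpoly p \<Longrightarrow> cpoly (\<lambda>x. p (swapv a b x))"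
  unfolding swapv_eq_pm by (rule cpoly_pm)

lemma cpoly_mult: "cpoly p \<Longrightarrow> cpoly q \<Longrightarrow> cpoly (\<lambda>x. p x * q x)"
proof (induction rule: cpoly.induct)
  case (cpoly_const c) thus ?case by (rule cpoly_cmult)
next
  case (cpoly_add p1 p2) thus ?case by (simp add: distrib_right cpoly.cpoly_add)
next
  case (cpoly_coord p l) 
  from cpoly.cpoly_coord[OF cpoly_coord(2), of l] cpoly_coord show ?case by (simp add: mult_ac)
qed

lemma cpoly_continuous: "cpoly p \<Longrightarrow> continuous_on A p"
  by (induction rule: cpoly.induct) (auto intro!: continuous_intros)

lemma cpoly_measurable: "cpoly p \<Longrightarrow> p \<in> borel_measurable borel"
  by (intro borel_measurable_continuous_onI cpoly_continuous)

lemma nth_has_vector_derivative: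
  "((\<lambda>t. complex_of_real ((x + t *\<^sub>R axis i 1) $ l)) has_vector_derivative (if l = i then 1 else 0)) (at 0)"
proof -
  have "((\<lambda>t. complex_of_real (x $ l + t * (if l = i then 1 else 0))) has_vector_derivative (if l = i then 1 else 0)) (at 0)"
    by (rule has_vector_derivative_eq_rhs, (rule derivative_eq_intros refl)+) (auto simp: has_vector_derivative_def)
  thus ?thesis
    by (simp add: axis_def if_distrib cong: if_cong)
qed

lemma cpoly_has_pd:
  "cpoly p \<Longrightarrow> ((\<lambda>t. p (x + t *\<^sub>R axis i 1)) has_vector_derivative pd i p x) (at 0)"
proof -
  assume "cpoly p"
  hence "(\<lambda>t. p (x + t *\<^sub>R axis i 1)) differentiable (at 0)"
  proof (induction rule: cpoly.induct)
    case (cpoly_coord p l)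
    have "(\<lambda>t. complex_of_real ((x + t *\<^sub>R axis i 1) $ l)) differentiable (at 0)"
      using nth_has_vector_derivative by (rule differentiableI_vector)
    thus ?case using cpoly_coord by (intro differentiable_mult)
  qed auto
  thus ?thesis unfolding pd_def by (rule vector_derivative_works[THEN iffD1])
qed

lemma pd_eqI: "((\<lambda>t. p (x + t *\<^sub>R axis i 1)) has_vector_derivative D) (at 0) \<Longrightarrow> pd i p x = D"
  unfolding pd_def by (rule vector_derivative_at)

lemma pd_const [simp]: "pd i (\<lambda>_. c) x = 0"
  by (rule pd_eqI) simp

lemma pd_add: "cpoly p \<Longrightarrow> cpoly q \<Longrightarrow> pd i (\<lambda>x. p x + q x) x = pd i p x + pd i q x"
  by (rule pd_eqI, intro has_vector_derivative_add cpoly_has_pd)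

lemma pd_mult: "cpoly p \<Longrightarrow> cpoly q \<Longrightarrow> pd i (\<lambda>x. p x * q x) x = pd i p x * q x + p x * pd i q x"
  by (rule pd_eqI) (use has_vector_derivative_mult[OF cpoly_has_pd[of p x i] cpoly_has_pd[of q x i]] in \<open>simp add: add.commute\<close>)

lemma pd_cmult: "cpoly p \<Longrightarrow> pd i (\<lambda>x. c * p x) x = c * pd i p x"
  using pd_mult[OF cpoly_const[of c], of p] by simp

lemma cpoly_nth: "cpoly (\<lambda>x. of_real (x $ l))"
  using cpoly_coord[OF cpoly_const[of 1]] by simp

lemma pd_nth: "pd i (\<lambda>x. of_real (x $ l)) x = (if l = i then 1 else 0)"
  by (rule pd_eqI) (rule nth_has_vector_derivative)

lemma pd_coord: "cpoly p \<Longrightarrow> pd i (\<lambda>x. of_real (x $ l) * p x) x = of_real (x $ l) * pd i p x + (if l = i then p x else 0)"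
  using pd_mult[OF cpoly_nth[of l], of p i x] by (simp add: pd_nth)

lemma cpoly_pd: "cpoly p \<Longrightarrow> cpoly (pd i p)"
proof (induction rule: cpoly.induct)
  case (cpoly_const c)
  have "pd i (\<lambda>_. c) = (\<lambda>_. 0)" by (simp add: fun_eq_iff)
  thus ?case by (simp add: cpoly.cpoly_const)
next
  case (cpoly_add p q)
  have "pd i (\<lambda>x. p x + q x) = (\<lambda>x. pd i p x + pd i q x)" using cpoly_add by (simp add: fun_eq_iff pd_add)
  thus ?case using cpoly_add by (simp add: cpoly.cpoly_add)
next
  case (cpoly_coord p l)
  have "pd i (\<lambda>x. of_real (x $ l) * p x) = (\<lambda>x. of_real (x $ l) * pd i p x + (if l = i then p x else 0))"
    using cpoly_coord by (simp add: fun_eq_iff pd_coord)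
  thus ?case using cpoly_coord by (cases "l = i") (auto intro!: cpoly.intros)
qed

lemma divdiff_const [simp]: "divdiff i j (\<lambda>_. c) x = 0"
  by (simp add: divdiff_def)

lemma divdiff_add: "cpoly p \<Longrightarrow> cpoly q \<Longrightarrow> divdiff i j (\<lambda>x. p x + q x) x = divdiff i j p x + divdiff i j q x"
  by (simp add: divdiff_def pd_add diff_divide_distrib add_divide_distrib)

text \<open>The Leibniz rule for divided differences. Thanks to the limit value built into
  \<open>divdiff\<close> it persists on the hyperplane x_i = x_j, where the correction term comes
  from the derivative of the coordinate.\<close>

lemma divdiff_coord:
  assumes "cpoly p" "j \<noteq> i"
  shows "divdiff i j (\<lambda>x. of_real (x $ l) * p x) x =
     of_real (x $ l) * divdiff i j p x + (if l = i then p (swapv i j x) else if l = j then - p (swapv i j x) else 0)"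
proof (cases "x $ i = x $ j")
  case True
  thus ?thesis using assms by (auto simp: divdiff_def pd_coord swapv_eq_same right_diff_distrib)
next
  case False
  thus ?thesis using assms by (auto simp: divdiff_def tr_def divide_simps) (auto simp: algebra_simps)
qed

lemma dunkl_op_const [simp]: "dunkl_op k i (\<lambda>_. c) x = 0"
  by (simp add: dunkl_op_def)

lemma dunkl_op_add: "cpoly p \<Longrightarrow> cpoly q \<Longrightarrow> dunkl_op k i (\<lambda>x. p x + q x) x = dunkl_op k i p x + dunkl_op k i q x"
  by (simp add: dunkl_op_def pd_add divdiff_add sum.distrib algebra_simps)

text \<open>The commutator of \<open>dunkl_op k i\<close> with a coordinate involves reflections but
  no derivative. The later inductions over polynomials rest on this.\<close>

lemma dunkl_op_coord:
  assumes "cpoly p"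
  shows "dunkl_op k i (\<lambda>x. of_real (x $ l) * p x) x = of_real (x $ l) * dunkl_op k i p x +
    (if l = i then p x + of_real k * (\<Sum>j\<in>UNIV - {i}. p (swapv i j x)) else - of_real k * p (swapv i l x))"
proof -
  have "(\<Sum>j\<in>UNIV - {i}. divdiff i j (\<lambda>x. of_real (x $ l) * p x) x) =
     (\<Sum>j\<in>UNIV - {i}. of_real (x $ l) * divdiff i j p x + (if l = i then p (swapv i j x) else if l = j then - p (swapv i j x) else 0))"
    using assms by (intro sum.cong refl divdiff_coord) auto
  also have "\<dots> = of_real (x $ l) * (\<Sum>j\<in>UNIV - {i}. divdiff i j p x) +
     (if l = i then (\<Sum>j\<in>UNIV - {i}. p (swapv i j x)) else - p (swapv i l x))"
    by (auto simp: sum.distrib sum_distrib_left)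
  finally have *: "(\<Sum>j\<in>UNIV - {i}. divdiff i j (\<lambda>x. of_real (x $ l) * p x) x) = \<dots>" .
  show ?thesis
    unfolding dunkl_op_def pd_coord[OF assms] * by (auto simp: algebra_simps)
qed

lemma dunkl_op_coord_fun:
  "cpoly p \<Longrightarrow> dunkl_op k i (\<lambda>x. of_real (x $ l) * p x) = (\<lambda>x. of_real (x $ l) * dunkl_op k i p x +
    (if l = i then p x + of_real k * (\<Sum>j\<in>UNIV - {i}. p (swapv i j x)) else - of_real k * p (swapv i l x)))"
  by (rule ext) (rule dunkl_op_coord)

lemma divdiff_cmult: "cpoly p \<Longrightarrow> divdiff i j (\<lambda>x. c * p x) x = c * divdiff i j p x"
  by (simp add: divdiff_def pd_cmult right_diff_distrib)

lemma dunkl_op_cmult: "cpoly p \<Longrightarrow> dunkl_op k i (\<lambda>x. c * p x) x = c * dunkl_op k i p x"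
  by (simp add: dunkl_op_def pd_cmult divdiff_cmult sum_distrib_left distrib_left mult_ac)

lemma dunkl_op_diff: "cpoly p \<Longrightarrow> cpoly q \<Longrightarrow> dunkl_op k i (\<lambda>x. p x - q x) x = dunkl_op k i p x - dunkl_op k i q x"
  using dunkl_op_add[of p "\<lambda>x. -1 * q x"] cpoly_cmult[of q "-1"] dunkl_op_cmult[of q k i "-1"] by simp

lemma dunkl_op_sum: "finite A \<Longrightarrow> (\<And>j. j \<in> A \<Longrightarrow> cpoly (p j)) \<Longrightarrow>
   dunkl_op k i (\<lambda>x. \<Sum>j\<in>A. p j x) x = (\<Sum>j\<in>A. dunkl_op k i (p j) x)"
  by (induction A rule: finite_induct) (auto simp: dunkl_op_add cpoly_sum)

text \<open>Degree zero needs a conclusion of its own, annihilation, because degrees are natural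
  numbers. With it the summand x_l T_i p of the induction step is homogeneous of degree m even for m
  = 0.\<close>

lemma hpoly_dunkl_op_aux:
  "hpoly n p \<Longrightarrow> (case n of 0 \<Rightarrow> dunkl_op k i p = (\<lambda>_. 0) | Suc m \<Rightarrow> hpoly m (dunkl_op k i p))"
proof (induction rule: hpoly.induct)
  case (hpoly_const c)
  show ?case by (simp add: fun_eq_iff)
next
  case (hpoly_zero m)
  have "dunkl_op k i (\<lambda>_. 0) = (\<lambda>_::real^'a. 0)" by (simp add: fun_eq_iff)
  thus ?case by (auto split: nat.split intro: hpoly.hpoly_zero)
next
  case (hpoly_add m p q)
  have "dunkl_op k i (\<lambda>x. p x + q x) = (\<lambda>x. dunkl_op k i p x + dunkl_op k i q x)"
    using hpoly_add by (auto simp: fun_eq_iff dunkl_op_add hpoly_imp_cpoly)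
  thus ?case using hpoly_add by (auto split: nat.splits intro: hpoly.hpoly_add)
next
  case (hpoly_coord m p l)
  have 1: "hpoly m (\<lambda>x. of_real (x $ l) * dunkl_op k i p x)"
    using hpoly_coord.IH by (cases m) (auto intro: hpoly.intros)
  have 2: "hpoly m (\<lambda>x. if l = i then p x + of_real k * (\<Sum>j\<in>UNIV - {i}. p (swapv i j x)) else - of_real k * p (swapv i l x))"
    using hpoly_coord.hyps by (cases "l = i") (auto intro!: hpoly_add hpoly_sum hpoly_cmult hpoly_swapv hpoly_uminus)
  show ?case
    using hpoly_add[OF 1 2] by (simp add: dunkl_op_coord_fun[OF hpoly_imp_cpoly[OF hpoly_coord.hyps]])
qed

lemma hpoly_dunkl_op: "hpoly (Suc m) p \<Longrightarrow> hpoly m (dunkl_op k i p)"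
  using hpoly_dunkl_op_aux[of "Suc m"] by simp

lemma cpoly_dunkl_op: "cpoly p \<Longrightarrow> cpoly (dunkl_op k i p)"
proof (induction rule: cpoly.induct)
  case (cpoly_const c)
  have "dunkl_op k i (\<lambda>_. c) = (\<lambda>_. 0)" by (simp add: fun_eq_iff)
  thus ?case by (simp add: cpoly.cpoly_const)
next
  case (cpoly_add p q)
  have "dunkl_op k i (\<lambda>x. p x + q x) = (\<lambda>x. dunkl_op k i p x + dunkl_op k i q x)"
    using cpoly_add by (simp add: fun_eq_iff dunkl_op_add)
  thus ?case using cpoly_add by (simp add: cpoly.cpoly_add)
next
  case (cpoly_coord p l)
  show ?case unfolding dunkl_op_coord_fun[OF cpoly_coord.hyps]
    using cpoly_coord by (cases "l = i") (auto intro!: cpoly.intros cpoly_sum cpoly_cmult cpoly_swapv cpoly_uminus cpoly_diff)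
qed

section \<open>Equivariance, commutativity and Euler identity of the Dunkl operators\<close>

lemma dunkl_op_swapv:
  "cpoly p \<Longrightarrow> dunkl_op k i (\<lambda>x. p (swapv a b x)) x = dunkl_op k (tr a b i) p (swapv a b x)"
proof (induction arbitrary: x rule: cpoly.induct)
  case (cpoly_add p q)
  thus ?case by (simp add: dunkl_op_add cpoly_swapv)
next
  case (cpoly_coord p l)
  have s: "p (swapv a b (swapv i j x)) = p (swapv (tr a b i) (tr a b j) (swapv a b x))" for j
    using swapv_swapv_conj[of "tr a b i" "tr a b j" a b x] by simp
  have iff: "tr a b l = i \<longleftrightarrow> l = tr a b i" by (metis tr_tr)
  have bij: "(\<Sum>j\<in>UNIV - {tr a b i}. g j) = (\<Sum>j\<in>UNIV - {i}. g (tr a b j))" for g :: "'a \<Rightarrow> complex"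
    by (rule sum.reindex_bij_witness[where i = "tr a b" and j = "tr a b"]) auto
  have "dunkl_op k i (\<lambda>x. complex_of_real (swapv a b x $ l) * p (swapv a b x)) x
     = dunkl_op k i (\<lambda>x. complex_of_real (x $ tr a b l) * p (swapv a b x)) x" by simp
  also have "\<dots> = complex_of_real (x $ tr a b l) * dunkl_op k (tr a b i) p (swapv a b x) +
     (if tr a b l = i then p (swapv a b x) + of_real k * (\<Sum>j\<in>UNIV - {i}. p (swapv a b (swapv i j x)))
      else - of_real k * p (swapv a b (swapv i (tr a b l) x)))"
    using cpoly_coord by (simp add: dunkl_op_coord cpoly_swapv)
  also have "\<dots> = dunkl_op k (tr a b i) (\<lambda>x. complex_of_real (x $ l) * p x) (swapv a b x)"
    unfolding dunkl_op_coord[OF cpoly_coord.hyps] s bij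
    using iff by (cases "l = tr a b i") simp_all
  finally show ?case .
qed (simp_all)

text \<open>The induction step of commutativity for l \<noteq> i; the case l = i follows on
  exchanging i and j. For l = j the commutator of T_j with x_j is a sum of reflections through j.
  T_i passes each of them unchanged except the one with b = i, which turns T_i into T_j; this
  surplus is matched by the other order of application.\<close>

lemma dunkl_op_commute_coord:
  assumes p: "cpoly p" and IH: "\<And>x. dunkl_op k i (dunkl_op k j p) x = dunkl_op k j (dunkl_op k i p) x" and "i \<noteq> j" "l \<noteq> i"
  shows "dunkl_op k i (dunkl_op k j (\<lambda>x. of_real (x $ l) * p x)) x = dunkl_op k j (dunkl_op k i (\<lambda>x. of_real (x $ l) * p x)) x"
proof -
  note [simp] = dunkl_op_add dunkl_op_cmult dunkl_op_coord dunkl_op_sum dunkl_op_diff cpoly_dunkl_op cpoly_swapv cpoly_cmult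
     cpoly_sum cpoly_add cpoly_coord p cpoly_diff cpoly_uminus dunkl_op_swapv
  have Ti: "dunkl_op k i (\<lambda>x. of_real (x $ l) * p x) = (\<lambda>x. of_real (x $ l) * dunkl_op k i p x + (- of_real k) * p (swapv i l x))"
    using \<open>l \<noteq> i\<close> by (simp add: fun_eq_iff)
  show ?thesis
  proof (cases "l = j")
    case False
    have Tj: "dunkl_op k j (\<lambda>x. of_real (x $ l) * p x) = (\<lambda>x. of_real (x $ l) * dunkl_op k j p x + (- of_real k) * p (swapv j l x))"
      using False by (simp add: fun_eq_iff)
    show ?thesis unfolding Ti Tj
      using assms False by (subst dunkl_op_add; (subst dunkl_op_cmult)?; simp add: tr_other IH)
  next
    case True
    have Tj: "dunkl_op k j (\<lambda>x. of_real (x $ l) * p x) = (\<lambda>x. of_real (x $ l) * dunkl_op k j p x +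
         (p x + of_real k * (\<Sum>b\<in>UNIV - {j}. p (swapv j b x))))"
      using True by (simp add: fun_eq_iff)
    have "(\<Sum>b\<in>UNIV - {j}. dunkl_op k (tr j b i) p (swapv j b x)) = dunkl_op k j p (swapv j i x) + (\<Sum>b\<in>UNIV - {j} - {i}. dunkl_op k (tr j b i) p (swapv j b x))"
      using assms by (subst sum.remove[of _ i]) auto
    also have "(\<Sum>b\<in>UNIV - {j} - {i}. dunkl_op k (tr j b i) p (swapv j b x)) = (\<Sum>b\<in>UNIV - {j} - {i}. dunkl_op k i p (swapv j b x))"
      using assms by (intro sum.cong refl) (auto simp: tr_other)
    finally have 1: "(\<Sum>b\<in>UNIV - {j}. dunkl_op k (tr j b i) p (swapv j b x)) = dunkl_op k j p (swapv i j x) + (\<Sum>b\<in>UNIV - {j} - {i}. dunkl_op k i p (swapv j b x))"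
      by (simp add: swapv_commute)
    have 2: "(\<Sum>b\<in>UNIV - {j}. dunkl_op k i p (swapv j b x)) = dunkl_op k i p (swapv i j x) + (\<Sum>b\<in>UNIV - {j} - {i}. dunkl_op k i p (swapv j b x))"
      using assms by (subst sum.remove[of _ i]) (auto simp: swapv_commute)
    show ?thesis unfolding Ti Tj
      using assms True by (simp add: IH 1 2 algebra_simps)
  qed
qed

lemma dunkl_op_commute:
  "cpoly p \<Longrightarrow> dunkl_op k i (dunkl_op k j p) x = dunkl_op k j (dunkl_op k i p) x"
proof (induction arbitrary: x rule: cpoly.induct)
  case (cpoly_const c)
  have "dunkl_op k i (\<lambda>_. c) = (\<lambda>_. 0)" for i by (simp add: fun_eq_iff)
  thus ?case by simp
next
  case (cpoly_add p q)
  have "dunkl_op k i (\<lambda>x. p x + q x) = (\<lambda>x. dunkl_op k i p x + dunkl_op k i q x)" for i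
    using cpoly_add by (simp add: fun_eq_iff dunkl_op_add)
  thus ?case using cpoly_add by (simp add: dunkl_op_add cpoly_dunkl_op)
next
  case (cpoly_coord p l)
  show ?case
  proof (cases "i = j")
    case False
    show ?thesis
    proof (cases "l = i")
      case True
      show ?thesis
        by (rule dunkl_op_commute_coord[OF cpoly_coord.hyps, symmetric]) (use False True cpoly_coord.IH in auto)
    qed (rule dunkl_op_commute_coord[OF cpoly_coord.hyps cpoly_coord.IH], use False in auto)
  qed simp
qed

text \<open>Reduces a sum over all ordered pairs to the transpositions that move \<open>i\<close>.
  Each occurs as (i, b) and as (b, i), whence the factor 2 that offsets the k/2 of the ordered
  sums.\<close>

lemma sum_pairs_star:
  fixes g :: "'n::finite \<Rightarrow> 'n \<Rightarrow> 'a::comm_ring_1"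
  assumes "\<And>a b. a \<noteq> i \<Longrightarrow> b \<noteq> i \<Longrightarrow> g a b = 0" "\<And>a b. g a b = g b a" "g i i = 0"
  shows "(\<Sum>a\<in>UNIV. \<Sum>b\<in>UNIV. g a b) = 2 * (\<Sum>b\<in>UNIV - {i}. g i b)"
proof -
  have "(\<Sum>a\<in>UNIV. \<Sum>b\<in>UNIV. g a b) = (\<Sum>b\<in>UNIV. g i b) + (\<Sum>a\<in>UNIV - {i}. \<Sum>b\<in>UNIV. g a b)"
    by (rule sum.remove) auto
  also have "(\<Sum>a\<in>UNIV - {i}. \<Sum>b\<in>UNIV. g a b) = (\<Sum>a\<in>UNIV - {i}. g i a)"
  proof (rule sum.cong)
    fix a assume a: "a \<in> UNIV - {i}"
    have "(\<Sum>b\<in>UNIV. g a b) = g a i + (\<Sum>b\<in>UNIV - {i}. g a b)"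
      by (rule sum.remove) auto
    also have "(\<Sum>b\<in>UNIV - {i}. g a b) = 0"
      using a assms(1) by (intro sum.neutral) auto
    finally show "(\<Sum>b\<in>UNIV. g a b) = g i a" using assms(2)[of a i] by simp
  qed simp
  also have "(\<Sum>b\<in>UNIV. g i b) = (\<Sum>b\<in>UNIV - {i}. g i b)"
    using assms(3) by (subst sum.remove[of _ i]) auto
  finally show ?thesis by simp
qed

text \<open>Multiplication by x_l raises the degree by one, and the commutator terms of
  \<open>dunkl_op_coord\<close> add up to the change of the reflection sum, since only
  transpositions moving l fail to fix that factor.\<close>

lemma dunkl_euler:
  "hpoly m p \<Longrightarrow> (\<Sum>j\<in>UNIV. of_real (x $ j) * dunkl_op k j p x) =
     of_nat m * p x + of_real k / 2 * (\<Sum>a\<in>UNIV. \<Sum>b\<in>UNIV. p x - p (swapv a b x))"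
proof (induction rule: hpoly.induct)
  case (hpoly_add m p q)
  have "(\<Sum>j\<in>UNIV. of_real (x $ j) * dunkl_op k j (\<lambda>x. p x + q x) x) =
    (\<Sum>j\<in>UNIV. of_real (x $ j) * dunkl_op k j p x) + (\<Sum>j\<in>UNIV. of_real (x $ j) * dunkl_op k j q x)"
    using hpoly_add by (simp add: dunkl_op_add hpoly_imp_cpoly algebra_simps sum.distrib)
  thus ?case unfolding hpoly_add.IH by (simp add: algebra_simps sum.distrib sum_subtractf)
next
  case (hpoly_coord m p l)
  let ?x = "\<lambda>j. complex_of_real (x $ j)"
  have p: "cpoly p" using hpoly_coord hpoly_imp_cpoly by blast
  have "(\<Sum>j\<in>UNIV. ?x j * dunkl_op k j (\<lambda>x. of_real (x $ l) * p x) x)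
     = (\<Sum>j\<in>UNIV. ?x l * (?x j * dunkl_op k j p x)) + (\<Sum>j\<in>UNIV. ?x j * (if l = j then p x + of_real k * (\<Sum>b\<in>UNIV - {j}. p (swapv j b x)) else - of_real k * p (swapv j l x)))"
    unfolding dunkl_op_coord[OF p] by (simp add: algebra_simps sum.distrib)
  also have "(\<Sum>j\<in>UNIV. ?x l * (?x j * dunkl_op k j p x)) = ?x l * (of_nat m * p x + of_real k / 2 * (\<Sum>a\<in>UNIV. \<Sum>b\<in>UNIV. p x - p (swapv a b x)))"
    unfolding hpoly_coord.IH[symmetric] by (simp only: sum_distrib_left)
  also have "(\<Sum>j\<in>UNIV. ?x j * (if l = j then p x + of_real k * (\<Sum>b\<in>UNIV - {j}. p (swapv j b x)) else - of_real k * p (swapv j l x)))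
     = ?x l * (p x + of_real k * (\<Sum>b\<in>UNIV - {l}. p (swapv l b x))) + (\<Sum>j\<in>UNIV - {l}. ?x j * (- of_real k * p (swapv l j x)))"
    by (subst sum.remove[of _ l]) (auto intro!: arg_cong2[of _ _ _ _ "(+)"] sum.cong simp: swapv_commute)
  also have "\<dots> = ?x l * p x + of_real k * (\<Sum>b\<in>UNIV - {l}. (?x l - ?x b) * p (swapv l b x))"
    by (simp add: algebra_simps sum_distrib_left sum_subtractf sum_negf)
  also have "(\<Sum>b\<in>UNIV - {l}. (?x l - ?x b) * p (swapv l b x)) = (\<Sum>a\<in>UNIV. \<Sum>b\<in>UNIV. (?x l - ?x (tr a b l)) * p (swapv a b x)) / 2"
    by (subst sum_pairs_star[of l]) (auto simp: tr_other tr_commute swapv_commute)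
  finally have *: "(\<Sum>j\<in>UNIV. ?x j * dunkl_op k j (\<lambda>x. of_real (x $ l) * p x) x) =
     ?x l * (of_nat m * p x + of_real k / 2 * (\<Sum>a\<in>UNIV. \<Sum>b\<in>UNIV. p x - p (swapv a b x))) +
     (?x l * p x + of_real k * ((\<Sum>a\<in>UNIV. \<Sum>b\<in>UNIV. (?x l - ?x (tr a b l)) * p (swapv a b x)) / 2))" .
  have "(\<Sum>a\<in>UNIV. \<Sum>b\<in>UNIV. ?x l * p x - complex_of_real (swapv a b x $ l) * p (swapv a b x))
     = ?x l * (\<Sum>a\<in>UNIV. \<Sum>b\<in>UNIV. p x - p (swapv a b x)) + (\<Sum>a\<in>UNIV. \<Sum>b\<in>UNIV. (?x l - ?x (tr a b l)) * p (swapv a b x))"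
    unfolding sum_distrib_left sum.distrib[symmetric] by (intro sum.cong refl) (simp add: algebra_simps)
  thus ?case unfolding * by (simp add: algebra_simps)
qed simp_all

section \<open>Eigenvalue equations for the homogeneous components\<close>

context dunkl
begin

abbreviation T where "T \<equiv> dunkl_op k"

lemma hpoly_e: "hpoly m (\<lambda>x. of_real (e m x y))"
proof (induction m)
  case 0 show ?case by (simp add: hpoly_const)
next
  case (Suc m)
  have lin: "hpoly (Suc m) (\<lambda>x. of_real (x \<bullet> y) * p x)" if "hpoly m p" for p
  proof -
    have "hpoly (Suc m) (\<lambda>x. \<Sum>i\<in>UNIV. of_real (y $ i) * (of_real (x $ i) * p x))"
      by (intro hpoly_sum hpoly_cmult hpoly_coord that)
    thus ?thesis by (simp add: inner_vec_def sum_distrib_left sum_distrib_right mult_ac)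
  qed
  have "hpoly (Suc m) (\<lambda>x. \<Sum>w\<in>UNIV. of_real (rweight k (Suc m) w) * (of_real (pm w x \<bullet> y) * of_real (e m (pm w x) y)))"
    by (intro hpoly_sum hpoly_cmult) (rule hpoly_pm[OF lin[OF Suc]])
  thus ?case by (simp add: dunkl_e.simps(2) mult.assoc)
qed

lemma cpoly_e: "cpoly (\<lambda>x. of_real (e m x y))"
  using hpoly_e hpoly_imp_cpoly by blast

lemma e_euler:
  "(\<Sum>j\<in>UNIV. of_real (x $ j) * T j (\<lambda>x. of_real (e (Suc m) x y)) x) = of_real (x \<bullet> y) * of_real (e m x y)"
  unfolding dunkl_euler[OF hpoly_e[of "Suc m" y]]
  using arg_cong[OF e_recursion[of m x y], of complex_of_real] by simp

text \<open>The recursion yields only the contracted equation \<open>e_euler\<close>. Put v_i = T_i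
  e_(m+1) - y_i e_m. Applying T_i to the contracted equation and commuting T_i past the T_j produces
  a homogeneous linear relation among the v_j on an orbit, which the zero principle
  resolves.\<close>

lemma dunkl_op_e: "T i (\<lambda>x. of_real (e (Suc m) x y)) x = of_real (y $ i) * of_real (e m x y)"
proof (induction m arbitrary: i x)
  \<comment> \<open>The induction hypothesis enters contracted with x, a form that holds for m = 0
    too, where both sides vanish.\<close>
  have main: "T i (\<lambda>x. of_real (e (Suc m) x y)) x = of_real (y $ i) * of_real (e m x y)"
    if IH: "\<And>i x. of_real (y $ i) * (\<Sum>j\<in>UNIV. of_real (x $ j) * T j (\<lambda>x. of_real (e m x y)) x)
         = of_real (x \<bullet> y) * T i (\<lambda>x. of_real (e m x y)) x" for m i x
  proof -
    define E where "E = (\<lambda>x. complex_of_real (e (Suc m) x y))"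
    define E' where "E' = (\<lambda>x. complex_of_real (e m x y))"
    define v where "v = (\<lambda>i x. T i E x - of_real (y $ i) * E' x)"
    have hE: "hpoly (Suc m) E" and hE': "hpoly m E'" unfolding E_def E'_def by (rule hpoly_e)+
    note pE = hpoly_imp_cpoly[OF hE] and pE' = hpoly_imp_cpoly[OF hE']
    have hv: "hpoly m (v i)" for i unfolding v_def
      by (intro hpoly_diff hpoly_dunkl_op hE hpoly_cmult hE')
    have D: "(\<lambda>x. \<Sum>j\<in>UNIV. of_real (x $ j) * T j E x) = (\<lambda>x. \<Sum>j\<in>UNIV. of_real (y $ j) * (of_real (x $ j) * E' x))"
      using e_euler[of _ m y] by (simp add: fun_eq_iff E_def E'_def inner_vec_def sum_distrib_left sum_distrib_right mult_ac)
    \<comment> \<open>T_i is applied to both expressions \<open>D\<close> of the Euler sum. Its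
      commutators with the factors x_j give the reflection terms, and the induction hypothesis
      removes the remaining multiple of T_i E'.\<close>
    have eq1: "(\<Sum>j\<in>UNIV. of_real (x $ j) * T j (v i) x) + v i x + of_real k * (\<Sum>b\<in>UNIV - {i}. v i (swapv i b x) - v b (swapv i b x)) = 0" for i x
    proof -
      have l: "T i (\<lambda>x. \<Sum>j\<in>UNIV. of_real (x $ j) * T j E x) x
         = (\<Sum>j\<in>UNIV. of_real (x $ j) * T i (T j E) x) + (T i E x + of_real k * (\<Sum>b\<in>UNIV - {i}. T i E (swapv i b x)))
           - of_real k * (\<Sum>j\<in>UNIV - {i}. T j E (swapv i j x))"
      proof -
        have "T i (\<lambda>x. \<Sum>j\<in>UNIV. of_real (x $ j) * T j E x) x = (\<Sum>j\<in>UNIV. T i (\<lambda>x. of_real (x $ j) * T j E x) x)"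
          by (rule dunkl_op_sum) (auto intro: cpoly_coord cpoly_dunkl_op pE)
        also have "\<dots> = (\<Sum>j\<in>UNIV. of_real (x $ j) * T i (T j E) x) +
            (\<Sum>j\<in>UNIV. (if j = i then T j E x + of_real k * (\<Sum>b\<in>UNIV - {i}. T j E (swapv i b x)) else - of_real k * T j E (swapv i j x)))"
          by (simp add: dunkl_op_coord cpoly_dunkl_op pE sum.distrib)
        also have "(\<Sum>j\<in>UNIV. (if j = i then T j E x + of_real k * (\<Sum>b\<in>UNIV - {i}. T j E (swapv i b x)) else - of_real k * T j E (swapv i j x)))
          = (T i E x + of_real k * (\<Sum>b\<in>UNIV - {i}. T i E (swapv i b x))) + (\<Sum>j\<in>UNIV - {i}. - of_real k * T j E (swapv i j x))"
          by (subst sum.remove[of _ i]) (auto intro!: sum.cong)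
        finally show ?thesis by (simp add: sum_distrib_left sum_negf)
      qed
      have r: "T i (\<lambda>x. \<Sum>j\<in>UNIV. of_real (y $ j) * (of_real (x $ j) * E' x)) x
         = of_real (x \<bullet> y) * T i E' x + of_real (y $ i) * (E' x + of_real k * (\<Sum>b\<in>UNIV - {i}. E' (swapv i b x)))
           - of_real k * (\<Sum>j\<in>UNIV - {i}. of_real (y $ j) * E' (swapv i j x))"
      proof -
        have "T i (\<lambda>x. \<Sum>j\<in>UNIV. of_real (y $ j) * (of_real (x $ j) * E' x)) x = (\<Sum>j\<in>UNIV. T i (\<lambda>x. of_real (y $ j) * (of_real (x $ j) * E' x)) x)"
          by (rule dunkl_op_sum) (simp, intro cpoly_cmult cpoly_coord pE')
        also have "\<dots> = (\<Sum>j\<in>UNIV. of_real (y $ j) * (of_real (x $ j) * T i E' x)) +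
            (\<Sum>j\<in>UNIV. of_real (y $ j) * (if j = i then E' x + of_real k * (\<Sum>b\<in>UNIV - {i}. E' (swapv i b x)) else - of_real k * E' (swapv i j x)))"
          by (simp add: dunkl_op_coord dunkl_op_cmult cpoly_coord pE' sum.distrib distrib_left)
        also have "(\<Sum>j\<in>UNIV. of_real (y $ j) * (if j = i then E' x + of_real k * (\<Sum>b\<in>UNIV - {i}. E' (swapv i b x)) else - of_real k * E' (swapv i j x)))
          = of_real (y $ i) * (E' x + of_real k * (\<Sum>b\<in>UNIV - {i}. E' (swapv i b x))) + (\<Sum>j\<in>UNIV - {i}. of_real (y $ j) * (- of_real k * E' (swapv i j x)))"
          by (subst sum.remove[of _ i]) (auto intro!: sum.cong)
        finally show ?thesis by (simp add: sum_distrib_left sum_distrib_right sum_negf inner_vec_def mult_ac)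
      qed
      have c: "T i (T j E) x = T j (T i E) x" for j by (rule dunkl_op_commute[OF pE])
      have Tv: "T j (v i) x = T j (T i E) x - of_real (y $ i) * T j E' x" for j
        by (simp add: v_def dunkl_op_diff dunkl_op_cmult pE pE' cpoly_dunkl_op cpoly_cmult)
      have "(\<Sum>j\<in>UNIV. of_real (x $ j) * T j (v i) x) = (\<Sum>j\<in>UNIV. of_real (x $ j) * T i (T j E) x) - of_real (y $ i) * (\<Sum>j\<in>UNIV. of_real (x $ j) * T j E' x)"
        unfolding c Tv by (simp add: right_diff_distrib sum_subtractf sum_distrib_left mult_ac)
      also have "of_real (y $ i) * (\<Sum>j\<in>UNIV. of_real (x $ j) * T j E' x) = of_real (x \<bullet> y) * T i E' x"
        unfolding E'_def by (rule IH)
      finally have 3: "(\<Sum>j\<in>UNIV. of_real (x $ j) * T j (v i) x) = (\<Sum>j\<in>UNIV. of_real (x $ j) * T i (T j E) x) - of_real (x \<bullet> y) * T i E' x" .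
      have 4: "(\<Sum>b\<in>UNIV - {i}. v i (swapv i b x) - v b (swapv i b x)) = (\<Sum>b\<in>UNIV - {i}. T i E (swapv i b x)) - (\<Sum>j\<in>UNIV - {i}. T j E (swapv i j x))
         - of_real (y $ i) * (\<Sum>b\<in>UNIV - {i}. E' (swapv i b x)) + (\<Sum>j\<in>UNIV - {i}. of_real (y $ j) * E' (swapv i j x))"
        unfolding v_def by (simp add: sum_subtractf sum_distrib_left)
      show ?thesis unfolding 3 4 using l[unfolded D r] by (simp add: v_def algebra_simps)
    qed
    \<comment> \<open>The relations couple v_i at z with v_(\<sigma> i) at \<sigma> z, so the finite
      set for the zero principle consists of pairs of an index and a map. Euler's identity for v_i,
      of degree m, supplies the coefficient m; the separate summand v_i makes it m + 1.\<close>
    define u where "u = (\<lambda>(i, w). v i (pm w x))"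
    have "u (i, id) = 0"
    proof (rule zero_principle_complex[where m = "real (Suc m)" and c = "k / 2" and u = u and x = "(i, id)"
          and \<phi> = "\<lambda>a b (i, w). (tr a b i, w \<circ> tr a b)"])
      show "0 \<le> k / 2" using k_nonneg by simp
      fix iw :: "'a \<times> ('a \<Rightarrow> 'a)"
      obtain i w where iw: "iw = (i, w)" by (cases iw)
      define z where "z = pm w x"
      have p: "pm (w \<circ> tr a b) x = swapv a b z" for a b by (simp add: z_def swapv_eq_pm pm_pm)
      have "(\<Sum>a\<in>UNIV. \<Sum>b\<in>UNIV. v i (swapv a b z) - v (tr a b i) (swapv a b z)) = 2 * (\<Sum>b\<in>UNIV - {i}. v i (swapv i b z) - v b (swapv i b z))"
        by (subst sum_pairs_star[of i]) (auto simp: tr_other tr_commute swapv_commute)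
      moreover have "(\<Sum>a\<in>UNIV. \<Sum>b\<in>UNIV. v i z - v (tr a b i) (swapv a b z)) = (\<Sum>a\<in>UNIV. \<Sum>b\<in>UNIV. v i z - v i (swapv a b z))
          + (\<Sum>a\<in>UNIV. \<Sum>b\<in>UNIV. v i (swapv a b z) - v (tr a b i) (swapv a b z))"
        by (simp add: sum.distrib[symmetric])
      ultimately have "of_real (real (Suc m)) * v i z + of_real (k / 2) * (\<Sum>a\<in>UNIV. \<Sum>b\<in>UNIV. v i z - v (tr a b i) (swapv a b z)) = 0"
        using eq1[of z i] unfolding dunkl_euler[OF hv] by (simp add: algebra_simps)
      thus "of_real (real (Suc m)) * u iw + of_real (k / 2) * (\<Sum>a\<in>UNIV. \<Sum>b\<in>UNIV. u iw - u (case iw of (i, w) \<Rightarrow> (tr a b i, w \<circ> tr a b))) = 0"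
        by (simp add: iw u_def p z_def[symmetric])
    qed simp
    thus ?thesis by (simp add: u_def v_def E_def E'_def)
  qed
  case 0
  show ?case by (rule main) simp
  case (Suc m)
  show ?case
  proof (rule main)
    fix i x
    show "complex_of_real (y $ i) * (\<Sum>j\<in>UNIV. of_real (x $ j) * T j (\<lambda>x. of_real (e (Suc m) x y)) x)
         = of_real (x \<bullet> y) * T i (\<lambda>x. of_real (e (Suc m) x y)) x"
      unfolding Suc by (simp add: inner_vec_def sum_distrib_left sum_distrib_right mult_ac)
  qed
qed

end

section \<open>Convergence and boundedness of the kernel\<close>

text \<open>The majorant makes the series of derivatives converge uniformly. It will be applied on
  small intervals that avoid the hyperplanes.\<close>

lemma has_vector_derivative_suminf:
  fixes f :: "nat \<Rightarrow> real \<Rightarrow> 'b::banach"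
  assumes S: "convex S" "open S" "x \<in> S"
    and der: "\<And>m t. t \<in> S \<Longrightarrow> (f m has_vector_derivative f' m t) (at t)"
    and bound: "\<And>m t. t \<in> S \<Longrightarrow> norm (f' m t) \<le> M m" and M: "summable M"
    and sum: "summable (\<lambda>m. f m x)"
  shows "((\<lambda>t. \<Sum>m. f m t) has_vector_derivative (\<Sum>m. f' m x)) (at x)"
proof -
  define g' where "g' t = (\<Sum>m. f' m t)" for t
  have ul: "uniform_limit S (\<lambda>n t. \<Sum>i<n. f' i t) g' sequentially"
    unfolding g'_def by (rule Weierstrass_m_test[OF bound M])
  have "\<exists>g. \<forall>x\<in>S. (\<lambda>n. f n x) sums g x \<and> (g has_derivative (\<lambda>h. h *\<^sub>R g' x)) (at x within S)"
  proof (rule has_derivative_series[OF S(1) _ _ S(3)])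
    show "(f n has_derivative (\<lambda>h. h *\<^sub>R f' n x)) (at x within S)" if "x \<in> S" for n x
      using der[OF that] by (auto simp: has_vector_derivative_def intro: has_derivative_at_withinI)
    show "(\<lambda>n. f n x) sums (\<Sum>n. f n x)" using sum by (rule summable_sums)
    fix \<epsilon> :: real assume "\<epsilon> > 0"
    from uniform_limitD[OF ul this]
    show "\<forall>\<^sub>F n in sequentially. \<forall>x\<in>S. \<forall>h. norm ((\<Sum>i<n. h *\<^sub>R f' i x) - h *\<^sub>R g' x) \<le> \<epsilon> * norm h"
    proof (rule eventually_mono, intro ballI allI)
      fix n t h assume "\<forall>x\<in>S. dist (\<Sum>i<n. f' i x) (g' x) < \<epsilon>" "t \<in> S"
      hence "norm ((\<Sum>i<n. f' i t) - g' t) \<le> \<epsilon>" by (auto simp: dist_norm intro: less_imp_le)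
      hence "\<bar>h\<bar> * norm ((\<Sum>i<n. f' i t) - g' t) \<le> \<bar>h\<bar> * \<epsilon>" by (rule mult_left_mono) simp
      moreover have "(\<Sum>i<n. h *\<^sub>R f' i t) - h *\<^sub>R g' t = h *\<^sub>R ((\<Sum>i<n. f' i t) - g' t)"
        by (simp add: scaleR_diff_right scaleR_sum_right)
      ultimately show "norm ((\<Sum>i<n. h *\<^sub>R f' i t) - h *\<^sub>R g' t) \<le> \<epsilon> * norm h"
        by (simp add: mult.commute)
    qed
  qed
  then obtain g where gg: "\<forall>x\<in>S. (\<lambda>n. f n x) sums g x \<and> (g has_derivative (\<lambda>h. h *\<^sub>R g' x)) (at x within S)" ..
  have g: "(\<lambda>n. f n u) sums g u" if "u \<in> S" for u using gg that by simp
  have g': "(g has_derivative (\<lambda>h. h *\<^sub>R g' x)) (at x within S)" using gg S(3) by simp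
  from g' have "(g has_derivative (\<lambda>h. h *\<^sub>R g' x)) (at x)" by (simp only: at_within_open[OF S(3) S(2)])
  hence "((\<lambda>t. \<Sum>m. f m t) has_derivative (\<lambda>h. h *\<^sub>R g' x)) (at x)"
    by (rule has_derivative_transform_within_open[OF _ S(2,3)]) (rule sums_unique, rule g)
  thus ?thesis by (simp add: has_vector_derivative_def g'_def)
qed

text \<open>The reflection terms are dissipative: pairing $w$ with $\phi_{ab} w$, their contribution to the
  derivative of $\sum_w |h_w|^2$ is $\leq 0$ whatever the sign of the other terms.\<close>

lemma orbit_gronwall:
  fixes h :: "'w \<Rightarrow> real \<Rightarrow> complex" and \<phi> :: "'a::finite \<Rightarrow> 'b::finite \<Rightarrow> 'w \<Rightarrow> 'w"
  assumes W: "finite W" "\<And>a b. bij_betw (\<phi> a b) W W" and c: "c \<ge> 0"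
    and cont: "\<And>w. w \<in> W \<Longrightarrow> continuous_on {0..1} (h w)"
    and der: "\<And>w t. w \<in> W \<Longrightarrow> 0 < t \<Longrightarrow> t < 1 \<Longrightarrow> \<exists>D. (h w has_vector_derivative D) (at t) \<and>
       of_real t * D = of_real t * \<beta> w * h w t - of_real c * (\<Sum>a\<in>UNIV. \<Sum>b\<in>UNIV. h w t - h (\<phi> a b w) t)"
    and \<beta>: "\<And>w. w \<in> W \<Longrightarrow> Re (\<beta> w) \<le> C"
  shows "(\<Sum>w\<in>W. (norm (h w 1))\<^sup>2) \<le> exp (2 * C) * (\<Sum>w\<in>W. (norm (h w 0))\<^sup>2)"
proof -
  define G where "G t = exp (-2 * C * t) * (\<Sum>w\<in>W. (norm (h w t))\<^sup>2)" for t
  \<comment> \<open>The system carries a factor t and degenerates at 0, so monotonicity of G is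
    derived from the open interval and from continuity at its ends.\<close>
  have "G 1 \<le> G 0"
  proof (rule DERIV_nonpos_imp_decreasing_open[of 0 1 G])
    show "continuous_on {0..1} G"
      unfolding G_def using cont by (intro continuous_intros)
    fix t :: real assume t: "0 < t" "t < 1"
    have "\<exists>D. \<forall>w\<in>W. (h w has_vector_derivative D w) (at t) \<and>
       of_real t * D w = of_real t * \<beta> w * h w t - of_real c * (\<Sum>a\<in>UNIV. \<Sum>b\<in>UNIV. h w t - h (\<phi> a b w) t)"
      using der[OF _ t] by (intro bchoice) auto
    then obtain D where D: "\<And>w. w \<in> W \<Longrightarrow> (h w has_vector_derivative D w) (at t)"
      and D_eq: "\<And>w. w \<in> W \<Longrightarrow> of_real t * D w = of_real t * \<beta> w * h w t - of_real c * (\<Sum>a\<in>UNIV. \<Sum>b\<in>UNIV. h w t - h (\<phi> a b w) t)"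
      by blast
    have d1: "((\<lambda>t. (norm (h w t))\<^sup>2) has_real_derivative 2 * (D w \<bullet> h w t)) (at t)" if "w \<in> W" for w
    proof -
      have "((\<lambda>t. h w t \<bullet> h w t) has_vector_derivative (h w t \<bullet> D w + D w \<bullet> h w t)) (at t)"
        by (rule bounded_bilinear.has_vector_derivative[OF bounded_bilinear_inner D[OF that] D[OF that]])
      thus ?thesis by (simp add: has_real_derivative_iff_has_vector_derivative power2_norm_eq_inner inner_commute)
    qed
    define S where "S = (\<Sum>w\<in>W. (norm (h w t))\<^sup>2)"
    have d2: "(G has_real_derivative (exp (-2 * C * t) * (\<Sum>w\<in>W. 2 * (D w \<bullet> h w t)) + exp (-2 * C * t) * (-2 * C) * S)) (at t)"
      unfolding G_def S_def
      by (rule derivative_eq_intros refl d1 | simp)+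
    \<comment> \<open>Because \<open>\<phi> a b\<close> permutes W, twice this sum equals the sum of
      the squared norms of the increments.\<close>
    have sym: "(\<Sum>w\<in>W. (h w t - h (\<phi> a b w) t) \<bullet> h w t) \<ge> 0" for a b
    proof -
      have re: "(\<Sum>w\<in>W. h (\<phi> a b w) t \<bullet> h (\<phi> a b w) t) = (\<Sum>w\<in>W. h w t \<bullet> h w t)"
        by (rule sum.reindex_bij_betw[OF W(2)])
      have "0 \<le> (\<Sum>w\<in>W. (h w t - h (\<phi> a b w) t) \<bullet> (h w t - h (\<phi> a b w) t))"
        by (intro sum_nonneg) simp
      also have "\<dots> = 2 * (\<Sum>w\<in>W. (h w t - h (\<phi> a b w) t) \<bullet> h w t)"
        using re by (simp add: inner_diff_left inner_diff_right sum_subtractf sum.distrib sum_distrib_left inner_commute)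
      finally show ?thesis by simp
    qed
    have "t * (\<Sum>w\<in>W. D w \<bullet> h w t) = (\<Sum>w\<in>W. (of_real t * D w) \<bullet> h w t)"
      by (simp add: sum_distrib_left scaleR_conv_of_real[symmetric])
    also have "\<dots> = (\<Sum>w\<in>W. t * ((\<beta> w * h w t) \<bullet> h w t)) - c * (\<Sum>a\<in>UNIV. \<Sum>b\<in>UNIV. \<Sum>w\<in>W. (h w t - h (\<phi> a b w) t) \<bullet> h w t)"
    proof -
      have "(of_real t * D w) \<bullet> h w t = t * ((\<beta> w * h w t) \<bullet> h w t) - c * (\<Sum>a\<in>UNIV. \<Sum>b\<in>UNIV. (h w t - h (\<phi> a b w) t) \<bullet> h w t)" if "w \<in> W" for w
        unfolding D_eq[OF that]
        by (simp add: inner_diff_left mult.assoc scaleR_conv_of_real[symmetric] inner_sum_left del: sum_subtractf)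
      hence "(\<Sum>w\<in>W. (of_real t * D w) \<bullet> h w t) = (\<Sum>w\<in>W. t * ((\<beta> w * h w t) \<bullet> h w t)) - c * (\<Sum>w\<in>W. \<Sum>a\<in>UNIV. \<Sum>b\<in>UNIV. (h w t - h (\<phi> a b w) t) \<bullet> h w t)"
        by (simp add: sum_subtractf sum_distrib_left)
      also have "(\<Sum>w\<in>W. \<Sum>a\<in>UNIV. \<Sum>b\<in>UNIV. (h w t - h (\<phi> a b w) t) \<bullet> h w t) = (\<Sum>a\<in>UNIV. \<Sum>b\<in>UNIV. \<Sum>w\<in>W. (h w t - h (\<phi> a b w) t) \<bullet> h w t)"
        by (subst sum.swap, rule sum.cong[OF refl], rule sum.swap)
      finally show ?thesis .
    qed
    also have "\<dots> \<le> (\<Sum>w\<in>W. t * ((\<beta> w * h w t) \<bullet> h w t))"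
    proof -
      have "0 \<le> c * (\<Sum>a\<in>UNIV. \<Sum>b\<in>UNIV. \<Sum>w\<in>W. (h w t - h (\<phi> a b w) t) \<bullet> h w t)"
        by (rule mult_nonneg_nonneg[OF c], rule sum_nonneg, rule sum_nonneg, rule sym)
      thus ?thesis by linarith
    qed
    also have "\<dots> \<le> (\<Sum>w\<in>W. t * (C * (norm (h w t))\<^sup>2))"
    proof (intro sum_mono mult_left_mono)
      fix w assume "w \<in> W"
      have "(\<beta> w * h w t) \<bullet> h w t = Re (\<beta> w) * (norm (h w t))\<^sup>2"
        unfolding cmod_power2 inner_complex_def by (simp add: algebra_simps power2_eq_square)
      thus "(\<beta> w * h w t) \<bullet> h w t \<le> C * (norm (h w t))\<^sup>2"
        using \<beta>[OF \<open>w \<in> W\<close>] by (simp add: mult_right_mono)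
    qed (use t in auto)
    also have "\<dots> = t * (C * S)" by (simp add: S_def sum_distrib_left)
    finally have "(\<Sum>w\<in>W. D w \<bullet> h w t) \<le> C * S" using t by simp
    hence "(\<Sum>w\<in>W. 2 * (D w \<bullet> h w t)) - 2 * C * S \<le> 0"
      unfolding sum_distrib_left[symmetric] by simp
    hence "exp (-2 * C * t) * ((\<Sum>w\<in>W. 2 * (D w \<bullet> h w t)) - 2 * C * S) \<le> 0"
      by (intro mult_nonneg_nonpos) simp_all
    thus "\<exists>y. (G has_real_derivative y) (at t) \<and> y \<le> 0"
      using d2 by (intro exI conjI) (auto simp: algebra_simps)
  qed simp
  thus ?thesis by (simp add: G_def exp_minus field_simps)
qed

context dunkl
begin

text \<open>\<open>K x y\<close> is $E_k^A(x, iy)$ for real $x, y$.\<close>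

definition K :: "real^'n::finite \<Rightarrow> real^'n \<Rightarrow> complex" where
  "K x y = (\<Sum>m. \<i> ^ m * of_real (e m x y))"

lemma e_bound_norm: "\<bar>e m x y\<bar> \<le> (norm x * (\<Sum>i\<in>UNIV. \<bar>y $ i\<bar>)) ^ m / fact m" for x y :: "real^'n::finite"
  by (rule e_bound) (rule component_le_norm_cart)

lemma summable_pow_fact: "summable (\<lambda>m. (R::real) ^ m / fact m)"
  using summable_exp[of R] by (simp add: field_simps)

lemma summable_e: "summable (\<lambda>m. \<bar>e m x y\<bar>)" for x y :: "real^'n::finite"
  by (rule summable_comparison_test'[OF summable_pow_fact, of 0]) (use e_bound_norm in auto)

lemma summable_K: "summable (\<lambda>m. \<i> ^ m * of_real (e m x y))" for x y :: "real^'n::finite"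
  by (rule summable_norm_cancel) (use summable_e in \<open>simp add: norm_mult norm_power\<close>)

lemma K_sums: "(\<lambda>m. \<i> ^ m * of_real (e m x y)) sums K x y" for x y :: "real^'n::finite"
  unfolding K_def by (rule summable_sums[OF summable_K])

lemma e_zero_left: "e m 0 y = (if m = 0 then 1 else 0)" for y :: "real^'n::finite"
  using e_scale[of m 0 0 y] by (cases m) auto

lemma K_zero_left [simp]: "K 0 y = 1" for y :: "real^'n::finite"
proof -
  have "(\<lambda>m. \<i> ^ m * complex_of_real (e m 0 y)) = (\<lambda>m. if m = 0 then 1 else 0)"
    by (auto simp: fun_eq_iff e_zero_left)
  thus ?thesis using K_sums[of 0 y] sums_single[of 0 "\<lambda>_. 1::complex"] by (simp add: sums_iff)
qed

lemma K_sym: "K x y = K y x" for x y :: "real^'n::finite"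
  unfolding K_def by (subst e_sym) simp

lemma K_zero_right [simp]: "K x 0 = 1" for x :: "real^'n::finite"
  by (subst K_sym) simp

lemma e_minus: "e m (- x) y = e m x (- y)" for x y :: "real^'n::finite"
  using e_scale[of m "-1" x y] e_scale[of m "-1" y x] by (simp add: e_sym)

lemma K_minus: "K (- x) y = K x (- y)" for x y :: "real^'n::finite"
  unfolding K_def e_minus ..

lemma continuous_on_e:
  fixes f g :: "'a::topological_space \<Rightarrow> real^'n::finite"
  assumes "continuous_on A f" "continuous_on A g"
  shows "continuous_on A (\<lambda>z. e m (f z) (g z))"
  using assms(1)
proof (induction m arbitrary: f)
  case (Suc m)
  have "continuous_on A (\<lambda>z. pm w (f z))" for w
    unfolding pm_def by (intro continuous_intros Suc.prems)
  with Suc.IH assms(2) show ?case unfolding dunkl_e.simps(2) by (intro continuous_intros) auto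
qed (simp add: continuous_intros)

lemma continuous_on_K_UNIV: "continuous_on UNIV (\<lambda>z :: (real^'n::finite) \<times> (real^'n). K (fst z) (snd z))"
proof (subst continuous_on_eq_continuous_at; (intro ballI)?)
  fix z0 :: "(real^'n) \<times> (real^'n)"
  define R where "R = norm z0 + 1"
  let ?S = "ball 0 R :: ((real^'n) \<times> (real^'n)) set"
  let ?M = "\<lambda>m. (R * (real CARD('n) * R)) ^ m / fact m"
  have "uniform_limit ?S (\<lambda>n z. \<Sum>m<n. \<i> ^ m * complex_of_real (e m (fst z) (snd z))) (\<lambda>z. K (fst z) (snd z)) sequentially"
    unfolding K_def
  proof (rule Weierstrass_m_test)
    show "summable ?M" by (rule summable_pow_fact)
    fix m and z :: "(real^'n) \<times> (real^'n)" assume z: "z \<in> ?S"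
    have z1: "norm (fst z) \<le> R" "norm (snd z) \<le> R"
      using z norm_fst_le[of "fst z" "snd z"] norm_snd_le[of "snd z" "fst z"] by auto
    have "(\<Sum>i\<in>UNIV. \<bar>snd z $ i\<bar>) \<le> (\<Sum>i\<in>(UNIV::'n set). R)"
      using z1(2) component_le_norm_cart[of "snd z"] by (intro sum_mono) (meson order_trans)
    hence "norm (fst z) * (\<Sum>i\<in>UNIV. \<bar>snd z $ i\<bar>) \<le> R * (real CARD('n) * R)"
      using z1 by (intro mult_mono) (auto intro: sum_nonneg order_trans[OF norm_ge_zero])
    hence "(norm (fst z) * (\<Sum>i\<in>UNIV. \<bar>snd z $ i\<bar>)) ^ m / fact m \<le> ?M m"
      by (intro divide_right_mono power_mono) (auto intro: sum_nonneg)
    thus "norm (\<i> ^ m * complex_of_real (e m (fst z) (snd z))) \<le> ?M m"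
      using e_bound_norm[of m "fst z" "snd z"] by (simp add: norm_mult norm_power)
  qed
  hence "continuous_on ?S (\<lambda>z. K (fst z) (snd z))"
    by (rule uniform_limit_theorem[rotated])
       (auto intro!: always_eventually continuous_intros continuous_on_e)
  moreover have "z0 \<in> ?S" by (simp add: R_def)
  ultimately show "isCont (\<lambda>z. K (fst z) (snd z)) z0"
    using continuous_on_eq_continuous_at[of ?S] by blast
qed simp

lemma continuous_on_K [continuous_intros]:
  fixes f g :: "'a::topological_space \<Rightarrow> real^'n::finite"
  assumes "continuous_on A f" "continuous_on A g"
  shows "continuous_on A (\<lambda>z. K (f z) (g z))"
  using continuous_on_compose2[OF continuous_on_K_UNIV continuous_on_Pair[OF assms]] by simp

lemma measurable_K [measurable]:
  fixes f g :: "'a \<Rightarrow> real^'n::finite"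
  assumes "f \<in> borel_measurable M" "g \<in> borel_measurable M"
  shows "(\<lambda>z. K (f z) (g z)) \<in> borel_measurable M"
proof -
  have "(\<lambda>z :: (real^'n) \<times> (real^'n). K (fst z) (snd z)) \<in> borel_measurable borel"
    by (rule borel_measurable_continuous_onI) (rule continuous_on_K_UNIV)
  from measurable_compose[OF borel_measurable_Pair[OF assms] this] show ?thesis by simp
qed

lemma measurable_e [measurable]:
  fixes f g :: "'a \<Rightarrow> real^'n::finite"
  assumes "f \<in> borel_measurable M" "g \<in> borel_measurable M"
  shows "(\<lambda>z. e m (f z) (g z)) \<in> borel_measurable M"
proof -
  have "(\<lambda>z :: (real^'n) \<times> (real^'n). e m (fst z) (snd z)) \<in> borel_measurable borel"
    by (rule borel_measurable_continuous_onI) (intro continuous_on_e continuous_intros)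
  from measurable_compose[OF borel_measurable_Pair[OF assms] this] show ?thesis by simp
qed

lemma swapv_scaleR: "swapv a b (t *\<^sub>R x) = t *\<^sub>R swapv a b x" for x :: "real^'n::finite"
  by (simp add: vec_eq_iff)

text \<open>Multiplying \<open>e_recursion\<close> by powers of t and summing recovers t d/dt on the
  left. Keeping the factor t avoids a division in the reflection terms, so the identity holds at t =
  0 as well.\<close>

lemma K_radial:
  fixes x y :: "real^'n::finite"
  shows "\<exists>D. ((\<lambda>t. K (t *\<^sub>R x) y) has_vector_derivative D) (at t) \<and>
    of_real t * D = of_real t * (\<i> * of_real (x \<bullet> y)) * K (t *\<^sub>R x) y
      - of_real (k / 2) * (\<Sum>a\<in>UNIV. \<Sum>b\<in>UNIV. K (t *\<^sub>R x) y - K (t *\<^sub>R swapv a b x) y)"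
proof -
  define c where "c m = \<i> ^ m * complex_of_real (e m x y)" for m
  have K_eq: "K (t *\<^sub>R x) y = (\<Sum>m. c m * of_real t ^ m)" for t
    unfolding K_def c_def by (simp add: e_scale mult_ac)
  have summ: "summable (\<lambda>m. c m * z ^ m)" for z
  proof (rule summable_norm_cancel, rule summable_comparison_test'[OF summable_e[of "norm z *\<^sub>R x" y], of 0])
    show "norm (norm (c m * z ^ m)) \<le> \<bar>e m (norm z *\<^sub>R x) y\<bar>" for m
      by (simp add: c_def norm_mult norm_power e_scale abs_mult)
  qed
  define D where "D = (\<Sum>n. diffs c n * of_real t ^ n)"
  have "((\<lambda>z. \<Sum>n. c n * z ^ n) has_field_derivative D) (at (of_real t))"
    unfolding D_def by (rule termdiffs_strong_converges_everywhere) (rule summ)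
  hence "((\<lambda>t. K (t *\<^sub>R x) y) has_vector_derivative D) (at t)"
    unfolding K_eq by (rule has_vector_derivative_real_field)
  moreover have "of_real t * D = of_real t * (\<i> * of_real (x \<bullet> y)) * K (t *\<^sub>R x) y
      - of_real (k / 2) * (\<Sum>a\<in>UNIV. \<Sum>b\<in>UNIV. K (t *\<^sub>R x) y - K (t *\<^sub>R swapv a b x) y)"
  proof -
    have "(\<lambda>n. diffs c n * of_real t ^ n) sums D"
      unfolding D_def by (rule summable_sums, rule termdiff_converges_all[OF summ])
    hence 1: "(\<lambda>n. of_real t * (diffs c n * of_real t ^ n)) sums (of_real t * D)"
      by (rule sums_mult)
    \<comment> \<open>The recursion relates degree n + 1 to degree n, so the series loses its first
      term; the constants 1 cancel in the differences below.\<close>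
    have s1: "(\<lambda>n. \<i> ^ Suc n * of_real (e (Suc n) z y)) sums (K z y - 1)" for z
      using K_sums[of z y] by (subst sums_Suc_iff) simp
    have 2: "(\<lambda>n. of_real t * (\<i> * of_real (x \<bullet> y)) * (\<i> ^ n * of_real (e n (t *\<^sub>R x) y)) -
       of_real (k / 2) * (\<Sum>a\<in>UNIV. \<Sum>b\<in>UNIV. \<i> ^ Suc n * of_real (e (Suc n) (t *\<^sub>R x) y) - \<i> ^ Suc n * of_real (e (Suc n) (t *\<^sub>R swapv a b x) y)))
       sums (of_real t * (\<i> * of_real (x \<bullet> y)) * K (t *\<^sub>R x) y
      - of_real (k / 2) * (\<Sum>a\<in>UNIV. \<Sum>b\<in>UNIV. (K (t *\<^sub>R x) y - 1) - (K (t *\<^sub>R swapv a b x) y - 1)))"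
      by (intro sums_diff sums_mult K_sums sums_sum s1)
    have "of_real t * (diffs c n * of_real t ^ n) = of_real t * (\<i> * of_real (x \<bullet> y)) * (\<i> ^ n * of_real (e n (t *\<^sub>R x) y)) -
       of_real (k / 2) * (\<Sum>a\<in>UNIV. \<Sum>b\<in>UNIV. \<i> ^ Suc n * of_real (e (Suc n) (t *\<^sub>R x) y) - \<i> ^ Suc n * of_real (e (Suc n) (t *\<^sub>R swapv a b x) y))" for n
    proof -
      have "of_real t * (diffs c n * of_real t ^ n) = \<i> ^ Suc n * of_real t ^ Suc n * of_real (real (Suc n) * e (Suc n) x y)"
        by (simp add: diffs_def c_def mult_ac)
      also have "real (Suc n) * e (Suc n) x y = (x \<bullet> y) * e n x y - k / 2 * (\<Sum>a\<in>UNIV. \<Sum>b\<in>UNIV. e (Suc n) x y - e (Suc n) (swapv a b x) y)"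
        using e_recursion[of n x y] by linarith
      finally show ?thesis
        by (simp add: e_scale sum_distrib_left right_diff_distrib sum_subtractf mult_ac)
    qed
    with 1 2 show ?thesis by (simp add: sums_unique2)
  qed
  ultimately show ?thesis by blast
qed

text \<open>For purely imaginary parameters the factor \<open>\<beta>\<close> has real part 0, so
  the orbit sum of |K|^2 does not increase along the ray, and at the origin every term is 1. The sum
  may run over all self-maps, since right composition with a transposition permutes them; their
  number is the bound.\<close>

lemma K_bounded: "norm (K x y) \<le> sqrt (real (CARD('n \<Rightarrow> 'n)))" for x y :: "real^'n::finite"
proof -
  have "(\<Sum>w\<in>UNIV. (norm (K (1 *\<^sub>R pm w x) y))\<^sup>2) \<le> exp (2 * 0) * (\<Sum>w\<in>(UNIV::('n\<Rightarrow>'n) set). (norm (K (0 *\<^sub>R pm w x) y))\<^sup>2)"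
  proof (rule orbit_gronwall[where \<phi> = "\<lambda>a b w. w \<circ> tr a b" and \<beta> = "\<lambda>w. \<i> * of_real (pm w x \<bullet> y)" and c = "k / 2"
         and h = "\<lambda>w t. K (t *\<^sub>R pm w x) y"])
    fix w :: "'n \<Rightarrow> 'n" and t :: real
    have p: "pm (w \<circ> tr a b) x = swapv a b (pm w x)" for a b by (simp add: swapv_eq_pm pm_pm)
    show "\<exists>D. ((\<lambda>t. K (t *\<^sub>R pm w x) y) has_vector_derivative D) (at t) \<and>
        of_real t * D = of_real t * (\<i> * of_real (pm w x \<bullet> y)) * K (t *\<^sub>R pm w x) y
         - of_real (k / 2) * (\<Sum>a\<in>UNIV. \<Sum>b\<in>UNIV. K (t *\<^sub>R pm w x) y - K (t *\<^sub>R pm (w \<circ> tr a b) x) y)"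
      unfolding p by (rule K_radial)
  qed (use k_nonneg in \<open>auto intro!: continuous_intros bij_comp_tr\<close>)
  hence "(\<Sum>w\<in>UNIV. (norm (K (pm w x) y))\<^sup>2) \<le> real (CARD('n \<Rightarrow> 'n))" by simp
  moreover have "(norm (K (pm id x) y))\<^sup>2 \<le> (\<Sum>w\<in>UNIV. (norm (K (pm w x) y))\<^sup>2)"
    by (rule member_le_sum[of id UNIV "\<lambda>w. (norm (K (pm w x) y))\<^sup>2"]) auto
  ultimately have "(norm (K x y))\<^sup>2 \<le> real (CARD('n \<Rightarrow> 'n))" by simp
  thus ?thesis by (rule real_le_rsqrt)
qed

lemma K_has_pd:
  fixes x y :: "real^'n::finite"
  assumes reg: "\<And>j. j \<noteq> i \<Longrightarrow> x $ i \<noteq> x $ j"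
  shows "((\<lambda>t. K (x + t *\<^sub>R axis i 1) y) has_vector_derivative
     (\<i> * of_real (y $ i) * K x y - of_real k * (\<Sum>j\<in>UNIV - {i}. (K x y - K (swapv i j x) y) / of_real (x $ i - x $ j)))) (at 0)"
proof -
  \<comment> \<open>Within distance \<open>\<delta>\<close> the differences z_i - z_j stay at least
    \<open>\<delta>\<close> in absolute value. As \<open>dunkl_op_e\<close> expresses each
    derivative through the components and their reflection quotients, this yields the summable
    majorant \<open>M\<close>.\<close>
  define \<delta> where "\<delta> = Min (insert 1 ((\<lambda>j. \<bar>x $ i - x $ j\<bar> / 2) ` (UNIV - {i})))"
  have \<delta>: "\<delta> > 0" unfolding \<delta>_def using reg by (subst Min_gr_iff) auto
  have \<delta>_le: "2 * \<delta> \<le> \<bar>x $ i - x $ j\<bar>" if "j \<noteq> i" for j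
  proof -
    have "\<delta> \<le> \<bar>x $ i - x $ j\<bar> / 2" unfolding \<delta>_def using that by (intro Min_le) auto
    thus ?thesis by simp
  qed
  define z where "z t = x + t *\<^sub>R axis i 1" for t
  have z_i: "z t $ i = x $ i + t" and z_j: "j \<noteq> i \<Longrightarrow> z t $ j = x $ j" for t j
    by (auto simp: z_def axis_def)
  let ?S = "{-\<delta><..<\<delta>}"
  have gap: "\<delta> \<le> \<bar>z t $ i - z t $ j\<bar>" if "t \<in> ?S" "j \<noteq> i" for t j
    using \<delta>_le[OF that(2)] that by (auto simp: z_i z_j)
  define E where "E m = (\<lambda>x. complex_of_real (e m x y))" for m
  define f' where "f' m t = \<i> ^ m * pd i (E m) (z t)" for m t
  define R where "R = (norm x + \<delta>) * (\<Sum>i\<in>UNIV. \<bar>y $ i\<bar>)"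
  define B where "B m = R ^ m / fact m" for m
  have B0: "B m \<ge> 0" for m
    unfolding B_def R_def using \<delta> by (intro divide_nonneg_nonneg zero_le_power mult_nonneg_nonneg sum_nonneg) auto
  have bnd: "norm (E m v) \<le> B m" if "norm v \<le> norm x + \<delta>" for m v
  proof -
    have "norm (E m v) \<le> (norm v * (\<Sum>i\<in>UNIV. \<bar>y $ i\<bar>)) ^ m / fact m"
      using e_bound_norm[of m v y] by (simp add: E_def)
    also have "\<dots> \<le> B m" unfolding B_def R_def using that \<delta>
      by (intro divide_right_mono power_mono mult_right_mono mult_nonneg_nonneg sum_nonneg) auto
    finally show ?thesis .
  qed
  have nz: "norm (z t) \<le> norm x + \<delta>" if "t \<in> ?S" for t
  proof -
    have "norm (z t) \<le> norm x + norm (t *\<^sub>R axis i (1::real))" unfolding z_def by (rule norm_triangle_ineq)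
    also have "norm (t *\<^sub>R axis i (1::real) :: real^'n) = \<bar>t\<bar>" by simp
    finally show ?thesis using that by auto
  qed
  have pdE: "pd i (E (Suc m)) (z t) = of_real (y $ i) * E m (z t) -
        of_real k * (\<Sum>j\<in>UNIV - {i}. (E (Suc m) (z t) - E (Suc m) (swapv i j (z t))) / of_real (z t $ i - z t $ j))" if "t \<in> ?S" for m t
  proof -
    have "(\<Sum>j\<in>UNIV - {i}. divdiff i j (E (Suc m)) (z t)) = (\<Sum>j\<in>UNIV - {i}. (E (Suc m) (z t) - E (Suc m) (swapv i j (z t))) / of_real (z t $ i - z t $ j))"
          proof (intro sum.cong refl)
      fix j assume "j \<in> UNIV - {i}"
      hence "z t $ i \<noteq> z t $ j" using gap[OF that, of j] \<delta> by auto
      thus "divdiff i j (E (Suc m)) (z t) = (E (Suc m) (z t) - E (Suc m) (swapv i j (z t))) / of_real (z t $ i - z t $ j)"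
        by (simp add: divdiff_def)
    qed
    moreover have "complex_of_real (e m (z t) y) = E m (z t)" by (simp add: E_def)
    ultimately show ?thesis using dunkl_op_e[of i m y "z t"] by (simp add: dunkl_op_def E_def[symmetric] algebra_simps)
  qed
  have pdE0: "pd i (E 0) (z t) = 0" for t by (simp add: E_def)
  define M where "M m = (case m of 0 \<Rightarrow> 0 | Suc m \<Rightarrow> \<bar>y $ i\<bar> * B m + k * (real CARD('n) * (2 * B (Suc m) / \<delta>)))" for m
  have "((\<lambda>t. \<Sum>m. \<i> ^ m * E m (z t)) has_vector_derivative (\<Sum>m. f' m 0)) (at 0)"
  proof (rule has_vector_derivative_suminf[where S = "?S" and M = M])
    show "summable M"
    proof (subst summable_Suc_iff[symmetric])
      have "summable B" unfolding B_def by (rule summable_pow_fact)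
      moreover from this have "summable (\<lambda>m. B (Suc m))" by (subst summable_Suc_iff)
      ultimately show "summable (\<lambda>m. M (Suc m))" unfolding M_def nat.case
        by (intro summable_add summable_mult summable_divide)
    qed
    show "summable (\<lambda>m. \<i> ^ m * E m (z 0))" using summable_K by (simp add: E_def z_def)
    fix m t assume t: "t \<in> ?S"
    have "((\<lambda>s. E m (z t + s *\<^sub>R axis i 1)) has_vector_derivative pd i (E m) (z t)) (at 0)"
      unfolding E_def by (rule cpoly_has_pd[OF cpoly_e])
    moreover have "z t + s *\<^sub>R axis i 1 = z (t + s)" for s by (simp add: z_def scaleR_add_left)
    ultimately have "((\<lambda>s. E m (z (t + s))) has_vector_derivative pd i (E m) (z t)) (at 0)" by simp
    hence "((\<lambda>s. E m (z s)) has_vector_derivative pd i (E m) (z t)) (at t)"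
      using vector_diff_chain_at[of "\<lambda>s. s - t" 1 t "\<lambda>s. E m (z (t + s))" "pd i (E m) (z t)"]
      by (simp add: o_def derivative_eq_intros has_vector_derivative_diff_const)
    thus "((\<lambda>t. \<i> ^ m * E m (z t)) has_vector_derivative f' m t) (at t)"
      unfolding f'_def by (rule has_vector_derivative_mult_right)
    show "norm (f' m t) \<le> M m"
    proof (cases m)
      case 0 thus ?thesis by (simp add: f'_def pdE0 M_def)
    next
      case (Suc n)
      have "norm (\<Sum>j\<in>UNIV - {i}. (E (Suc n) (z t) - E (Suc n) (swapv i j (z t))) / of_real (z t $ i - z t $ j))
         \<le> (\<Sum>j\<in>UNIV - {i}. 2 * B (Suc n) / \<delta>)"
      proof (intro sum_norm_le)
        fix j assume j: "j \<in> UNIV - {i}"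
        have "norm (E (Suc n) (z t) - E (Suc n) (swapv i j (z t))) \<le> B (Suc n) + B (Suc n)"
          by (intro norm_triangle_le_diff add_mono bnd) (use nz[OF t] in auto)
        hence "norm (E (Suc n) (z t) - E (Suc n) (swapv i j (z t))) / \<bar>z t $ i - z t $ j\<bar> \<le> (2 * B (Suc n)) / \<delta>"
          using gap[OF t, of j] j \<delta> by (intro frac_le) (auto simp: B0)
        thus "norm ((E (Suc n) (z t) - E (Suc n) (swapv i j (z t))) / of_real (z t $ i - z t $ j)) \<le> 2 * B (Suc n) / \<delta>"
          by (simp add: norm_divide del: of_real_diff)
      qed
      also have "\<dots> \<le> (\<Sum>j\<in>(UNIV::'n set). 2 * B (Suc n) / \<delta>)"
        using \<delta> B0 by (intro sum_mono2) auto
      finally have 1: "norm (\<Sum>j\<in>UNIV - {i}. (E (Suc n) (z t) - E (Suc n) (swapv i j (z t))) / of_real (z t $ i - z t $ j)) \<le> real CARD('n) * (2 * B (Suc n) / \<delta>)"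
        by simp
      have "norm (f' m t) \<le> \<bar>y $ i\<bar> * B n + k * (real CARD('n) * (2 * B (Suc n) / \<delta>))"
      proof -
        let ?S = "\<Sum>j\<in>UNIV - {i}. (E (Suc n) (z t) - E (Suc n) (swapv i j (z t))) / of_real (z t $ i - z t $ j)"
        have "norm (f' m t) = norm (of_real (y $ i) * E n (z t) - of_real k * ?S)"
          unfolding f'_def Suc norm_mult norm_power pdE[OF t] by simp
        also have "\<dots> \<le> norm (of_real (y $ i) * E n (z t)) + norm (of_real k * ?S)"
          by (rule norm_triangle_ineq4)
        also have "\<dots> = \<bar>y $ i\<bar> * norm (E n (z t)) + k * norm ?S"
          using k_nonneg by (simp add: norm_mult)
        also have "\<dots> \<le> \<bar>y $ i\<bar> * B n + k * (real CARD('n) * (2 * B (Suc n) / \<delta>))"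
          by (intro add_mono mult_left_mono bnd[OF nz[OF t]] 1 k_nonneg abs_ge_zero)
        finally show ?thesis .
      qed
      thus ?thesis by (simp add: M_def Suc)
    qed
  qed (use \<delta> in auto)
  moreover have "(\<lambda>t. \<Sum>m. \<i> ^ m * E m (z t)) = (\<lambda>t. K (x + t *\<^sub>R axis i 1) y)"
    by (simp add: K_def E_def z_def)
  moreover have "(\<Sum>m. f' m 0) = \<i> * of_real (y $ i) * K x y - of_real k * (\<Sum>j\<in>UNIV - {i}. (K x y - K (swapv i j x) y) / of_real (x $ i - x $ j))"
  proof -
    have s1: "(\<lambda>n. \<i> ^ Suc n * E (Suc n) v) sums (K v y - 1)" for v
      using K_sums[of v y] unfolding E_def by (subst sums_Suc_iff) simp
    have z0: "z 0 = x" by (simp add: z_def)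
    have "(\<lambda>n. \<i> * of_real (y $ i) * (\<i> ^ n * E n x) - of_real k * (\<Sum>j\<in>UNIV - {i}. (\<i> ^ Suc n * E (Suc n) x - \<i> ^ Suc n * E (Suc n) (swapv i j x)) / of_real (x $ i - x $ j)))
      sums (\<i> * of_real (y $ i) * K x y - of_real k * (\<Sum>j\<in>UNIV - {i}. ((K x y - 1) - (K (swapv i j x) y - 1)) / of_real (x $ i - x $ j)))"
      unfolding E_def by (intro sums_diff sums_mult sums_sum sums_divide K_sums s1[unfolded E_def])
    also have "(\<lambda>n. \<i> * of_real (y $ i) * (\<i> ^ n * E n x) - of_real k * (\<Sum>j\<in>UNIV - {i}. (\<i> ^ Suc n * E (Suc n) x - \<i> ^ Suc n * E (Suc n) (swapv i j x)) / of_real (x $ i - x $ j)))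
      = (\<lambda>n. f' (Suc n) 0)"
    proof
      fix n
      have "f' (Suc n) 0 = \<i> ^ Suc n * (of_real (y $ i) * E n x -
        of_real k * (\<Sum>j\<in>UNIV - {i}. (E (Suc n) x - E (Suc n) (swapv i j x)) / of_real (x $ i - x $ j)))"
        unfolding f'_def using pdE[of 0 n] \<delta> by (simp add: z0)
      thus "\<i> * of_real (y $ i) * (\<i> ^ n * E n x) - of_real k * (\<Sum>j\<in>UNIV - {i}. (\<i> ^ Suc n * E (Suc n) x - \<i> ^ Suc n * E (Suc n) (swapv i j x)) / of_real (x $ i - x $ j)) = f' (Suc n) 0"
        by (simp add: right_diff_distrib sum_distrib_left diff_divide_distrib sum_subtractf mult_ac)
    qed
    finally have "(\<lambda>n. f' (Suc n) 0) sums (\<i> * of_real (y $ i) * K x y - of_real k * (\<Sum>j\<in>UNIV - {i}. (K x y - K (swapv i j x) y) / of_real (x $ i - x $ j)))"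
      by simp
    hence "(\<lambda>n. f' n 0) sums (\<i> * of_real (y $ i) * K x y - of_real k * (\<Sum>j\<in>UNIV - {i}. (K x y - K (swapv i j x) y) / of_real (x $ i - x $ j)) + f' 0 0)"
      by (subst (asm) sums_Suc_iff) simp
    thus ?thesis by (simp add: sums_iff f'_def pdE0)
  qed
  ultimately show ?thesis by simp
qed

end

section \<open>Real analyticity and uniqueness of the kernel\<close>

definition monom_at :: "real^'n::finite \<Rightarrow> ('n \<Rightarrow> nat) \<Rightarrow> complex" where
  "monom_at u \<alpha> = (\<Prod>i\<in>UNIV. complex_of_real (u $ i ^ \<alpha> i))"

lemma norm_monom_at_le_1: "(\<And>i. \<bar>u $ i\<bar> \<le> 1) \<Longrightarrow> norm (monom_at u \<alpha>) \<le> 1"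
  unfolding monom_at_def prod_norm[symmetric]
  by (intro prod_le_1) (auto simp: norm_power power_abs power_le_one)

text \<open>On the cube of radius 1 every monomial is bounded by 1, so the l1 norm of the
  coefficients alone controls convergence. The fixed radius is possible because the functions in
  question are entire.\<close>

definition expands :: "(real^'n::finite \<Rightarrow> complex) \<Rightarrow> real^'n \<Rightarrow> (('n \<Rightarrow> nat) \<Rightarrow> complex) \<Rightarrow> bool" where
  "expands f a c \<longleftrightarrow> (\<forall>u. (\<forall>i. \<bar>u $ i\<bar> \<le> 1) \<longrightarrow> ((\<lambda>\<alpha>. c \<alpha> * monom_at u \<alpha>) has_sum f (a + u)) UNIV)"

lemma expandsI: "(\<And>u. (\<And>i. \<bar>u $ i\<bar> \<le> 1) \<Longrightarrow> ((\<lambda>\<alpha>. c \<alpha> * monom_at u \<alpha>) has_sum f (a + u)) UNIV) \<Longrightarrow> expands f a c"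
  by (simp add: expands_def)

lemma expandsD: "expands f a c \<Longrightarrow> (\<And>i. \<bar>u $ i\<bar> \<le> 1) \<Longrightarrow> ((\<lambda>\<alpha>. c \<alpha> * monom_at u \<alpha>) has_sum f (a + u)) UNIV"
  by (simp add: expands_def)

text \<open>Bounding the coefficients at all centres of a cube at once keeps the class stable under
  permutations of the coordinates, which move the centre.\<close>

definition majorized :: "real \<Rightarrow> real \<Rightarrow> (real^'n::finite \<Rightarrow> complex) \<Rightarrow> bool" where
  "majorized A M f \<longleftrightarrow> (\<forall>a. (\<forall>i. \<bar>a $ i\<bar> \<le> A) \<longrightarrow>
     (\<exists>c N. N \<le> M \<and> ((\<lambda>\<alpha>. norm (c \<alpha>)) has_sum N) UNIV \<and> expands f a c))"

lemma majorizedI: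
  assumes "\<And>a. (\<And>i. \<bar>a $ i\<bar> \<le> A) \<Longrightarrow> \<exists>c N. N \<le> M \<and> ((\<lambda>\<alpha>. norm (c \<alpha>)) has_sum N) UNIV \<and> expands f a c"
  shows "majorized A M f"
  using assms unfolding majorized_def by blast

lemma majorizedE:
  assumes "majorized A M f" "\<And>i. \<bar>a $ i\<bar> \<le> A"
  obtains N c where "N \<le> M" "((\<lambda>\<alpha>. norm (c \<alpha>)) has_sum N) UNIV" "expands f a c"
  using assms unfolding majorized_def by blast

lemma majorized_imp_analytic:
  assumes "\<And>A. \<exists>M. majorized A M f"
  shows "real_analytic_Rn f"
  unfolding real_analytic_Rn_def
proof
  fix a :: "real^'a"
  obtain M where "majorized (norm a) M f" using assms by blast
  from majorizedE[OF this component_le_norm_cart] obtain c where c: "expands f a c" by metis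
  show "\<exists>r>0. \<exists>c. \<forall>x\<in>ball a r. ((\<lambda>\<alpha>. c \<alpha> * (\<Prod>i\<in>UNIV. complex_of_real ((x $ i - a $ i) ^ \<alpha> i))) has_sum f x) UNIV"
  proof (intro exI[of _ 1] conjI exI[of _ c] ballI)
    fix x assume x: "x \<in> ball a 1"
    have "\<bar>(x - a) $ i\<bar> \<le> 1" for i
      using x component_le_norm_cart[of "x - a" i] by (simp add: dist_norm norm_minus_commute)
    from expandsD[OF c this] show "((\<lambda>\<alpha>. c \<alpha> * (\<Prod>i\<in>UNIV. complex_of_real ((x $ i - a $ i) ^ \<alpha> i))) has_sum f x) UNIV"
      by (simp add: monom_at_def)
  qed simp
qed

lemma majorized_const: "majorized A (norm v) (\<lambda>_. v)"
proof (rule majorizedI)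
  fix a :: "real^'a"
  define c where "c \<alpha> = (if \<alpha> = (\<lambda>_. 0) then v else 0)" for \<alpha> :: "'a \<Rightarrow> nat"
  have "((\<lambda>\<alpha>. norm (c \<alpha>)) has_sum norm v) UNIV"
    using has_sum_cong_neutral[of UNIV "{\<lambda>_. 0}" "\<lambda>\<alpha>. norm (c \<alpha>)" "\<lambda>\<alpha>. norm (c \<alpha>)" "norm v"]
      has_sum_finite[of "{\<lambda>_::'a. 0::nat}" "\<lambda>\<alpha>. norm (c \<alpha>)"]
    by (simp add: c_def)
  moreover have "((\<lambda>\<alpha>. c \<alpha> * monom_at u \<alpha>) has_sum v) UNIV" for u
    using has_sum_cong_neutral[of UNIV "{\<lambda>_. 0}" "\<lambda>\<alpha>. c \<alpha> * monom_at u \<alpha>" "\<lambda>\<alpha>. c \<alpha> * monom_at u \<alpha>" "v"]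
      has_sum_finite[of "{\<lambda>_::'a. 0::nat}" "\<lambda>\<alpha>. c \<alpha> * monom_at u \<alpha>"]
    by (simp add: c_def monom_at_def)
  ultimately show "\<exists>c N. N \<le> norm v \<and> ((\<lambda>\<alpha>. norm (c \<alpha>)) has_sum N) UNIV \<and> expands (\<lambda>x. v) a c"
    by (intro exI[of _ c] exI[of _ "norm v"]) (auto simp: expands_def)
qed

lemma majorized_cmult:
  assumes "majorized A M f"
  shows "majorized A (norm v * M) (\<lambda>x. v * f x)"
proof (rule majorizedI)
  fix a :: "real^'a" assume "\<And>i. \<bar>a $ i\<bar> \<le> A"
  with assms obtain N c where c: "N \<le> M" "((\<lambda>\<alpha>. norm (c \<alpha>)) has_sum N) UNIV"
     "expands f a c"
    by (rule majorizedE)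
  show "\<exists>c N. N \<le> norm v * M \<and> ((\<lambda>\<alpha>. norm (c \<alpha>)) has_sum N) UNIV \<and> expands (\<lambda>x. (v * f x)) a c"
    using has_sum_cmult_right[OF c(2), of "norm v"] has_sum_cmult_right[OF expandsD[OF c(3)], of _ v] c(1)
    by (intro exI[of _ "\<lambda>\<alpha>. v * c \<alpha>"] exI[of _ "norm v * N"]) (auto simp: norm_mult mult.assoc mult_left_mono expands_def)
qed

lemma majorized_add:
  assumes "majorized A M f" "majorized A M' g"
  shows "majorized A (M + M') (\<lambda>x. f x + g x)"
proof (rule majorizedI)
  fix a :: "real^'a" assume a: "\<And>i. \<bar>a $ i\<bar> \<le> A"
  obtain N c where c: "N \<le> M" "((\<lambda>\<alpha>. norm (c \<alpha>)) has_sum N) UNIV"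
     "expands f a c"
    by (rule majorizedE[OF assms(1) a])
  obtain N' c' where c': "N' \<le> M'" "((\<lambda>\<alpha>. norm (c' \<alpha>)) has_sum N') UNIV"
     "expands g a c'"
    by (rule majorizedE[OF assms(2) a])
  have s: "((\<lambda>\<alpha>. norm (c \<alpha>) + norm (c' \<alpha>)) has_sum (N + N')) UNIV"
    by (rule has_sum_add[OF c(2) c'(2)])
  have "(\<lambda>\<alpha>. norm (c \<alpha> + c' \<alpha>)) summable_on UNIV"
    by (rule Infinite_Sum.abs_summable_on_comparison_test[of "\<lambda>\<alpha>. norm (c \<alpha>) + norm (c' \<alpha>)"])
       (use s in \<open>auto simp: summable_on_def norm_triangle_ineq\<close>)
  then obtain N'' where N'': "((\<lambda>\<alpha>. norm (c \<alpha> + c' \<alpha>)) has_sum N'') UNIV" by (auto simp: summable_on_def)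
  moreover have "N'' \<le> N + N'" by (rule has_sum_mono[OF N'' s]) (rule norm_triangle_ineq)
  moreover have "((\<lambda>\<alpha>. (c \<alpha> + c' \<alpha>) * monom_at u \<alpha>) has_sum (f (a + u) + g (a + u))) UNIV" if "\<And>i. \<bar>u $ i\<bar> \<le> 1" for u
    using has_sum_add[OF expandsD[OF c(3) that] expandsD[OF c'(3) that]] by (simp add: distrib_right)
  ultimately show "\<exists>c N. N \<le> M + M' \<and> ((\<lambda>\<alpha>. norm (c \<alpha>)) has_sum N) UNIV \<and> expands (\<lambda>x. (f x + g x)) a c"
    using c(1) c'(1) by (intro exI[of _ "\<lambda>\<alpha>. c \<alpha> + c' \<alpha>"] exI[of _ "N''"]) (auto simp: expands_def)
qed

lemma majorized_sum:
  "finite I \<Longrightarrow> (\<And>i. i \<in> I \<Longrightarrow> majorized A (M i) (f i)) \<Longrightarrow> majorized A (\<Sum>i\<in>I. M i) (\<lambda>x. \<Sum>i\<in>I. f i x)"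
  by (induction I rule: finite_induct) (use majorized_const[of A 0] in \<open>auto intro: majorized_add\<close>)

text \<open>The expansion at \<open>a\<close> is that of \<open>f\<close> at the permuted centre
  with correspondingly permuted exponents. Bijectivity of \<open>w\<close> makes this relabelling of
  exponents a bijection.\<close>

lemma majorized_pm:
  assumes "majorized A M f" "bij w"
  shows "majorized A M (\<lambda>x. f (pm w x))"
proof (rule majorizedI)
  fix a :: "real^'a" assume a: "\<And>i. \<bar>a $ i\<bar> \<le> A"
  obtain N c where c: "N \<le> M" "((\<lambda>\<alpha>. norm (c \<alpha>)) has_sum N) UNIV"
     "expands f (pm w a) c"
    by (rule majorizedE[OF assms(1), of "pm w a"]) (use a in auto)
  have bij: "bij (\<lambda>\<beta> :: 'a \<Rightarrow> nat. \<beta> \<circ> w)"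
    using assms(2) by (intro o_bij[of "\<lambda>\<beta>. \<beta> \<circ> inv w"]) (auto simp: fun_eq_iff bij_is_inj bij_is_surj surj_f_inv_f)
  have mon: "monom_at (pm w u) (\<beta> \<circ> w) = monom_at u \<beta>" for u \<beta>
    unfolding monom_at_def using prod.reindex_bij_betw[OF assms(2), of "\<lambda>i. complex_of_real (u $ i ^ \<beta> i)"] by simp
  have "((\<lambda>\<beta>. norm (c (\<beta> \<circ> w))) has_sum N) UNIV"
    using c(2) by (subst has_sum_reindex_bij_betw[OF bij])
  moreover have "((\<lambda>\<beta>. c (\<beta> \<circ> w) * monom_at u \<beta>) has_sum f (pm w (a + u))) UNIV" if "\<And>i. \<bar>u $ i\<bar> \<le> 1" for u
  proof -
    have "pm w (a + u) = pm w a + pm w u" by (simp add: vec_eq_iff)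
    with expandsD[OF c(3), of "pm w u"] that have "((\<lambda>\<alpha>. c \<alpha> * monom_at (pm w u) \<alpha>) has_sum f (pm w (a + u))) UNIV" by simp
    hence "((\<lambda>\<beta>. c (\<beta> \<circ> w) * monom_at (pm w u) (\<beta> \<circ> w)) has_sum f (pm w (a + u))) UNIV"
      by (subst has_sum_reindex_bij_betw[OF bij])
    thus ?thesis by (simp only: mon)
  qed
  ultimately show "\<exists>c N. N \<le> M \<and> ((\<lambda>\<alpha>. norm (c \<alpha>)) has_sum N) UNIV \<and> expands (\<lambda>x. f (pm w x)) a c"
    using c(1) by (intro exI[of _ "\<lambda>\<beta>. c (\<beta> \<circ> w)"] exI[of _ N]) (auto simp: expands_def)
qed

lemma majorized_nonneg: 
  assumes "majorized A M (f :: real^'n::finite \<Rightarrow> complex)" "A \<ge> 0"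
  shows "M \<ge> 0"
proof -
  obtain N c where c: "N \<le> M" "((\<lambda>\<alpha>. norm (c \<alpha> :: complex)) has_sum N) (UNIV :: ('n \<Rightarrow> nat) set)"
    by (rule majorizedE[OF assms(1), of 0]) (use assms in auto)
  have "N \<ge> 0" using c(2) by (rule has_sum_nonneg) simp
  thus ?thesis using c(1) by simp
qed

text \<open>Write x_l = a_l + u_l with |a_l| \<le> A. Multiplication by u_l shifts exponents by
  \<open>up\<close> and preserves the norm of the coefficients, which explains the factor A +
  1.\<close>

lemma majorized_coord:
  assumes f: "majorized A M f" and A: "A \<ge> 0"
  shows "majorized A ((A + 1) * M) (\<lambda>x. of_real (x $ l) * f x)"
proof (rule majorizedI)
  fix a :: "real^'a" assume a: "\<And>i. \<bar>a $ i\<bar> \<le> A"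
  obtain N c where c: "N \<le> M" "((\<lambda>\<alpha>. norm (c \<alpha>)) has_sum N) UNIV"
     "expands f a c"
    by (rule majorizedE[OF f a])
  have N0: "N \<ge> 0" using c(2) by (rule has_sum_nonneg) simp
  define up where "up \<alpha> = \<alpha>(l := Suc (\<alpha> l))" for \<alpha> :: "'a \<Rightarrow> nat"
  define c1 where "c1 \<alpha> = (if \<alpha> l = 0 then 0 else c (\<alpha>(l := \<alpha> l - 1)))" for \<alpha> :: "'a \<Rightarrow> nat"
  have inj: "inj up"
    by (rule inj_on_inverseI[where g = "\<lambda>\<alpha>. \<alpha>(l := \<alpha> l - 1)"]) (simp add: up_def)
  have rng: "\<alpha> \<in> range up \<longleftrightarrow> \<alpha> l \<noteq> 0" for \<alpha>
  proof
    assume "\<alpha> l \<noteq> 0"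
    hence "\<alpha> = up (\<alpha>(l := \<alpha> l - 1))" by (simp add: up_def fun_eq_iff)
    thus "\<alpha> \<in> range up" by blast
  qed (auto simp: up_def)
  have c1_up: "c1 (up \<alpha>) = c \<alpha>" for \<alpha> by (simp add: c1_def up_def)
  have mon_up: "monom_at u (up \<alpha>) = of_real (u $ l) * monom_at u \<alpha>" for u \<alpha>
  proof -
    have "monom_at u (up \<alpha>) = of_real (u $ l ^ Suc (\<alpha> l)) * (\<Prod>i\<in>UNIV-{l}. complex_of_real (u $ i ^ up \<alpha> i))"
      unfolding monom_at_def by (subst prod.remove[of _ l]) (auto simp: up_def)
    also have "(\<Prod>i\<in>UNIV-{l}. complex_of_real (u $ i ^ up \<alpha> i)) = (\<Prod>i\<in>UNIV-{l}. complex_of_real (u $ i ^ \<alpha> i))"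
      by (intro prod.cong) (auto simp: up_def)
    also have "of_real (u $ l ^ Suc (\<alpha> l)) * \<dots> = of_real (u $ l) * monom_at u \<alpha>"
      unfolding monom_at_def by (subst (2) prod.remove[of _ l]) auto
    finally show ?thesis .
  qed
  have "((\<lambda>\<alpha>. norm (c1 (up \<alpha>))) has_sum N) UNIV" using c(2) by (simp add: c1_up)
  hence "((\<lambda>\<alpha>. norm (c1 \<alpha>)) has_sum N) (range up)"
    by (subst has_sum_reindex[OF inj]) (simp add: o_def)
  hence n1: "((\<lambda>\<alpha>. norm (c1 \<alpha>)) has_sum N) UNIV"
    by (subst has_sum_cong_neutral[of "range up" _ "\<lambda>\<alpha>. norm (c1 \<alpha>)"]) (auto simp: rng c1_def)
  have s: "((\<lambda>\<alpha>. \<bar>a $ l\<bar> * norm (c \<alpha>) + norm (c1 \<alpha>)) has_sum (\<bar>a $ l\<bar> * N + N)) UNIV"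
    by (intro has_sum_add has_sum_cmult_right c(2) n1)
  have le: "norm (of_real (a $ l) * c \<alpha> + c1 \<alpha>) \<le> \<bar>a $ l\<bar> * norm (c \<alpha>) + norm (c1 \<alpha>)" for \<alpha>
    by (rule order_trans[OF norm_triangle_ineq]) (simp add: norm_mult)
  have "(\<lambda>\<alpha>. norm (of_real (a $ l) * c \<alpha> + c1 \<alpha>)) summable_on UNIV"
    by (rule Infinite_Sum.abs_summable_on_comparison_test[of "\<lambda>\<alpha>. \<bar>a $ l\<bar> * norm (c \<alpha>) + norm (c1 \<alpha>)"])
       (use s le in \<open>auto simp: summable_on_def\<close>)
  then obtain N'' where N'': "((\<lambda>\<alpha>. norm (of_real (a $ l) * c \<alpha> + c1 \<alpha>)) has_sum N'') UNIV" by (auto simp: summable_on_def)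
  moreover have "N'' \<le> (A + 1) * M"
  proof -
    have "N'' \<le> \<bar>a $ l\<bar> * N + N" by (rule has_sum_mono[OF N'' s]) (rule le)
    also have "\<dots> \<le> (A + 1) * N" using a[of l] N0 by (simp add: distrib_right mult_right_mono)
    also have "\<dots> \<le> (A + 1) * M" using c(1) A by (intro mult_left_mono) auto
    finally show ?thesis .
  qed
  moreover have "((\<lambda>\<alpha>. (of_real (a $ l) * c \<alpha> + c1 \<alpha>) * monom_at u \<alpha>) has_sum (of_real ((a + u) $ l) * f (a + u))) UNIV" if u: "\<And>i. \<bar>u $ i\<bar> \<le> 1" for u
  proof -
    have "((\<lambda>\<alpha>. of_real (u $ l) * (c \<alpha> * monom_at u \<alpha>)) has_sum (of_real (u $ l) * f (a + u))) UNIV"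
      by (rule has_sum_cmult_right[OF expandsD[OF c(3) u]])
    hence "((\<lambda>\<alpha>. c1 (up \<alpha>) * monom_at u (up \<alpha>)) has_sum (of_real (u $ l) * f (a + u))) UNIV"
      by (simp add: c1_up mon_up mult_ac)
    hence "((\<lambda>\<alpha>. c1 \<alpha> * monom_at u \<alpha>) has_sum (of_real (u $ l) * f (a + u))) (range up)"
      by (subst has_sum_reindex[OF inj]) (simp add: o_def)
    hence "((\<lambda>\<alpha>. c1 \<alpha> * monom_at u \<alpha>) has_sum (of_real (u $ l) * f (a + u))) UNIV"
      by (subst has_sum_cong_neutral[of "range up" _ "\<lambda>\<alpha>. c1 \<alpha> * monom_at u \<alpha>"]) (auto simp: rng c1_def)
    from has_sum_add[OF has_sum_cmult_right[OF expandsD[OF c(3) u], of "of_real (a $ l)"] this]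
    show ?thesis by (simp add: distrib_right mult.assoc)
  qed
  ultimately show "\<exists>c N. N \<le> (A + 1) * M \<and> ((\<lambda>\<alpha>. norm (c \<alpha>)) has_sum N) UNIV \<and> expands (\<lambda>x. (of_real (x $ l) * f x)) a c"
    by (intro exI[of _ "\<lambda>\<alpha>. of_real (a $ l) * c \<alpha> + c1 \<alpha>"] exI[of _ "N''"]) (auto simp: expands_def)
qed

text \<open>The coefficients form an absolutely summable double family, so the expansion of the sum
  at a centre is obtained by interchanging the two summations.\<close>

lemma majorized_series:
  assumes f: "\<And>m. majorized A (M m) (f m)" and M: "summable M" "\<And>m. M m \<ge> 0"
    and sums: "\<And>x. (\<lambda>m. f m x) sums g x"
  shows "majorized A (\<Sum>m. M m) g"
proof (rule majorizedI)
  fix a :: "real^'a" assume a: "\<And>i. \<bar>a $ i\<bar> \<le> A"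
  have "\<forall>m. \<exists>c N. N \<le> M m \<and> ((\<lambda>\<alpha>. norm (c \<alpha>)) has_sum N) UNIV \<and> expands (f m) a c"
    using f a unfolding majorized_def by blast
  then obtain N c where N: "\<And>m. N m \<le> M m" and c: "\<And>m. ((\<lambda>\<alpha>. norm (c m \<alpha>)) has_sum N m) UNIV"
    and cu: "\<And>m. expands (f m) a (c m)"
    by metis
  have N0: "N m \<ge> 0" for m using c by (rule has_sum_nonneg) simp
  have sM: "(M has_sum (\<Sum>m. M m)) UNIV"
    by (rule sums_nonneg_imp_has_sum[OF summable_sums[OF M(1)] M(2)])
  have sN: "N summable_on UNIV"
    using Infinite_Sum.abs_summable_on_comparison_test[of M UNIV N] sM N N0 M(2)
    by (auto simp: summable_on_def)
  have inf_c: "infsum (\<lambda>\<alpha>. norm (c m \<alpha>)) UNIV = N m" for m using c by (rule infsumI)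
  have sc: "(\<lambda>x. norm (case x of (m, \<alpha>) \<Rightarrow> c m \<alpha>)) summable_on UNIV \<times> UNIV"
    using c sN N0 by (subst Infinite_Sum.abs_summable_on_Sigma_iff) (auto simp: inf_c summable_on_def)
  have su: "(\<lambda>x. norm (case x of (m, \<alpha>) \<Rightarrow> c m \<alpha> * monom_at u \<alpha>)) summable_on UNIV \<times> UNIV" if u: "\<And>i. \<bar>u $ i\<bar> \<le> 1" for u
  proof (rule Infinite_Sum.abs_summable_on_comparison_test[OF sc])
    fix x show "norm ((\<lambda>(m, \<alpha>). c m \<alpha> * monom_at u \<alpha>) x) \<le> norm ((\<lambda>(m, \<alpha>). c m \<alpha>) x)"
      using mult_left_mono[OF norm_monom_at_le_1[of u, OF u], of "norm (c (fst x) (snd x))"]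
      by (simp add: case_prod_unfold norm_mult)
  qed
  define C where "C \<alpha> = (\<Sum>\<^sub>\<infinity>m. c m \<alpha>)" for \<alpha>
  have sc': "(\<lambda>x. norm (case x of (\<alpha>, m) \<Rightarrow> c m \<alpha>)) summable_on UNIV \<times> UNIV"
    using summable_on_reindex_bij_betw[of prod.swap UNIV UNIV "\<lambda>x. norm (case x of (m, \<alpha>) \<Rightarrow> c m \<alpha>)"] sc
    by (simp add: case_prod_unfold bij_swap)
  have sc2: "(\<lambda>m. norm (c m \<alpha>)) summable_on UNIV" "(\<lambda>\<alpha>. \<Sum>\<^sub>\<infinity>m. norm (c m \<alpha>)) summable_on UNIV" for \<alpha>
    using Infinite_Sum.abs_summable_on_Sigma_iff[of "\<lambda>(\<alpha>, m). c m \<alpha>" UNIV "\<lambda>_. UNIV"] sc' by (simp_all add: infsum_nonneg)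
  have Cle: "norm (C \<alpha>) \<le> (\<Sum>\<^sub>\<infinity>m. norm (c m \<alpha>))" for \<alpha>
    unfolding C_def by (rule norm_infsum_bound[OF sc2(1)])
  have sC: "(\<lambda>\<alpha>. norm (C \<alpha>)) summable_on UNIV"
    by (rule Infinite_Sum.abs_summable_on_comparison_test[of "\<lambda>\<alpha>. \<Sum>\<^sub>\<infinity>m. norm (c m \<alpha>)"])
       (use sc2 Cle in \<open>auto simp: infsum_nonneg\<close>)
  have "infsum (\<lambda>\<alpha>. norm (C \<alpha>)) UNIV \<le> infsum (\<lambda>\<alpha>. \<Sum>\<^sub>\<infinity>m. norm (c m \<alpha>)) UNIV"
    by (rule infsum_mono[OF sC sc2(2) Cle])
  also have "\<dots> = (\<Sum>\<^sub>\<infinity>m. \<Sum>\<^sub>\<infinity>\<alpha>. norm (c m \<alpha>))"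
    by (rule infsum_swap_banach) (use sc' in \<open>simp add: case_prod_unfold\<close>)
  also have "\<dots> \<le> (\<Sum>m. M m)"
    unfolding inf_c using infsum_mono[of N UNIV M] sN sM N infsumI[OF sM] by (auto simp: summable_on_def)
  finally have NC: "infsum (\<lambda>\<alpha>. norm (C \<alpha>)) UNIV \<le> (\<Sum>m. M m)" .
  have "expands g a C"
  proof (rule expandsI)
    fix u :: "real^'a" assume u: "\<And>i. \<bar>u $ i\<bar> \<le> 1"
    have s1: "(\<lambda>(m, \<alpha>). c m \<alpha> * monom_at u \<alpha>) summable_on UNIV \<times> UNIV"
      by (rule abs_summable_summable, rule su, rule u)
    have s2: "(\<lambda>m. \<Sum>\<^sub>\<infinity>\<alpha>. c m \<alpha> * monom_at u \<alpha>) summable_on UNIV"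
      using summable_on_Sigma_banach[of "\<lambda>m \<alpha>. c m \<alpha> * monom_at u \<alpha>" UNIV "\<lambda>_. UNIV"] s1 by simp
    have i: "(\<Sum>\<^sub>\<infinity>\<alpha>. c m \<alpha> * monom_at u \<alpha>) = f m (a + u)" for m using expandsD[OF cu, of u m] u by (intro infsumI) auto
    have "(\<lambda>m. f m (a + u)) sums (\<Sum>\<^sub>\<infinity>m. f m (a + u))"
      using has_sum_infsum[OF s2] unfolding i by (rule has_sum_imp_sums)
    hence g: "(\<Sum>\<^sub>\<infinity>m. f m (a + u)) = g (a + u)" using sums[of "a + u"] by (rule sums_unique2)
    have Cm: "C \<alpha> * monom_at u \<alpha> = (\<Sum>\<^sub>\<infinity>m. c m \<alpha> * monom_at u \<alpha>)" for \<alpha>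
      unfolding C_def by (rule infsum_cmult_left[symmetric]) (use sc2(1) in \<open>auto intro: abs_summable_summable\<close>)
    have "(\<Sum>\<^sub>\<infinity>\<alpha>. C \<alpha> * monom_at u \<alpha>) = (\<Sum>\<^sub>\<infinity>m. \<Sum>\<^sub>\<infinity>\<alpha>. c m \<alpha> * monom_at u \<alpha>)"
      unfolding Cm by (rule infsum_swap_banach[OF s1, symmetric])
    also have "\<dots> = g (a + u)" unfolding i by (rule g)
    finally have 1: "(\<Sum>\<^sub>\<infinity>\<alpha>. C \<alpha> * monom_at u \<alpha>) = g (a + u)" .
    have "(\<lambda>\<alpha>. norm (C \<alpha> * monom_at u \<alpha>)) summable_on UNIV"
    proof (rule Infinite_Sum.abs_summable_on_comparison_test[of C])
      show "(\<lambda>\<alpha>. norm (C \<alpha>)) summable_on UNIV" by (rule sC)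
      fix \<alpha> show "norm (C \<alpha> * monom_at u \<alpha>) \<le> norm (C \<alpha>)"
        using mult_left_mono[OF norm_monom_at_le_1[of u, OF u], of "norm (C \<alpha>)"] by (simp add: norm_mult)
    qed
    from has_sum_infsum[OF abs_summable_summable[OF this]] 1 show "((\<lambda>\<alpha>. C \<alpha> * monom_at u \<alpha>) has_sum g (a + u)) UNIV" by simp
  qed
  thus "\<exists>c N. N \<le> (\<Sum>m. M m) \<and> ((\<lambda>\<alpha>. norm (c \<alpha>)) has_sum N) UNIV \<and> expands g a c"
    using NC has_sum_infsum[OF sC] by blast
qed

text \<open>Uniqueness needs the chain rule along rays, hence total differentiability. The
  derivative is read off from the terms of degree 1. The rest is quadratically small: for |u| \<le>
  \<open>\<delta>\<close> a term of degree at least 2 is at most (|u|/\<open>\<delta>\<close>)^2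
  times its size at the vector with all coordinates \<open>\<delta>\<close>.\<close>

lemma real_analytic_imp_differentiable:
  fixes f :: "real^'n::finite \<Rightarrow> complex"
  assumes "real_analytic_Rn f"
  shows "f differentiable (at a)"
proof -
  from assms obtain r c where r: "r > 0" and
    c: "\<And>x. x \<in> ball a r \<Longrightarrow> ((\<lambda>\<alpha>. c \<alpha> * (\<Prod>i\<in>UNIV. complex_of_real ((x $ i - a $ i) ^ \<alpha> i))) has_sum f x) UNIV"
    unfolding real_analytic_Rn_def by blast
  have c': "((\<lambda>\<alpha>. c \<alpha> * monom_at u \<alpha>) has_sum f (a + u)) UNIV" if "norm u < r" for u
    using c[of "a + u"] that by (simp add: monom_at_def dist_norm)
  \<comment> \<open>The vector \<open>d\<close> with all coordinates \<open>\<delta>\<close> then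
    has norm at most r/2, so the series converges there, and absolutely, complex sums over an index
    set being unconditional.\<close>
  define \<delta> where "\<delta> = r / (2 * real CARD('n))"
  have \<delta>: "\<delta> > 0" "\<delta> \<le> r / 2" using r by (auto simp: \<delta>_def field_simps Suc_le_eq)
  define d where "d = (\<chi> i::'n. \<delta>)"
  have "norm d \<le> (\<Sum>i\<in>UNIV. \<bar>d $ i\<bar>)" by (rule norm_le_l1_cart)
  also have "\<dots> = r / 2" using \<delta> by (simp add: d_def \<delta>_def)
  finally have "norm d < r" using r by simp
  from c'[OF this] have "(\<lambda>\<alpha>. norm (c \<alpha> * monom_at d \<alpha>)) summable_on UNIV"
    unfolding summable_on_iff_abs_summable_on_complex[symmetric] by (auto simp: summable_on_def)
  moreover have mon_d: "monom_at d \<alpha> = of_real (\<delta> ^ (\<Sum>i\<in>UNIV. \<alpha> i))" for \<alpha>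
    unfolding monom_at_def d_def of_real_prod[symmetric] by (simp add: power_sum)
  ultimately have "(\<lambda>\<alpha>. norm (c \<alpha>) * \<delta> ^ (\<Sum>i\<in>UNIV. \<alpha> i)) summable_on UNIV"
    using \<delta> by (simp add: norm_mult norm_power)
  then obtain B where B: "((\<lambda>\<alpha>. norm (c \<alpha>) * \<delta> ^ (\<Sum>i\<in>UNIV. \<alpha> i)) has_sum B) UNIV"
    by (auto simp: summable_on_def)
  have B0: "B \<ge> 0" using B \<delta> by (intro has_sum_nonneg[OF B]) auto
  define unit where "unit i = (\<lambda>j. if j = i then 1 else 0 :: nat)" for i :: 'n
  define F where "F = insert (\<lambda>_. 0) (range unit)"
  define L where "L u = (\<Sum>i\<in>UNIV. c (unit i) * of_real (u $ i))" for u :: "real^'n"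
  have inj_unit: "inj unit" by (rule injI) (metis unit_def zero_neq_one)
  have unit_ne: "(\<lambda>_. 0) \<notin> range unit"
  proof
    assume "(\<lambda>_. 0) \<in> range unit"
    then obtain i where "(\<lambda>_. 0) = unit i" by auto
    from fun_cong[OF this, of i] show False by (simp add: unit_def)
  qed
  have mon_unit: "monom_at u (unit i) = of_real (u $ i)" for u i
  proof -
    have "monom_at u (unit i) = (\<Prod>j\<in>UNIV. if j = i then complex_of_real (u $ i) else 1)"
      unfolding monom_at_def by (intro prod.cong) (auto simp: unit_def)
    thus ?thesis by simp
  qed
  have sumF: "(\<Sum>\<alpha>\<in>F. c \<alpha> * monom_at u \<alpha>) = c (\<lambda>_. 0) + L u" for u
    unfolding F_def L_def using unit_ne
    by (simp add: sum.reindex[OF inj_unit] mon_unit) (simp add: monom_at_def)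
  have big: "(\<Sum>i\<in>UNIV. \<alpha> i) \<ge> 2" if "\<alpha> \<notin> F" for \<alpha>
  proof (rule ccontr)
    assume "\<not> ?thesis"
    hence le: "(\<Sum>i\<in>UNIV. \<alpha> i) \<le> 1" by simp
    from that have "\<alpha> \<noteq> (\<lambda>_. 0)" by (auto simp: F_def)
    then obtain i where i: "\<alpha> i \<noteq> 0" by auto
    have sr: "(\<Sum>i\<in>UNIV. \<alpha> i) = \<alpha> i + (\<Sum>j\<in>UNIV-{i}. \<alpha> j)" by (rule sum.remove) auto
    have "\<alpha> i = 1" "(\<Sum>j\<in>UNIV-{i}. \<alpha> j) = 0" using i le sr by linarith+
    moreover from this have "\<alpha> j = 0" if "j \<noteq> i" for j using that by simp
    ultimately have "\<alpha> = unit i" unfolding unit_def by (intro ext) simp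
    with that show False by (auto simp: F_def)
  qed
  have est: "norm (f (a + u) - c (\<lambda>_. 0) - L u) \<le> B * (norm u / \<delta>)\<^sup>2" if u: "norm u \<le> \<delta>" for u
  proof -
    have "norm u < r" using u \<delta> r by linarith
    have "((\<lambda>\<alpha>. c \<alpha> * monom_at u \<alpha>) has_sum (c (\<lambda>_. 0) + L u)) F"
      using has_sum_finite[of F "\<lambda>\<alpha>. c \<alpha> * monom_at u \<alpha>"] by (simp add: sumF) (simp add: F_def)
    from has_sum_Diff[OF c'[OF \<open>norm u < r\<close>] this]
    have 1: "((\<lambda>\<alpha>. c \<alpha> * monom_at u \<alpha>) has_sum (f (a + u) - (c (\<lambda>_. 0) + L u))) (UNIV - F)" by simp
    have "(\<lambda>\<alpha>. c \<alpha> * monom_at u \<alpha>) summable_on (UNIV - F)" using 1 by (auto simp: summable_on_def)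
    hence "(\<lambda>\<alpha>. norm (c \<alpha> * monom_at u \<alpha>)) summable_on (UNIV - F)"
      by (simp add: summable_on_iff_abs_summable_on_complex)
    then obtain S where S: "((\<lambda>\<alpha>. norm (c \<alpha> * monom_at u \<alpha>)) has_sum S) (UNIV - F)" by (auto simp: summable_on_def)
    have "norm (f (a + u) - (c (\<lambda>_. 0) + L u)) \<le> S" by (rule norm_has_sum_bound[OF S 1])
    also have "S \<le> B * (norm u / \<delta>)\<^sup>2"
    proof (rule has_sum_mono_neutral[OF S has_sum_cmult_left[OF B]])
      fix \<alpha> assume "\<alpha> \<in> (UNIV - F) \<inter> UNIV"
      hence \<alpha>: "(\<Sum>i\<in>UNIV. \<alpha> i) \<ge> 2" using big by auto
      have "norm (monom_at u \<alpha>) = (\<Prod>i\<in>UNIV. \<bar>u $ i\<bar> ^ \<alpha> i)"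
        unfolding monom_at_def prod_norm[symmetric] by (simp add: norm_power)
      also have "\<dots> \<le> (\<Prod>i\<in>UNIV. norm u ^ \<alpha> i)"
        by (intro prod_mono conjI power_mono component_le_norm_cart) auto
      also have "\<dots> = (norm u / \<delta>) ^ (\<Sum>i\<in>UNIV. \<alpha> i) * \<delta> ^ (\<Sum>i\<in>UNIV. \<alpha> i)"
        using \<delta> by (simp add: power_sum[symmetric] power_divide)
      also have "\<dots> \<le> (norm u / \<delta>)\<^sup>2 * \<delta> ^ (\<Sum>i\<in>UNIV. \<alpha> i)"
        using \<delta> u \<alpha> by (intro mult_right_mono power_decreasing) auto
      finally have "norm (c \<alpha>) * norm (monom_at u \<alpha>) \<le> norm (c \<alpha>) * ((norm u / \<delta>)\<^sup>2 * \<delta> ^ (\<Sum>i\<in>UNIV. \<alpha> i))"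
        by (rule mult_left_mono) simp
      thus "norm (c \<alpha> * monom_at u \<alpha>) \<le> norm (c \<alpha>) * \<delta> ^ (\<Sum>i\<in>UNIV. \<alpha> i) * (norm u / \<delta>)\<^sup>2"
        by (simp add: norm_mult mult_ac)
    qed (use \<delta> in auto)
    finally show ?thesis by (simp add: diff_diff_eq)
  qed
  have c0: "c (\<lambda>_. 0) = f a" using est[of 0] \<delta> by (simp add: L_def)
  have bl: "bounded_linear L" unfolding L_def
    by (intro bounded_linear_sum bounded_linear_compose[OF bounded_linear_mult_right] bounded_linear_compose[OF bounded_linear_of_real] bounded_linear_vec_nth)
  have "(f has_derivative L) (at a)"
    unfolding has_derivative_at
  proof (intro conjI bl)
    show "(\<lambda>h. norm (f (a + h) - f a - L h) / norm h) \<midarrow>0\<rightarrow> 0"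
    proof (rule Lim_null_comparison[where g = "\<lambda>h. B / \<delta>\<^sup>2 * norm h"])
      show "\<forall>\<^sub>F h in at 0. norm (norm (f (a + h) - f a - L h) / norm h) \<le> B / \<delta>\<^sup>2 * norm h"
        unfolding eventually_at
      proof (intro exI[of _ \<delta>] conjI ballI impI \<delta>(1))
        fix h :: "real^'n" assume "h \<noteq> 0 \<and> dist h 0 < \<delta>"
        hence h: "norm h > 0" "norm h \<le> \<delta>" by auto
        have "norm (f (a + h) - f a - L h) / norm h \<le> B * (norm h / \<delta>)\<^sup>2 / norm h"
          using est[OF h(2)] h(1) by (intro divide_right_mono) (auto simp: c0)
        also have "\<dots> = B / \<delta>\<^sup>2 * norm h" using h(1) by (simp add: field_simps power2_eq_square)
        finally show "norm (norm (f (a + h) - f a - L h) / norm h) \<le> B / \<delta>\<^sup>2 * norm h" by simp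
      qed
      show "((\<lambda>h. B / \<delta>\<^sup>2 * norm h) \<longlongrightarrow> 0) (at 0)"
        by (rule tendsto_eq_intros refl | simp)+
    qed
  qed
  thus ?thesis by (auto simp: differentiable_def)
qed

lemma negligible_coord_eq:
  fixes i j :: "'n::finite"
  assumes "i \<noteq> j"
  shows "negligible {x :: real^'n. x $ i = x $ j}"
proof -
  have "negligible {x :: real^'n. (axis i 1 - axis j 1) \<bullet> x = 0}"
  proof (rule negligible_hyperplane)
    have "(axis i 1 - axis j (1::real)) $ i = 1" using assms by (simp add: axis_def)
    thus "axis i 1 - axis j (1::real) \<noteq> 0 \<or> (0::real) \<noteq> 0" by (metis zero_index zero_neq_one)
  qed
  thus ?thesis by (simp add: inner_diff_left inner_axis')
qed

lemma negligible_not_regular: "negligible {x :: real^'n::finite. \<exists>i j. i \<noteq> j \<and> x $ i = x $ j}"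
proof -
  have "{x :: real^'n. \<exists>i j. i \<noteq> j \<and> x $ i = x $ j} = (\<Union>p\<in>{p. fst p \<noteq> snd p}. {x. x $ fst p = x $ snd p})" by (auto, blast)
  thus ?thesis by (auto intro!: negligible_Union negligible_coord_eq)
qed

text \<open>Lets an identity be checked only where all coordinates differ, that is, where the
  difference quotients make sense: the exceptional set is negligible, a nonempty open set is
  not.\<close>

lemma continuous_eq_regular:
  fixes f g :: "real^'n::finite \<Rightarrow> complex"
  assumes "continuous_on UNIV f" "continuous_on UNIV g"
    and "\<And>x. (\<And>i j. i \<noteq> j \<Longrightarrow> x $ i \<noteq> x $ j) \<Longrightarrow> f x = g x"
  shows "f x = g x"
proof (rule ccontr)
  assume ne: "f x \<noteq> g x"
  let ?S = "{x. f x \<noteq> g x}"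
  have "open ?S" by (rule open_Collect_neq[OF assms(1,2)])
  moreover have "?S \<noteq> {}" using ne by auto
  moreover have "negligible ?S"
    by (rule negligible_subset[OF negligible_not_regular]) (use assms(3) in fastforce)
  ultimately show False using open_not_negligible by blast
qed

section \<open>Uniqueness, analyticity and the kernel at parameters with constant real part\<close>

context dunkl
begin

text \<open>Symmetrisation in i and j uses x_i/(x_i - x_j) + x_j/(x_j - x_i) = 1, which removes the
  singular denominators from the radial equation.\<close>

lemma sum_radial_symm:
  fixes x :: "real^'n::finite" and s :: "'n \<Rightarrow> 'n \<Rightarrow> complex"
  assumes reg: "\<And>i j. i \<noteq> j \<Longrightarrow> x $ i \<noteq> x $ j" and s: "\<And>i j. s i j = s j i" "\<And>i. s i i = 0"
  shows "(\<Sum>i\<in>UNIV. of_real (x $ i) * (\<Sum>j\<in>UNIV - {i}. s i j / of_real (x $ i - x $ j))) = (\<Sum>i\<in>UNIV. \<Sum>j\<in>UNIV. s i j) / 2"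
proof -
  let ?g = "\<lambda>i j. of_real (x $ i) * s i j / of_real (x $ i - x $ j)"
  have "(\<Sum>i\<in>UNIV. of_real (x $ i) * (\<Sum>j\<in>UNIV - {i}. s i j / of_real (x $ i - x $ j))) = (\<Sum>i\<in>UNIV. \<Sum>j\<in>UNIV. ?g i j)" (is "?l = _")
  proof (rule sum.cong[OF refl])
    fix i
    have "(\<Sum>j\<in>UNIV. ?g i j) = ?g i i + (\<Sum>j\<in>UNIV - {i}. ?g i j)" by (rule sum.remove) auto
    thus "of_real (x $ i) * (\<Sum>j\<in>UNIV - {i}. s i j / of_real (x $ i - x $ j)) = (\<Sum>j\<in>UNIV. ?g i j)"
      by (simp add: s sum_distrib_left)
  qed
  moreover have "(\<Sum>i\<in>UNIV. \<Sum>j\<in>UNIV. ?g i j) = (\<Sum>i\<in>UNIV. \<Sum>j\<in>UNIV. ?g j i)" by (rule sum.swap)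
  ultimately have "2 * ?l = (\<Sum>i\<in>UNIV. \<Sum>j\<in>UNIV. ?g i j + ?g j i)" by (simp add: sum.distrib)
  also have "\<dots> = (\<Sum>i\<in>UNIV. \<Sum>j\<in>UNIV. s i j)"
  proof (intro sum.cong refl)
    fix i j
    show "?g i j + ?g j i = s i j"
    proof (cases "i = j")
      case False
      hence d: "complex_of_real (x $ i - x $ j) \<noteq> 0" using reg[of i j] by simp
      have "?g j i = - (of_real (x $ j) * s i j / of_real (x $ i - x $ j))"
        using s(1)[of j i] by (metis minus_diff_eq of_real_minus divide_minus_right)
      hence "?g i j + ?g j i = (of_real (x $ i) * s i j - of_real (x $ j) * s i j) / of_real (x $ i - x $ j)"
        by (simp only: diff_divide_distrib add_uminus_conv_diff)
      also have "of_real (x $ i) * s i j - of_real (x $ j) * s i j = of_real (x $ i - x $ j) * s i j"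
        by (simp add: left_diff_distrib)
      finally show ?thesis using d by simp
    qed (simp add: s)
  qed
  finally have "2 * ?l = (\<Sum>i\<in>UNIV. \<Sum>j\<in>UNIV. s i j)" .
  moreover have "2 * a = b \<Longrightarrow> a = b / 2" for a b :: complex by auto
  ultimately show ?thesis by blast
qed

text \<open>The difference g of two solutions satisfies along rays the system of
  \<open>orbit_gronwall\<close> and vanishes at 0. Analyticity enters through differentiability,
  which combines the partial derivatives into the radial one.\<close>

lemma dunkl_eigen_unique:
  fixes f1 f2 :: "real^'n::finite \<Rightarrow> complex"
  assumes an: "real_analytic_Rn f1" "real_analytic_Rn f2" and ei: "dunkl_eigen k y f1" "dunkl_eigen k y f2"
    and eq0: "f1 0 = f2 0"
  shows "f1 = f2"
proof
  fix x
  define g where "g x = f1 x - f2 x" for x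
  have diff: "g differentiable (at a)" for a
    unfolding g_def using an by (intro differentiable_diff real_analytic_imp_differentiable)
  have cont: "continuous_on UNIV f1" "continuous_on UNIV f2"
    using an by (auto intro!: differentiable_imp_continuous_on differentiable_at_imp_differentiable_on real_analytic_imp_differentiable)
  have gcont: "continuous_on A g" for A
    using continuous_on_subset[OF cont(1)] continuous_on_subset[OF cont(2)] unfolding g_def by (intro continuous_intros) auto
  have ei_g: "((\<lambda>t. g (x + t *\<^sub>R axis i 1)) has_vector_derivative (y $ i * g x - of_real k * (\<Sum>j\<in>UNIV-{i}. (g x - g (swapv i j x)) / of_real (x $ i - x $ j)))) (at 0)"
    if "\<And>j. j \<noteq> i \<Longrightarrow> x $ i \<noteq> x $ j" for x i
  proof -
    from ei(1) that obtain D1 where D1: "((\<lambda>t. f1 (x + t *\<^sub>R axis i 1)) has_vector_derivative D1) (at 0)"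
       "D1 + complex_of_real k * (\<Sum>j\<in>UNIV - {i}. (f1 x - f1 (swapv i j x)) / complex_of_real (x $ i - x $ j)) = y $ i * f1 x"
      unfolding dunkl_eigen_def by blast
    from ei(2) that obtain D2 where D2: "((\<lambda>t. f2 (x + t *\<^sub>R axis i 1)) has_vector_derivative D2) (at 0)"
       "D2 + complex_of_real k * (\<Sum>j\<in>UNIV - {i}. (f2 x - f2 (swapv i j x)) / complex_of_real (x $ i - x $ j)) = y $ i * f2 x"
      unfolding dunkl_eigen_def by blast
    define S1 where "S1 = (\<Sum>j\<in>UNIV - {i}. (f1 x - f1 (swapv i j x)) / complex_of_real (x $ i - x $ j))"
    define S2 where "S2 = (\<Sum>j\<in>UNIV - {i}. (f2 x - f2 (swapv i j x)) / complex_of_real (x $ i - x $ j))"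
    have S: "(\<Sum>j\<in>UNIV-{i}. (g x - g (swapv i j x)) / of_real (x $ i - x $ j)) = S1 - S2"
      unfolding S1_def S2_def sum_subtractf[symmetric] g_def by (intro sum.cong refl) (simp add: diff_divide_distrib[symmetric])
    have "y $ i * g x - of_real k * (S1 - S2) = D1 - D2"
    proof -
      have d1: "D1 = y $ i * f1 x - of_real k * S1" using D1(2)[folded S1_def] by (metis add_diff_cancel_right')
      have d2: "D2 = y $ i * f2 x - of_real k * S2" using D2(2)[folded S2_def] by (metis add_diff_cancel_right')
      show ?thesis unfolding d1 d2 g_def by (simp add: algebra_simps)
    qed
    thus ?thesis using has_vector_derivative_diff[OF D1(1) D2(1)] unfolding S by (simp add: g_def)
  qed
  have radial: "\<exists>D. ((\<lambda>t. g (t *\<^sub>R x)) has_vector_derivative D) (at t) \<and>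
    of_real t * D = of_real t * (\<Sum>i\<in>UNIV. of_real (x $ i) * y $ i) * g (t *\<^sub>R x)
      - of_real (k / 2) * (\<Sum>a\<in>UNIV. \<Sum>b\<in>UNIV. g (t *\<^sub>R x) - g (t *\<^sub>R swapv a b x))"
    if reg: "\<And>i j. i \<noteq> j \<Longrightarrow> x $ i \<noteq> x $ j" and t: "t > 0" for x :: "real^'n" and t
  proof -
    obtain g' where g': "(g has_derivative g') (at (t *\<^sub>R x))" using diff by (auto simp: differentiable_def)
    interpret g': bounded_linear g' using g' by (rule has_derivative_bounded_linear)
    let ?z = "t *\<^sub>R x"
    have pdg: "g' (axis i 1) = y $ i * g ?z - of_real k * (\<Sum>j\<in>UNIV-{i}. (g ?z - g (swapv i j ?z)) / of_real (?z $ i - ?z $ j))" for i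
    proof -
      have l: "((\<lambda>s. ?z + s *\<^sub>R axis i (1::real)) has_derivative (\<lambda>s. s *\<^sub>R axis i 1)) (at 0)"
        by (auto intro!: derivative_eq_intros)
      from g' have "(g has_derivative g') (at (?z + 0 *\<^sub>R axis i 1))" by simp
      from diff_chain_at[OF l this] have "((\<lambda>s. g (?z + s *\<^sub>R axis i 1)) has_vector_derivative g' (axis i 1)) (at 0)"
        by (simp add: has_vector_derivative_def o_def g'.scaleR)
      moreover have "?z $ i \<noteq> ?z $ j" if "j \<noteq> i" for j using reg[of i j] that t by simp
      ultimately show ?thesis using ei_g[of i ?z] vector_derivative_unique_at by blast
    qed
    have x_sum: "x = (\<Sum>i\<in>UNIV. (x $ i) *\<^sub>R axis i 1)"
      by (simp add: vec_eq_iff axis_def if_distrib cong: if_cong)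
    have "g' x = (\<Sum>i\<in>UNIV. of_real (x $ i) * g' (axis i 1))"
      by (subst x_sum) (simp add: g'.sum g'.scaleR, simp add: scaleR_conv_of_real)
    also have "\<dots> = (\<Sum>i\<in>UNIV. of_real (x $ i) * y $ i) * g ?z - of_real k * (\<Sum>i\<in>UNIV. of_real (x $ i) * (\<Sum>j\<in>UNIV-{i}. (g ?z - g (swapv i j ?z)) / of_real (?z $ i - ?z $ j)))"
      unfolding pdg by (simp add: right_diff_distrib sum_subtractf sum_distrib_left sum_distrib_right mult_ac)
    finally have "of_real t * g' x = of_real t * (\<Sum>i\<in>UNIV. of_real (x $ i) * y $ i) * g ?z - of_real k * (\<Sum>i\<in>UNIV. of_real (?z $ i) * (\<Sum>j\<in>UNIV-{i}. (g ?z - g (swapv i j ?z)) / of_real (?z $ i - ?z $ j)))"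
      by (simp add: right_diff_distrib sum_distrib_left mult_ac)
    also have "(\<Sum>i\<in>UNIV. of_real (?z $ i) * (\<Sum>j\<in>UNIV-{i}. (g ?z - g (swapv i j ?z)) / of_real (?z $ i - ?z $ j))) = (\<Sum>i\<in>UNIV. \<Sum>j\<in>UNIV. g ?z - g (swapv i j ?z)) / 2"
      by (rule sum_radial_symm) (use reg t in \<open>auto simp: swapv_commute\<close>)
    finally have e: "of_real t * g' x = of_real t * (\<Sum>i\<in>UNIV. of_real (x $ i) * y $ i) * g ?z - of_real (k / 2) * (\<Sum>a\<in>UNIV. \<Sum>b\<in>UNIV. g ?z - g (t *\<^sub>R swapv a b x))"
      by (simp add: swapv_scaleR)
    have "((\<lambda>s. s *\<^sub>R x) has_derivative (\<lambda>s. s *\<^sub>R x)) (at t)" by (auto intro!: derivative_eq_intros)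
    from diff_chain_at[OF this g'] have "((\<lambda>t. g (t *\<^sub>R x)) has_vector_derivative g' x) (at t)"
      by (simp add: has_vector_derivative_def o_def g'.scaleR)
    with e show ?thesis by blast
  qed
  show "f1 x = f2 x"
  proof (rule continuous_eq_regular[OF cont])
    fix x :: "real^'n" assume reg: "\<And>i j. i \<noteq> j \<Longrightarrow> x $ i \<noteq> x $ j"
    \<comment> \<open>Bijections only: the eigenvalue equations are given at points with distinct
      coordinates, and \<open>pm w x\<close> is such a point only if \<open>w\<close> is injective.
      Any growth constant will do in the estimate below, since the initial values vanish.\<close>
    let ?W = "{w :: 'n \<Rightarrow> 'n. bij w}"
    define \<beta> where "\<beta> w = (\<Sum>i\<in>UNIV. of_real (pm w x $ i) * y $ i)" for w
    have "(\<Sum>w\<in>?W. (norm (g (1 *\<^sub>R pm w x)))\<^sup>2) \<le> exp (2 * (\<Sum>w\<in>?W. \<bar>Re (\<beta> w)\<bar>)) * (\<Sum>w\<in>?W. (norm (g (0 *\<^sub>R pm w x)))\<^sup>2)"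
    proof (rule orbit_gronwall[where \<phi> = "\<lambda>a b w. w \<circ> tr a b" and \<beta> = \<beta> and c = "k / 2"
         and h = "\<lambda>w t. g (t *\<^sub>R pm w x)" and W = ?W])
      fix a b
      show "bij_betw (\<lambda>w. w \<circ> tr a b) ?W ?W"
        by (rule bij_betw_byWitness[where f' = "\<lambda>w. w \<circ> tr a b"]) (auto intro: bij_comp bij_tr)
    next
      fix w :: "'n \<Rightarrow> 'n" assume w: "w \<in> ?W"
      show "continuous_on {0..1} (\<lambda>t. g (t *\<^sub>R pm w x))"
        by (rule continuous_on_compose2[OF gcont[of UNIV]]) (auto intro!: continuous_intros)
      show "Re (\<beta> w) \<le> (\<Sum>w\<in>?W. \<bar>Re (\<beta> w)\<bar>)"
        using member_le_sum[of w ?W "\<lambda>w. \<bar>Re (\<beta> w)\<bar>"] w by simp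
      fix t :: real assume t: "0 < t" "t < 1"
      have p: "pm (w \<circ> tr a b) x = swapv a b (pm w x)" for a b by (simp add: swapv_eq_pm pm_pm)
      show "\<exists>D. ((\<lambda>t. g (t *\<^sub>R pm w x)) has_vector_derivative D) (at t) \<and>
          of_real t * D = of_real t * \<beta> w * g (t *\<^sub>R pm w x)
           - of_real (k / 2) * (\<Sum>a\<in>UNIV. \<Sum>b\<in>UNIV. g (t *\<^sub>R pm w x) - g (t *\<^sub>R pm (w \<circ> tr a b) x))"
        unfolding p \<beta>_def by (rule radial) (use t w reg in \<open>auto simp: bij_def inj_eq\<close>)
    qed (use k_nonneg in auto)
    moreover have "g 0 = 0" using eq0 by (simp add: g_def)
    ultimately have "(\<Sum>w\<in>?W. (norm (g (pm w x)))\<^sup>2) \<le> 0" by simp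
    moreover have "(norm (g (pm id x)))\<^sup>2 \<le> (\<Sum>w\<in>?W. (norm (g (pm w x)))\<^sup>2)"
      by (rule member_le_sum[of id ?W "\<lambda>w. (norm (g (pm w x)))\<^sup>2"]) auto
    ultimately have "(norm (g (pm id x)))\<^sup>2 \<le> 0" by linarith
    thus "f1 x = f2 x" by (simp add: g_def)
  qed
qed

text \<open>The maps that are not bijective form a set stable under composition with transpositions
  and missing \<open>id\<close>, so the weights restricted to it solve the homogeneous system. This
  is needed because expansions can be transported along \<open>pm w\<close> for bijective
  \<open>w\<close>.\<close>

lemma rweight_not_bij:
  assumes "m > 0" "\<not> bij w"
  shows "rweight k m w = 0"
proof -
  note r = rweight_resolvent[OF assms(1), where ?'n = 'a, unfolded resolvent_weights_def]
  have bij_iff: "bij (tr a b \<circ> w) \<longleftrightarrow> bij w" for a b and w :: "'a \<Rightarrow> 'a"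
    by (metis bij_comp bij_tr tr_o_tr(2))
  define u where "u w = (if bij w then 0 else rweight k m w)" for w :: "'a \<Rightarrow> 'a"
  have "u w = 0"
  proof (rule zero_principle[where m = "real m" and c = "k / 2" and u = u and \<phi> = "\<lambda>a b w. tr a b \<circ> w" and x = w])
    fix w :: "'a \<Rightarrow> 'a"
    show "real m * u w + k / 2 * (\<Sum>a\<in>UNIV. \<Sum>b\<in>UNIV. u w - u (tr a b \<circ> w)) = 0"
    proof (cases "bij w")
      case False
      hence "w \<noteq> id" by auto
      thus ?thesis using False r by (simp add: u_def bij_iff)
    qed (simp add: u_def bij_iff)
  qed (use assms k_nonneg in auto)
  thus ?thesis using assms by (simp add: u_def)
qed

lemma majorized_inner:
  assumes "majorized A M f" "A \<ge> 0"
  shows "majorized A ((A + 1) * (\<Sum>i\<in>UNIV. \<bar>y $ i\<bar>) * M) (\<lambda>x. of_real (x \<bullet> y) * f x)"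
proof -
  have "majorized A (\<Sum>i\<in>UNIV. norm (complex_of_real (y $ i)) * ((A + 1) * M)) (\<lambda>x. \<Sum>i\<in>UNIV. of_real (y $ i) * (of_real (x $ i) * f x))"
    by (intro majorized_sum majorized_cmult majorized_coord assms) simp
  thus ?thesis by (simp add: inner_vec_def sum_distrib_left sum_distrib_right mult_ac)
qed

text \<open>The induction of \<open>e_bound\<close>, with the l1 norm of the coefficients in place
  of the absolute value.\<close>

lemma majorized_e:
  assumes A: "A \<ge> 0"
  shows "majorized A (((A + 1) * (\<Sum>i\<in>UNIV. \<bar>y $ i\<bar>)) ^ m / fact m) (\<lambda>x. of_real (e m x (y :: real^'n::finite)))"
proof (induction m)
  case 0 thus ?case using majorized_const[of A 1] by simp
next
  case (Suc m)
  define M where "M = ((A + 1) * (\<Sum>i\<in>UNIV. \<bar>y $ i\<bar>)) ^ m / fact m"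
  define M' where "M' = (A + 1) * (\<Sum>i\<in>UNIV. \<bar>y $ i\<bar>) * M"
  have M'0: "M' \<ge> 0" unfolding M'_def M_def using A by (auto intro!: mult_nonneg_nonneg sum_nonneg)
  note r = rweight_resolvent[of "Suc m", where ?'n = 'n, unfolded resolvent_weights_def]
  have 1: "majorized A M' (\<lambda>x. of_real (x \<bullet> y) * of_real (e m x y))"
    unfolding M'_def M_def by (rule majorized_inner[OF Suc A])
  have "majorized A (\<Sum>w\<in>(UNIV::('n\<Rightarrow>'n) set). rweight k (Suc m) w * M') (\<lambda>x. \<Sum>w\<in>UNIV. of_real (rweight k (Suc m) w) * (of_real (pm w x \<bullet> y) * of_real (e m (pm w x) y)))"
  proof (rule majorized_sum)
    fix w :: "'n \<Rightarrow> 'n"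
    show "majorized A (rweight k (Suc m) w * M') (\<lambda>x. of_real (rweight k (Suc m) w) * (of_real (pm w x \<bullet> y) * of_real (e m (pm w x) y)))"
    proof (cases "bij w")
      case True
      from majorized_cmult[OF majorized_pm[OF 1 True], of "of_real (rweight k (Suc m) w)"] r show ?thesis by simp
    next
      case False
      thus ?thesis using majorized_const[of A 0] by (simp add: rweight_not_bij)
    qed
  qed simp
  also have "(\<Sum>w\<in>(UNIV::('n\<Rightarrow>'n) set). rweight k (Suc m) w * M') = ((A + 1) * (\<Sum>i\<in>UNIV. \<bar>y $ i\<bar>)) ^ Suc m / fact (Suc m)"
    proof -
    have s1: "(\<Sum>w\<in>(UNIV::('n\<Rightarrow>'n) set). rweight k (Suc m) w) = 1 / real (Suc m)" using r by simp
    show ?thesis unfolding sum_distrib_right[symmetric] s1 M'_def M_def by (simp add: field_simps)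
  qed
  finally show ?case by (simp add: dunkl_e.simps(2) mult.assoc)
qed

lemma majorized_K:
  assumes A: "A \<ge> 0"
  shows "\<exists>M. majorized A M (\<lambda>x. K x (y :: real^'n::finite))"
proof -
  let ?M = "\<lambda>m. ((A + 1) * (\<Sum>i\<in>UNIV. \<bar>y $ i\<bar>)) ^ m / fact m"
  have "majorized A (\<Sum>m. ?M m) (\<lambda>x. K x y)"
  proof (rule majorized_series)
    show "majorized A (?M m) (\<lambda>x. \<i> ^ m * of_real (e m x y))" for m
      using majorized_cmult[OF majorized_e[OF A, of y m], of "\<i> ^ m"] by (simp add: norm_power)
  qed (use A in \<open>auto intro!: summable_pow_fact K_sums divide_nonneg_nonneg zero_le_power mult_nonneg_nonneg sum_nonneg\<close>)
  thus ?thesis ..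
qed

text \<open>The exponential series is summed by \<open>majorized_series\<close>; each factor
  \<langle>x, v\<rangle> costs the constant \<open>B\<close>.\<close>

lemma majorized_exp_mult:
  assumes f: "majorized A M f" and A: "A \<ge> 0"
  shows "\<exists>M. majorized A M (\<lambda>x. exp (of_real (x \<bullet> v)) * f x)"
proof -
  define B where "B = (A + 1) * (\<Sum>i\<in>UNIV. \<bar>v $ i\<bar>)"
  have B0: "B \<ge> 0" unfolding B_def using A by (auto intro!: mult_nonneg_nonneg sum_nonneg)
  have M0: "M \<ge> 0" using majorized_nonneg[OF f A] .
  have pw: "majorized A (B ^ m * M) (\<lambda>x. of_real (x \<bullet> v) ^ m * f x)" for m
  proof (induction m)
    case (Suc m)
    from majorized_inner[OF Suc A, of v] show ?case by (simp add: B_def mult_ac)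
  qed (use f in simp)
  have "majorized A (\<Sum>m. B ^ m / fact m * M) (\<lambda>x. exp (of_real (x \<bullet> v)) * f x)"
  proof (rule majorized_series)
    show "majorized A (B ^ m / fact m * M) (\<lambda>x. of_real (1 / fact m) * (of_real (x \<bullet> v) ^ m * f x))" for m
      using majorized_cmult[OF pw[of m], of "of_real (1 / fact m)"] by (simp add: norm_divide)
    show "(\<lambda>m. of_real (1 / fact m) * (of_real (x \<bullet> v) ^ m * f x)) sums (exp (of_real (x \<bullet> v)) * f x)" for x
      using sums_mult2[OF exp_converges[of "complex_of_real (x \<bullet> v)"], of "f x"] by (simp add: scaleR_conv_of_real field_simps)
      show "summable (\<lambda>m. B ^ m / fact m * M)" by (intro summable_mult2 summable_pow_fact)
  qed (use B0 M0 in auto)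
  thus ?thesis ..
qed

text \<open>The factor exp(s \<Sum> x_j) is symmetric: it passes through the difference quotients
  unchanged, and its logarithmic derivative s in every direction shifts the eigenvalue i y_j to s +
  i y_j.\<close>

lemma dunklA_line: "dunklA k x (line_pt s y) = exp (of_real (s * (\<Sum>i\<in>UNIV. x $ i))) * K x (y :: real^'n::finite)"
proof -
  define f where "f x = exp (complex_of_real (s * (\<Sum>i\<in>UNIV. x $ i))) * K x y" for x
  have an: "real_analytic_Rn f"
  proof (rule majorized_imp_analytic)
    fix A
    obtain M where "majorized \<bar>A\<bar> M (\<lambda>x. K x y)" using majorized_K[of "\<bar>A\<bar>" y] by auto
    from majorized_exp_mult[OF this, of "\<chi> i. s"]
    obtain M' where "majorized \<bar>A\<bar> M' f" by (auto simp: f_def[abs_def] inner_vec_def sum_distrib_left mult.commute)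
    hence "majorized A M' f" unfolding majorized_def by (meson abs_ge_self order_trans)
    thus "\<exists>M. majorized A M f" ..
  qed
  have ei: "dunkl_eigen k (line_pt s y) f"
    unfolding dunkl_eigen_def
  proof (intro allI impI)
    fix i and x :: "real^'n" assume reg: "\<forall>j. j \<noteq> i \<longrightarrow> x $ i \<noteq> x $ j"
    define X where "X = exp (complex_of_real (s * (\<Sum>i\<in>UNIV. x $ i)))"
    define D where "D = \<i> * of_real (y $ i) * K x y - of_real k * (\<Sum>j\<in>UNIV - {i}. (K x y - K (swapv i j x) y) / of_real (x $ i - x $ j))"
    have D: "((\<lambda>t. K (x + t *\<^sub>R axis i 1) y) has_vector_derivative D) (at 0)"
      unfolding D_def by (rule K_has_pd) (use reg in auto)
    have sm: "(\<Sum>l\<in>UNIV. (x + t *\<^sub>R axis i 1) $ l) = (\<Sum>l\<in>UNIV. x $ l) + t" for t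
    proof -
      have "(x + t *\<^sub>R axis i 1) $ l = x $ l + (if l = i then t else 0)" for l by (simp add: axis_def)
      thus ?thesis by (simp add: sum.distrib)
    qed
    have "((\<lambda>z. exp (of_real s * (of_real (\<Sum>l\<in>UNIV. x $ l) + z))) has_field_derivative of_real s * X) (at (of_real 0))"
      unfolding X_def by (auto intro!: derivative_eq_intros)
    hence "((\<lambda>t. exp (of_real s * (of_real (\<Sum>l\<in>UNIV. x $ l) + of_real t))) has_vector_derivative of_real s * X) (at 0)"
      by (rule has_vector_derivative_real_field)
    hence "((\<lambda>t. exp (complex_of_real (s * (\<Sum>l\<in>UNIV. (x + t *\<^sub>R axis i 1) $ l)))) has_vector_derivative of_real s * X) (at 0)"
      unfolding sm by simp
    from has_vector_derivative_mult[OF this D]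
    have "((\<lambda>t. f (x + t *\<^sub>R axis i 1)) has_vector_derivative (X * D + of_real s * X * K x y)) (at 0)"
      by (simp add: f_def X_def)
    moreover have "X * D + of_real s * X * K x y + of_real k * (\<Sum>j\<in>UNIV - {i}. (f x - f (swapv i j x)) / of_real (x $ i - x $ j)) = line_pt s y $ i * f x"
    proof -
      have "f (swapv i j x) = X * K (swapv i j x) y" for j
        unfolding f_def X_def using sum_swapv[of "\<lambda>r. r" i j x] by simp
      hence "(\<Sum>j\<in>UNIV - {i}. (f x - f (swapv i j x)) / complex_of_real (x $ i - x $ j)) = X * (\<Sum>j\<in>UNIV - {i}. (K x y - K (swapv i j x) y) / of_real (x $ i - x $ j))"
        unfolding sum_distrib_left by (intro sum.cong refl) (simp add: f_def X_def right_diff_distrib)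
      moreover have "line_pt s y $ i = of_real s + \<i> * of_real (y $ i)" by (simp add: line_pt_def complex_eq_iff)
      ultimately show ?thesis unfolding D_def by (simp add: f_def X_def algebra_simps)
    qed
    ultimately show "\<exists>D. ((\<lambda>t. f (x + t *\<^sub>R axis i 1)) has_vector_derivative D) (at 0) \<and>
           D + complex_of_real k * (\<Sum>j\<in>UNIV - {i}. (f x - f (swapv i j x)) / complex_of_real (x $ i - x $ j)) = line_pt s y $ i * f x"
      by blast
  qed
  have f0: "f 0 = 1" by (simp add: f_def)
  have "(THE f. real_analytic_Rn f \<and> dunkl_eigen k (line_pt s y) f \<and> f 0 = 1) = f"
    by (rule the_equality) (use an ei f0 dunkl_eigen_unique in metis)+
  thus ?thesis by (simp add: dunklA_def f_def)
qed

end

section \<open>Gaussian integrals\<close>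

text \<open>Lebesgue measure on vectors is the image of a product measure indexed by
  \<open>Basis\<close>; the axes identify this index set with the coordinates.\<close>

lemma product_integral_vec:
  fixes g :: "'n::finite \<Rightarrow> real \<Rightarrow> 'a::{real_normed_field,banach,second_countable_topology}"
  assumes g: "\<And>i. integrable lborel (g i)"
  shows "integrable lborel (\<lambda>x :: real^'n. \<Prod>i\<in>UNIV. g i (x $ i))"
    and "integral\<^sup>L lborel (\<lambda>x :: real^'n. \<Prod>i\<in>UNIV. g i (x $ i)) = (\<Prod>i\<in>UNIV. integral\<^sup>L lborel (g i))"
proof -
  interpret P: product_sigma_finite "\<lambda>_::real^'n. lborel :: real measure" by standard
  define ax where "ax i = (axis i 1 :: real^'n)" for i
  define ix where "ix b = inv ax b" for b
  have inj: "inj ax" by (rule injI) (simp add: ax_def axis_eq_axis)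
  have Bas: "Basis = range ax" by (auto simp: Basis_vec_def ax_def)
  have ix: "ix (ax i) = i" for i unfolding ix_def using inj by simp
  have reindex: "(\<Prod>b\<in>Basis. h (ix b) b) = (\<Prod>i\<in>UNIV. h i (ax i))" for h :: "'n \<Rightarrow> real^'n \<Rightarrow> 'a"
    unfolding Bas by (simp add: prod.reindex[OF inj] ix)
  have nth: "(\<Sum>b\<in>Basis. f b *\<^sub>R b) $ i = f (ax i)" for f :: "real^'n \<Rightarrow> real" and i
    unfolding Bas by (simp add: sum.reindex[OF inj]) (simp add: ax_def axis_def if_distrib cong: if_cong)
  have meas: "(\<lambda>x :: real^'n. \<Prod>i\<in>UNIV. g i (x $ i)) \<in> borel_measurable borel"
  proof (rule borel_measurable_prod)
    fix i
    have "g i \<in> borel_measurable borel" using g[of i] by auto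
    moreover have "(\<lambda>x :: real^'n. x $ i) \<in> borel_measurable borel"
      by (intro borel_measurable_continuous_onI continuous_intros)
    ultimately show "(\<lambda>x :: real^'n. g i (x $ i)) \<in> borel_measurable borel" by measurable
  qed
  have m2: "(\<lambda>f. \<Sum>b\<in>Basis. f b *\<^sub>R b) \<in> measurable (\<Pi>\<^sub>M b\<in>(Basis :: (real^'n) set). lborel) (borel :: (real^'n) measure)"
    by measurable
  have eq: "(\<Prod>i\<in>UNIV. g i ((\<Sum>b\<in>Basis. f b *\<^sub>R b) $ i)) = (\<Prod>b\<in>Basis. g (ix b) (f b))" for f :: "real^'n \<Rightarrow> real"
    unfolding nth reindex[of "\<lambda>i b. g i (f b)"] ..
  have 1: "integrable (\<Pi>\<^sub>M b\<in>(Basis :: (real^'n) set). lborel) (\<lambda>f. \<Prod>b\<in>Basis. g (ix b) (f b))"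
    by (rule P.product_integrable_prod) (auto intro: g)
  thus "integrable lborel (\<lambda>x :: real^'n. \<Prod>i\<in>UNIV. g i (x $ i))"
    by (subst lborel_eq, subst integrable_distr_eq[OF m2 meas]) (simp only: eq)
  have "integral\<^sup>L lborel (\<lambda>x :: real^'n. \<Prod>i\<in>UNIV. g i (x $ i)) =
     integral\<^sup>L (\<Pi>\<^sub>M b\<in>(Basis :: (real^'n) set). lborel) (\<lambda>f. \<Prod>b\<in>Basis. g (ix b) (f b))"
    by (subst lborel_eq, subst integral_distr[OF m2 meas]) (simp only: eq)
  also have "\<dots> = (\<Prod>b\<in>Basis. integral\<^sup>L lborel (g (ix b)))"
    by (rule P.product_integral_prod) (auto intro: g)
  also have "\<dots> = (\<Prod>i\<in>UNIV. integral\<^sup>L lborel (g i))"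
    by (rule reindex[of "\<lambda>i b. integral\<^sup>L lborel (g i)"])
  finally show "integral\<^sup>L lborel (\<lambda>x :: real^'n. \<Prod>i\<in>UNIV. g i (x $ i)) = (\<Prod>i\<in>UNIV. integral\<^sup>L lborel (g i))" .
qed

section \<open>Functions of exponential growth and Gaussian integrability\<close>

definition l1norm :: "real^'n::finite \<Rightarrow> real" where
  "l1norm x = (\<Sum>i\<in>UNIV. \<bar>x $ i\<bar>)"

lemma l1norm_nonneg [simp]: "l1norm x \<ge> 0"
  by (simp add: l1norm_def sum_nonneg)

lemma nth_le_l1norm: "\<bar>x $ i\<bar> \<le> l1norm x"
  unfolding l1norm_def by (rule member_le_sum) auto

lemma continuous_on_l1norm: "continuous_on A l1norm"
  unfolding l1norm_def by (intro continuous_intros)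

lemma measurable_l1norm [measurable]: "l1norm \<in> borel_measurable borel"
  by (intro borel_measurable_continuous_onI continuous_on_l1norm)

text \<open>With the l1 norm, exp(b \<open>l1norm x\<close>) is a product over the coordinates,
  which reduces integrability against the Gaussian to one dimension. The class is closed under
  products and contains the polynomials, the weight and its regularisations.\<close>

definition expbdd :: "(real^'n::finite \<Rightarrow> 'a::real_normed_vector) \<Rightarrow> bool" where
  "expbdd f \<longleftrightarrow> (\<exists>C b. C \<ge> 0 \<and> b \<ge> 0 \<and> (\<forall>x. norm (f x) \<le> C * exp (b * l1norm x)))"

lemma expbddI: "C \<ge> 0 \<Longrightarrow> b \<ge> 0 \<Longrightarrow> (\<And>x. norm (f x) \<le> C * exp (b * l1norm x)) \<Longrightarrow> expbdd f"
  by (auto simp: expbdd_def)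

lemma expbdd_bounded: "(\<And>x. norm (f x) \<le> C) \<Longrightarrow> expbdd f"
  by (rule expbddI[of C 0]) (auto intro: order_trans[OF norm_ge_zero])

lemma expbdd_mono: "expbdd g \<Longrightarrow> (\<And>x. norm (f x) \<le> norm (g x)) \<Longrightarrow> expbdd f"
  unfolding expbdd_def by (meson order_trans)

lemma expbdd_norm: "expbdd f \<Longrightarrow> expbdd (\<lambda>x. norm (f x))"
  by (simp add: expbdd_def)

lemma expbdd_of_real: "expbdd (f :: real^'n::finite \<Rightarrow> real) \<Longrightarrow> expbdd (\<lambda>x. complex_of_real (f x))"
  by (simp add: expbdd_def)

lemma expbdd_add:
  assumes "expbdd f" "expbdd g" shows "expbdd (\<lambda>x. f x + g x)"
proof -
  obtain C b where f: "C \<ge> 0" "b \<ge> 0" "\<And>x. norm (f x) \<le> C * exp (b * l1norm x)" using assms(1) unfolding expbdd_def by auto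
  obtain C' b' where g: "C' \<ge> 0" "b' \<ge> 0" "\<And>x. norm (g x) \<le> C' * exp (b' * l1norm x)" using assms(2) unfolding expbdd_def by auto
  show ?thesis
  proof (rule expbddI[of "C + C'" "b + b'"])
    fix x
    have "norm (f x) \<le> C * exp ((b + b') * l1norm x)"
      by (rule order_trans[OF f(3)]) (use f g in \<open>auto intro!: mult_left_mono mult_right_mono\<close>)
    moreover have "norm (g x) \<le> C' * exp ((b + b') * l1norm x)"
      by (rule order_trans[OF g(3)]) (use f g in \<open>auto intro!: mult_left_mono mult_right_mono\<close>)
    ultimately show "norm (f x + g x) \<le> (C + C') * exp ((b + b') * l1norm x)"
      using norm_triangle_ineq[of "f x" "g x"] by (simp add: distrib_right)
  qed (use f g in auto)
qed

lemma expbdd_mult: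
  fixes f g :: "real^'n::finite \<Rightarrow> 'a::real_normed_algebra"
  assumes "expbdd f" "expbdd g" shows "expbdd (\<lambda>x. f x * g x)"
proof -
  obtain C b where f: "C \<ge> 0" "b \<ge> 0" "\<And>x. norm (f x) \<le> C * exp (b * l1norm x)" using assms(1) unfolding expbdd_def by auto
  obtain C' b' where g: "C' \<ge> 0" "b' \<ge> 0" "\<And>x. norm (g x) \<le> C' * exp (b' * l1norm x)" using assms(2) unfolding expbdd_def by auto
  show ?thesis
  proof (rule expbddI[of "C * C'" "b + b'"])
    fix x
    have "norm (f x * g x) \<le> norm (f x) * norm (g x)" by (rule norm_mult_ineq)
    also have "\<dots> \<le> (C * exp (b * l1norm x)) * (C' * exp (b' * l1norm x))"
      using f g by (intro mult_mono) auto
    finally show "norm (f x * g x) \<le> (C * C') * exp ((b + b') * l1norm x)"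
      by (simp add: exp_add algebra_simps)
  qed (use f g in auto)
qed

lemma expbdd_sum: "finite I \<Longrightarrow> (\<And>i. i \<in> I \<Longrightarrow> expbdd (f i)) \<Longrightarrow> expbdd (\<lambda>x. \<Sum>i\<in>I. f i x)"
  by (induction I rule: finite_induct) (auto intro: expbdd_add expbdd_bounded[of _ 0])

lemma expbdd_nth: "expbdd (\<lambda>x. complex_of_real (x $ i))"
proof (rule expbddI[of 1 1])
  fix x :: "real^'a"
  have "\<bar>x $ i\<bar> \<le> l1norm x" by (rule nth_le_l1norm)
  also have "l1norm x \<le> exp (l1norm x)" using exp_ge_add_one_self[of "l1norm x"] by linarith
  finally show "norm (complex_of_real (x $ i)) \<le> 1 * exp (1 * l1norm x)" by simp
qed auto

lemma cpoly_expbdd: "cpoly p \<Longrightarrow> expbdd p"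
  by (induction rule: cpoly.induct) (auto intro: expbdd_add expbdd_mult expbdd_nth expbdd_bounded)

definition gaussw :: "real^'n::finite \<Rightarrow> real" where
  "gaussw x = exp (- (norm x)\<^sup>2 / 2)"

lemma gaussw_pos [simp]: "gaussw x > 0" by (simp add: gaussw_def)

lemma continuous_on_gaussw [continuous_intros]: "continuous_on A gaussw"
  unfolding gaussw_def by (intro continuous_intros) auto

lemma measurable_gaussw [measurable]: "gaussw \<in> borel_measurable borel"
  by (intro borel_measurable_continuous_onI continuous_on_gaussw)

lemma norm2_vec: "(norm x)\<^sup>2 = (\<Sum>i\<in>UNIV. (x $ i)\<^sup>2)" for x :: "real^'n::finite"
  unfolding power2_norm_eq_inner inner_vec_def by (simp add: power2_eq_square)

lemma integrable_gauss_exp_1d: "integrable lborel (\<lambda>t::real. exp (b * \<bar>t\<bar> - t\<^sup>2 / 2))"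
proof (rule Bochner_Integration.integrable_bound)
  \<comment> \<open>Completing the square: exp(b t - t^2/2) is a multiple of the normal density
    centred at b. The absolute value is handled by using both centres b and -b.\<close>
  let ?f = "\<lambda>t::real. exp (b\<^sup>2/2) * sqrt (2 * pi) * (normal_density b 1 t + normal_density (-b) 1 t)"
  show "integrable lborel ?f"
    by (intro Bochner_Integration.integrable_mult_right Bochner_Integration.integrable_add) auto
  have eq: "exp (b\<^sup>2/2) * sqrt (2 * pi) * normal_density c 1 t = exp (c * t - t\<^sup>2/2)" if "c\<^sup>2 = b\<^sup>2" for c t
    using that by (simp add: normal_density_def exp_add[symmetric] power2_diff field_simps real_sqrt_mult)
  show "AE t in lborel. norm (exp (b * \<bar>t\<bar> - t\<^sup>2 / 2)) \<le> norm (?f t)"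
  proof (rule AE_I2)
    fix t :: real
    have "exp (b * \<bar>t\<bar> - t\<^sup>2 / 2) \<le> exp (b * t - t\<^sup>2/2) + exp ((-b) * t - t\<^sup>2/2)"
      by (cases "t \<ge> 0") auto
    also have "\<dots> = ?f t" unfolding distrib_left by (subst (1 2) eq) auto
    finally show "norm (exp (b * \<bar>t\<bar> - t\<^sup>2 / 2)) \<le> norm (?f t)" by simp
  qed
qed measurable

lemma integrable_gauss_exp: "integrable lborel (\<lambda>x :: real^'n::finite. gaussw x * exp (b * l1norm x))"
proof -
  have "gaussw x * exp (b * l1norm x) = (\<Prod>i\<in>UNIV. exp (b * \<bar>x $ i\<bar> - (x $ i)\<^sup>2 / 2))" for x :: "real^'n"
    unfolding gaussw_def l1norm_def norm2_vec exp_add[symmetric] exp_sum[OF finite, symmetric]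
    by (simp add: sum_subtractf sum_distrib_left sum_divide_distrib)
  thus ?thesis using product_integral_vec(1)[of "\<lambda>_ t. exp (b * \<bar>t\<bar> - t\<^sup>2 / 2)"] integrable_gauss_exp_1d by simp
qed

lemma integrable_gauss:
  fixes f :: "real^'n::finite \<Rightarrow> 'a::{banach,second_countable_topology}"
  assumes [measurable]: "f \<in> borel_measurable borel" and f: "expbdd f"
  shows "integrable lborel (\<lambda>x. gaussw x *\<^sub>R f x)"
proof -
  obtain C b where C: "C \<ge> 0" "\<And>x. norm (f x) \<le> C * exp (b * l1norm x)" using f unfolding expbdd_def by auto
  show ?thesis
  proof (rule Bochner_Integration.integrable_bound)
    show "integrable lborel (\<lambda>x :: real^'n. C * (gaussw x * exp (b * l1norm x)))"
      by (intro Bochner_Integration.integrable_mult_right integrable_gauss_exp)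
    show "AE x in lborel. norm (gaussw x *\<^sub>R f x) \<le> norm (C * (gaussw x * exp (b * l1norm x)))"
      using C by (intro AE_I2) (auto simp: mult.left_commute abs_mult less_imp_le intro!: mult_left_mono)
  qed measurable
qed

section \<open>Lebesgue integrals under coordinate swaps and differentiation\<close>

lemma distr_swapv: "distr lborel borel (swapv a b) = (lborel :: (real^'n::finite) measure)"
proof (rule lborel_eqI[symmetric])
  have cont: "continuous_on UNIV (swapv a b :: real^'n \<Rightarrow> real^'n)" unfolding swapv_def by (intro continuous_intros)
  hence [measurable]: "(swapv a b :: real^'n \<Rightarrow> real^'n) \<in> borel_measurable borel" by (rule borel_measurable_continuous_onI)
  fix l u :: "real^'n" assume le: "\<And>c. c \<in> Basis \<Longrightarrow> l \<bullet> c \<le> u \<bullet> c"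
  have le': "l $ i \<le> u $ i" for i using le[of "axis i 1"] by (simp add: inner_axis)
  have Bas: "(\<Prod>c\<in>Basis. x \<bullet> c) = (\<Prod>i\<in>UNIV. x $ i)" for x :: "real^'n"
  proof -
    have "(\<Prod>c\<in>Basis. x \<bullet> c) = (\<Prod>c\<in>range (\<lambda>i. axis i (1::real) :: real^'n). x \<bullet> c)"
      by (intro prod.cong) (auto simp: Basis_vec_def)
    also have "\<dots> = (\<Prod>i\<in>UNIV. x $ i)"
      by (subst prod.reindex) (auto simp: inner_axis axis_eq_axis intro!: injI)
    finally show ?thesis .
  qed
  have "swapv a b -` box l u = box (swapv a b l) (swapv a b u)"
  proof -
    have "(\<forall>i. l $ i < x $ tr a b i \<and> x $ tr a b i < u $ i) \<longleftrightarrow> (\<forall>i. l $ tr a b i < x $ i \<and> x $ i < u $ tr a b i)" for x :: "real^'n"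
      by (metis tr_tr)
    thus ?thesis by (auto simp: mem_box_cart)
  qed
  hence "emeasure (distr lborel borel (swapv a b)) (box l u) = emeasure lborel (box (swapv a b l) (swapv a b u))"
    by (simp add: emeasure_distr)
  also have "\<dots> = (\<Prod>c\<in>Basis. (swapv a b u - swapv a b l) \<bullet> c)"
  proof (rule emeasure_lborel_box)
    fix c :: "real^'n" assume "c \<in> Basis"
    then obtain i where "c = axis i 1" by (auto simp: Basis_vec_def)
    thus "swapv a b l \<bullet> c \<le> swapv a b u \<bullet> c" using le' by (simp add: inner_axis)
  qed
  also have "\<dots> = (\<Prod>c\<in>Basis. (u - l) \<bullet> c)"
    unfolding Bas using prod.reindex_bij_betw[OF bij_tr, of "\<lambda>i. u $ i - l $ i" a b] by simp
  finally show "emeasure (distr lborel borel (swapv a b)) (box l u) = (\<Prod>c\<in>Basis. (u - l) \<bullet> c)" .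
qed simp

lemma measurable_swapv [measurable]: "(swapv a b :: real^'n::finite \<Rightarrow> real^'n) \<in> borel_measurable borel"
  unfolding swapv_def by (intro borel_measurable_continuous_onI continuous_intros)

lemma integral_swapv:
  fixes f :: "real^'n::finite \<Rightarrow> 'a::{banach,second_countable_topology}"
  assumes [measurable]: "f \<in> borel_measurable borel"
  shows "integral\<^sup>L lborel (\<lambda>x. f (swapv a b x)) = integral\<^sup>L lborel f"
  by (subst (2) distr_swapv[symmetric, of a b], subst integral_distr) auto

lemma integral_odd_swapv:
  fixes f :: "real^'n::finite \<Rightarrow> complex"
  assumes "f \<in> borel_measurable borel" "\<And>x. f (swapv a b x) = - f x"
  shows "integral\<^sup>L lborel f = 0"
  using integral_swapv[OF assms(1), of a b] by (simp add: assms(2))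

text \<open>$\int \partial_j v = \int_0^1 \int \partial_j v(x + t e_j)\,dx\,dt = \int (v(x + e_j) - v(x))\,dx = 0$.\<close>

lemma integral_pd_zero:
  fixes v dv :: "real^'n::finite \<Rightarrow> complex"
  assumes dv_cont: "continuous_on UNIV dv"
    and der: "\<And>x. ((\<lambda>t. v (x + t *\<^sub>R axis j 1)) has_vector_derivative dv x) (at 0)"
    and v: "integrable lborel v" and dv: "integrable lborel dv"
  shows "integral\<^sup>L lborel dv = 0"
proof -
  let ?e = "axis j 1 :: real^'n"
  have shift: "integral\<^sup>L lborel (\<lambda>x. f (x + c)) = integral\<^sup>L lborel f" and shift_i: "integrable lborel f \<Longrightarrow> integrable lborel (\<lambda>x. f (x + c))"
    if [measurable]: "f \<in> borel_measurable borel" for f :: "real^'n \<Rightarrow> 'b::{banach,second_countable_topology}" and c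
  proof -
    show "integral\<^sup>L lborel (\<lambda>x. f (x + c)) = integral\<^sup>L lborel f"
      by (subst (2) lborel_distr_plus[symmetric, of c], subst integral_distr) (auto simp: add.commute)
    show "integrable lborel f \<Longrightarrow> integrable lborel (\<lambda>x. f (x + c))"
      by (subst (asm) lborel_distr_plus[symmetric, of c], subst (asm) integrable_distr_eq) (auto simp: add.commute)
  qed
  have [measurable]: "v \<in> borel_measurable borel" "dv \<in> borel_measurable borel" using v dv by auto
  have der': "((\<lambda>t. v (x + t *\<^sub>R ?e)) has_vector_derivative dv (x + t *\<^sub>R ?e)) (at t)" for x t
  proof -
    have "((\<lambda>s. v ((x + t *\<^sub>R ?e) + (s - t) *\<^sub>R ?e)) has_vector_derivative dv (x + t *\<^sub>R ?e)) (at t)"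
      using vector_diff_chain_at[of "\<lambda>s. s - t" 1 t "\<lambda>s. v ((x + t *\<^sub>R ?e) + s *\<^sub>R ?e)" "dv (x + t *\<^sub>R ?e)"] der[of "x + t *\<^sub>R ?e"]
      by (simp add: o_def derivative_eq_intros has_vector_derivative_diff_const)
    thus ?thesis by (simp add: algebra_simps)
  qed
  have ftc: "(\<integral>t. indicator {0..1} t *\<^sub>R dv (x + t *\<^sub>R ?e) \<partial>lborel) = v (x + ?e) - v x" for x
  proof -
    have "(\<integral>t. indicator {0..1} t *\<^sub>R dv (x + t *\<^sub>R ?e) \<partial>lborel) = v (x + 1 *\<^sub>R ?e) - v (x + 0 *\<^sub>R ?e)"
      by (rule integral_FTC_Icc)
         (auto intro!: has_vector_derivative_at_within[OF der'] continuous_on_compose2[OF dv_cont] continuous_intros)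
    thus ?thesis by simp
  qed
  define f where "f = (\<lambda>(t::real, x). indicator {0..1} t *\<^sub>R dv (x + t *\<^sub>R ?e))"
  have [measurable]: "f \<in> borel_measurable (lborel \<Otimes>\<^sub>M lborel)"
    unfolding f_def by measurable
  have dvn [measurable]: "(\<lambda>x. norm (dv x)) \<in> borel_measurable borel" by measurable
  have "integrable (lborel \<Otimes>\<^sub>M lborel) f"
  proof (rule lborel_pair.Fubini_integrable)
    have "(\<lambda>t. \<integral>x. norm (f (t, x)) \<partial>lborel) = (\<lambda>t. indicator {0..1} t *\<^sub>R (\<integral>x. norm (dv x) \<partial>lborel))"
    proof
      fix t :: real
      have "(\<integral>x. norm (f (t, x)) \<partial>lborel) = (\<integral>x. indicator {0..1} t *\<^sub>R norm (dv (x + t *\<^sub>R ?e)) \<partial>lborel)"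
        by (simp add: f_def)
      also have "\<dots> = indicator {0..1} t *\<^sub>R (\<integral>x. norm (dv (x + t *\<^sub>R ?e)) \<partial>lborel)" by simp
      also have "(\<integral>x. norm (dv (x + t *\<^sub>R ?e)) \<partial>lborel) = (\<integral>x. norm (dv x) \<partial>lborel)" by (rule shift[OF dvn])
      finally show "(\<integral>x. norm (f (t, x)) \<partial>lborel) = indicator {0..1} t *\<^sub>R (\<integral>x. norm (dv x) \<partial>lborel)" .
    qed
    thus "integrable lborel (\<lambda>t. \<integral>x. norm (f (t, x)) \<partial>lborel)" by simp
    show "AE t in lborel. integrable lborel (\<lambda>x. f (t, x))"
      unfolding f_def by (intro AE_I2) (simp add: shift_i dv)
  qed measurable
  hence fub: "(\<integral>x. (\<integral>t. f (t, x) \<partial>lborel) \<partial>lborel) = (\<integral>t. (\<integral>x. f (t, x) \<partial>lborel) \<partial>lborel)"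
    using lborel_pair.Fubini_integral[of "\<lambda>t x. f (t, x)"] by simp
  have "(\<integral>x. (\<integral>t. f (t, x) \<partial>lborel) \<partial>lborel) = (\<integral>x. v (x + ?e) - v x \<partial>lborel)"
    by (simp add: f_def ftc)
  also have "\<dots> = 0" by (subst Bochner_Integration.integral_diff) (auto simp: shift shift_i v)
  finally have "(\<integral>t. (\<integral>x. f (t, x) \<partial>lborel) \<partial>lborel) = 0" using fub by simp
  moreover have "(\<integral>x. f (t, x) \<partial>lborel) = indicator {0..1} t *\<^sub>R integral\<^sup>L lborel dv" for t
    using shift[of dv "t *\<^sub>R ?e"] by (simp add: f_def)
  ultimately show ?thesis by simp
qed

text \<open>A polynomial quotient, in contrast to the pointwise definition of
  \<open>divdiff\<close>. It provides the bounds for the passage to the limit in the weight and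
  shows that the defect in the Leibniz rule is a polynomial.\<close>

lemma divdiff_poly:
  assumes "cpoly p" "j \<noteq> b"
  shows "\<exists>q. cpoly q \<and> (\<forall>x. p x - p (swapv j b x) = of_real (x $ j - x $ b) * q x)"
  using assms(1)
proof (induction rule: cpoly.induct)
  case (cpoly_const c)
  show ?case by (intro exI[of _ "\<lambda>_. 0"]) (auto intro: cpoly.intros)
next
  case (cpoly_add p1 p2)
  then obtain q1 q2 where q: "cpoly q1" "cpoly q2"
    "\<And>x. p1 x - p1 (swapv j b x) = of_real (x $ j - x $ b) * q1 x" "\<And>x. p2 x - p2 (swapv j b x) = of_real (x $ j - x $ b) * q2 x"
    by blast
  show ?case
    by (intro exI[of _ "\<lambda>x. q1 x + q2 x"] conjI cpoly.cpoly_add q allI)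
       (simp only: distrib_left q(3,4)[symmetric], simp)
next
  case (cpoly_coord p l)
  then obtain q where q: "cpoly q" "\<And>x. p x - p (swapv j b x) = of_real (x $ j - x $ b) * q x" by blast
  define s where "s = (if l = j then 1 else if l = b then -1 else 0 :: complex)"
  show ?case
  proof (intro exI[of _ "\<lambda>x. of_real (x $ l) * q x + s * p (swapv j b x)"] conjI allI)
    show "cpoly (\<lambda>x. of_real (x $ l) * q x + s * p (swapv j b x))"
      using cpoly_coord q by (intro cpoly.cpoly_add cpoly.cpoly_coord cpoly_cmult cpoly_swapv) auto
    fix x
    have s: "of_real (x $ l) - of_real (x $ tr j b l) = of_real (x $ j - x $ b) * s"
      using assms(2) by (auto simp: s_def tr_def)
    have "of_real (x $ l) * p x - of_real (x $ tr j b l) * p (swapv j b x)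
       = of_real (x $ l) * (p x - p (swapv j b x)) + (of_real (x $ l) - of_real (x $ tr j b l)) * p (swapv j b x)"
      by (simp add: algebra_simps)
    thus "of_real (x $ l) * p x - of_real (swapv j b x $ l) * p (swapv j b x) =
       of_real (x $ j - x $ b) * (of_real (x $ l) * q x + s * p (swapv j b x))"
      unfolding q(2) s by (simp add: algebra_simps)
  qed
qed

lemma AE_regular: "AE x in lborel. \<forall>i j. i \<noteq> j \<longrightarrow> x $ i \<noteq> (x :: real^'n::finite) $ j"
proof -
  let ?N = "{x :: real^'n. \<exists>i j. i \<noteq> j \<and> x $ i = x $ j}"
  have "closed {x :: real^'n. x $ i = x $ j}" for i j
    by (intro closed_Collect_eq continuous_intros)
  moreover have "?N = (\<Union>p\<in>{p. fst p \<noteq> snd p}. {x :: real^'n. x $ fst p = x $ snd p})" by (auto, blast)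
  ultimately have "?N \<in> sets borel" by auto
  moreover have "?N \<in> null_sets lebesgue" using negligible_not_regular negligible_iff_null_sets by blast
  ultimately have "?N \<in> null_sets lborel" by (simp add: null_sets_completion_iff)
  thus ?thesis by (rule AE_I') auto
qed

section \<open>Integration by parts for the weight\<close>

abbreviation root_pairs :: "('n \<times> 'n) set" where
  "root_pairs \<equiv> {p. fst p \<noteq> snd p}"

text \<open>For small $k$ the weight is not differentiable on the reflecting hyperplanes; integration by parts is
  done for this smooth symmetric approximation, whose singular terms cancel after antisymmetrization.\<close>

definition omega_reg :: "real \<Rightarrow> real \<Rightarrow> real^'n::finite \<Rightarrow> real" where
  "omega_reg k \<epsilon> x = exp (k / 2 * (\<Sum>p\<in>root_pairs. ln ((x $ fst p - x $ snd p)\<^sup>2 + \<epsilon>)))"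

lemma prod_pairs_swap:
  fixes h :: "'n::finite \<Rightarrow> 'n \<Rightarrow> 'a::comm_monoid_mult"
  shows "(\<Prod>p\<in>root_pairs. h (tr a b (fst p)) (tr a b (snd p))) = (\<Prod>p\<in>root_pairs. h (fst p) (snd p))"
  by (rule prod.reindex_bij_witness[where i = "map_prod (tr a b) (tr a b)" and j = "map_prod (tr a b) (tr a b)"]) auto

lemma sum_pairs_swap:
  fixes h :: "'n::finite \<Rightarrow> 'n \<Rightarrow> 'a::comm_monoid_add"
  shows "(\<Sum>p\<in>root_pairs. h (tr a b (fst p)) (tr a b (snd p))) = (\<Sum>p\<in>root_pairs. h (fst p) (snd p))"
  by (rule sum.reindex_bij_witness[where i = "map_prod (tr a b) (tr a b)" and j = "map_prod (tr a b) (tr a b)"]) auto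

lemma omega_swapv: "omega k (swapv a b x) = omega k x"
  unfolding omega_def swapv_nth by (rule prod_pairs_swap[of "\<lambda>i j. apow (x $ i - x $ j) k"])

lemma omega_reg_swapv: "omega_reg k \<epsilon> (swapv a b x) = omega_reg k \<epsilon> x"
  unfolding omega_reg_def swapv_nth sum_pairs_swap[of "\<lambda>i j. ln ((x $ i - x $ j)\<^sup>2 + \<epsilon>)"] ..

lemma measurable_nth [measurable]: "(\<lambda>x :: real^'n::finite. x $ i) \<in> borel_measurable borel"
  by (intro borel_measurable_continuous_onI continuous_intros)

lemma measurable_omega [measurable]: "omega k \<in> borel_measurable (borel :: (real^'n::finite) measure)"
  unfolding omega_def apow_def by measurable

lemma omega_nonneg: "omega k x \<ge> 0"
  unfolding omega_def apow_def by (intro prod_nonneg) auto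

lemma omega_pos: "(\<And>i j. i \<noteq> j \<Longrightarrow> x $ i \<noteq> x $ j) \<Longrightarrow> omega k x > 0"
  unfolding omega_def apow_def by (intro prod_pos) auto

lemma continuous_on_omega_reg: "\<epsilon> > 0 \<Longrightarrow> continuous_on A (omega_reg k \<epsilon> :: real^'n::finite \<Rightarrow> real)"
  unfolding omega_reg_def
  by (intro continuous_intros) (metis add_nonneg_pos less_irrefl zero_le_power2)

lemma omega_reg_nonneg: "omega_reg k \<epsilon> x \<ge> 0"
  by (simp add: omega_reg_def)

lemma gaussw_swapv: "gaussw (swapv a b x) = gaussw x"
  by (simp add: gaussw_def)

lemma coord_diff_le_l1norm: "\<bar>x $ i - x $ j\<bar> \<le> 2 * l1norm x"
  using nth_le_l1norm[of x i] nth_le_l1norm[of x j] by linarith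

lemma divdiff_poly_family:
  assumes "cpoly p"
  shows "\<exists>q. \<forall>b. b \<noteq> j \<longrightarrow> cpoly (q b) \<and> (\<forall>x. p x - p (swapv j b x) = of_real (x $ j - x $ b) * q b x)"
proof -
  have "\<forall>b\<in>- {j}. \<exists>q. cpoly q \<and> (\<forall>x. p x - p (swapv j b x) = of_real (x $ j - x $ b) * q x)"
  proof
    fix b assume "b \<in> - {j}"
    hence "j \<noteq> b" by auto
    from divdiff_poly[OF assms this] show "\<exists>q. cpoly q \<and> (\<forall>x. p x - p (swapv j b x) = of_real (x $ j - x $ b) * q x)" .
  qed
  from bchoice[OF this] show ?thesis by auto
qed

context dunkl
begin

text \<open>A common majorant of the weight and of all its regularisations with
  \<open>\<epsilon> \<le> 1\<close>, for dominated convergence. By |x_i - x_j| \<le> 2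
  \<open>l1norm x\<close>, each ordered pair contributes at most exp(2 k
  \<open>l1norm x\<close>).\<close>

definition wbound :: "real^'n::finite \<Rightarrow> real" where
  "wbound x = exp (2 * k * real (card (root_pairs :: ('n \<times> 'n) set)) * l1norm x)"

lemma expbdd_wbound: "expbdd (wbound :: real^'n::finite \<Rightarrow> real)"
  unfolding wbound_def by (rule expbddI[of 1 "2 * k * real (card (root_pairs :: ('n \<times> 'n) set))"]) (use k_nonneg in auto)

lemma measurable_wbound [measurable]: "wbound \<in> borel_measurable borel"
  unfolding wbound_def by measurable

lemma omega_le_wbound: "omega k x \<le> wbound (x :: real^'n::finite)"
proof -
  have "omega k x \<le> (\<Prod>p\<in>(root_pairs :: ('n \<times> 'n) set). exp (k * (2 * l1norm x)))"
    unfolding omega_def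
  proof (intro prod_mono conjI)
    fix p :: "'n \<times> 'n"
    let ?t = "x $ fst p - x $ snd p"
    show "0 \<le> apow ?t k" by (auto simp: apow_def)
    show "apow ?t k \<le> exp (k * (2 * l1norm x))"
    proof (cases "?t = 0")
      case False
      hence "apow ?t k = exp (k * ln \<bar>?t\<bar>)" by (simp add: apow_def powr_def)
      also have "ln \<bar>?t\<bar> \<le> 2 * l1norm x"
        using ln_bound[of "\<bar>?t\<bar>"] coord_diff_le_l1norm[of x "fst p" "snd p"] False by simp
      finally show ?thesis using k_nonneg by (simp add: mult_left_mono)
    qed (use k_nonneg in \<open>auto simp: apow_def\<close>)
  qed
  also have "\<dots> = wbound x" by (simp add: wbound_def exp_of_nat_mult[symmetric] mult_ac)
  finally show ?thesis .
qed

lemma omega_reg_le_wbound: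
  assumes "0 < \<epsilon>" "\<epsilon> \<le> 1"
  shows "omega_reg k \<epsilon> x \<le> wbound (x :: real^'n::finite)"
proof -
  have "(\<Sum>p\<in>root_pairs. ln ((x $ fst p - x $ snd p)\<^sup>2 + \<epsilon>)) \<le> (\<Sum>p\<in>(root_pairs :: ('n \<times> 'n) set). 4 * l1norm x)"
  proof (intro sum_mono)
    fix p :: "'n \<times> 'n"
    let ?t = "x $ fst p - x $ snd p"
    have "?t\<^sup>2 + \<epsilon> \<le> ?t\<^sup>2 + 1 + 2 * \<bar>?t\<bar>"
    proof -
      have "\<epsilon> \<le> 1 + 2 * \<bar>?t\<bar>" by (rule order_trans[OF assms(2)]) simp
      thus ?thesis by simp
    qed
    also have "\<dots> = (1 + \<bar>?t\<bar>)\<^sup>2" by (simp add: power2_sum)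
    also have "\<dots> \<le> (exp \<bar>?t\<bar>)\<^sup>2" by (intro power_mono exp_ge_add_one_self) auto
    also have "\<dots> = exp (2 * \<bar>?t\<bar>)" by (simp add: exp_double[symmetric])
    finally have "?t\<^sup>2 + \<epsilon> \<le> exp (2 * \<bar>?t\<bar>)" .
    moreover have "0 < ?t\<^sup>2 + \<epsilon>" using assms by (simp add: add_nonneg_pos)
    ultimately have "ln (?t\<^sup>2 + \<epsilon>) \<le> ln (exp (2 * \<bar>?t\<bar>))" by (subst ln_le_cancel_iff) auto
    hence "ln (?t\<^sup>2 + \<epsilon>) \<le> 2 * \<bar>?t\<bar>" by (simp only: ln_exp)
    thus "ln (?t\<^sup>2 + \<epsilon>) \<le> 4 * l1norm x" using coord_diff_le_l1norm[of x "fst p" "snd p"] by simp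
  qed
  hence "k / 2 * (\<Sum>p\<in>root_pairs. ln ((x $ fst p - x $ snd p)\<^sup>2 + \<epsilon>)) \<le> k / 2 * (\<Sum>p\<in>(root_pairs :: ('n \<times> 'n) set). 4 * l1norm x)"
    using k_nonneg by (intro mult_left_mono) auto
  thus ?thesis unfolding omega_reg_def wbound_def by (simp add: mult_ac)
qed

lemma expbdd_omega: "expbdd (omega k :: real^'n::finite \<Rightarrow> real)"
  by (rule expbdd_mono[OF expbdd_wbound]) (simp add: omega_nonneg, rule order_trans[OF omega_le_wbound abs_ge_self])

lemma expbdd_omega_reg: "0 < \<epsilon> \<Longrightarrow> \<epsilon> \<le> 1 \<Longrightarrow> expbdd (omega_reg k \<epsilon> :: real^'n::finite \<Rightarrow> real)"
  by (rule expbdd_mono[OF expbdd_wbound])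
     (simp add: abs_of_nonneg[OF omega_reg_nonneg], rule order_trans[OF omega_reg_le_wbound abs_ge_self])

lemma omega_reg_tendsto:
  fixes x :: "real^'n::finite"
  assumes reg: "\<And>i j. i \<noteq> j \<Longrightarrow> x $ i \<noteq> x $ j" and lim: "\<epsilon> \<longlonglongrightarrow> 0"
  shows "(\<lambda>n. omega_reg k (\<epsilon> n) x) \<longlonglongrightarrow> omega k x"
proof -
  have "(\<lambda>n. omega_reg k (\<epsilon> n) x) \<longlonglongrightarrow> exp (k / 2 * (\<Sum>p\<in>root_pairs. ln ((x $ fst p - x $ snd p)\<^sup>2 + 0)))"
    unfolding omega_reg_def
    by (intro tendsto_intros lim) (use reg in auto)
  also have "exp (k / 2 * (\<Sum>p\<in>root_pairs. ln ((x $ fst p - x $ snd p)\<^sup>2 + 0))) = omega k x"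
  proof -
    have "k / 2 * ln ((x $ fst p - x $ snd p)\<^sup>2 + 0) = k * ln \<bar>x $ fst p - x $ snd p\<bar>" if "p \<in> root_pairs" for p
      using that reg[of "fst p" "snd p"] ln_realpow[of "\<bar>x $ fst p - x $ snd p\<bar>" 2] by simp
    hence "k / 2 * (\<Sum>p\<in>root_pairs. ln ((x $ fst p - x $ snd p)\<^sup>2 + 0)) = (\<Sum>p\<in>root_pairs. k * ln \<bar>x $ fst p - x $ snd p\<bar>)"
      unfolding sum_distrib_left by (intro sum.cong) auto
    hence "exp (k / 2 * (\<Sum>p\<in>root_pairs. ln ((x $ fst p - x $ snd p)\<^sup>2 + 0))) = (\<Prod>p\<in>root_pairs. exp (k * ln \<bar>x $ fst p - x $ snd p\<bar>))"
      by (simp add: exp_sum)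
    also have "\<dots> = omega k x" unfolding omega_def
      by (intro prod.cong) (use reg in \<open>auto simp: apow_def powr_def\<close>)
    finally show ?thesis .
  qed
  finally show ?thesis .
qed

lemma gauss_omega_reg_has_pd:
  fixes x :: "real^'n::finite"
  assumes "\<epsilon> > 0"
  shows "((\<lambda>t. gaussw (x + t *\<^sub>R axis j 1) * omega_reg k \<epsilon> (x + t *\<^sub>R axis j 1)) has_real_derivative
    (- x $ j + 2 * k * (\<Sum>b\<in>UNIV - {j}. (x $ j - x $ b) / ((x $ j - x $ b)\<^sup>2 + \<epsilon>))) * (gaussw x * omega_reg k \<epsilon> x)) (at 0)"
proof -
  define d where "d i = (if i = j then 1 else 0 :: real)" for i
  define L where "L t = - (\<Sum>i\<in>UNIV. (x $ i + t * d i)\<^sup>2) / 2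
      + k / 2 * (\<Sum>p\<in>root_pairs. ln ((x $ fst p + t * d (fst p) - (x $ snd p + t * d (snd p)))\<^sup>2 + \<epsilon>))" for t
  have nth: "(x + t *\<^sub>R axis j 1) $ i = x $ i + t * d i" for t i by (simp add: axis_def d_def)
  have W: "gaussw (x + t *\<^sub>R axis j 1) * omega_reg k \<epsilon> (x + t *\<^sub>R axis j 1) = exp (L t)" for t
    unfolding gaussw_def omega_reg_def norm2_vec nth exp_add[symmetric] L_def ..
  have pos: "0 < r\<^sup>2 + \<epsilon>" for r :: real using assms by (simp add: add_nonneg_pos)
  define g where "g a b = (x $ a - x $ b) * (d a - d b) / ((x $ a - x $ b)\<^sup>2 + \<epsilon>)" for a b
  have 1: "((\<lambda>t. \<Sum>i\<in>UNIV. (x $ i + t * d i)\<^sup>2) has_real_derivative (\<Sum>i\<in>UNIV. 2 * x $ i * d i)) (at 0)"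
    by (rule DERIV_sum) (auto intro!: derivative_eq_intros)
  have 2: "((\<lambda>t. \<Sum>p\<in>root_pairs. ln ((x $ fst p + t * d (fst p) - (x $ snd p + t * d (snd p)))\<^sup>2 + \<epsilon>)) has_real_derivative
      (\<Sum>p\<in>root_pairs. 2 * g (fst p) (snd p))) (at 0)"
  proof (rule DERIV_sum)
    fix p :: "'n \<times> 'n"
    show "((\<lambda>t. ln ((x $ fst p + t * d (fst p) - (x $ snd p + t * d (snd p)))\<^sup>2 + \<epsilon>)) has_real_derivative 2 * g (fst p) (snd p)) (at 0)"
      using pos[of "x $ fst p - x $ snd p"] by (auto intro!: derivative_eq_intros simp: g_def)
  qed
  \<comment> \<open>Only pairs containing j contribute, and each unordered one occurs twice.
    Together with the 2 from the square this gives 4, and the prefactor k/2 leaves 2 k.\<close>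
  have "(\<Sum>p\<in>root_pairs. 2 * g (fst p) (snd p)) = (\<Sum>p\<in>UNIV. 2 * g (fst p) (snd p))"
    by (intro sum.mono_neutral_left) (auto simp: g_def)
  also have "\<dots> = 2 * (\<Sum>a\<in>UNIV. \<Sum>b\<in>UNIV. g a b)"
    unfolding sum.cartesian_product by (simp add: sum_distrib_left case_prod_unfold)
  also have "(\<Sum>a\<in>UNIV. \<Sum>b\<in>UNIV. g a b) = 2 * (\<Sum>b\<in>UNIV - {j}. g j b)"
  proof (rule sum_pairs_star)
    fix a b
    show "g a b = g b a" unfolding g_def power2_commute[of "x $ a" "x $ b"] by (simp add: algebra_simps)
  qed (auto simp: g_def d_def)
  also have "(\<Sum>b\<in>UNIV - {j}. g j b) = (\<Sum>b\<in>UNIV - {j}. (x $ j - x $ b) / ((x $ j - x $ b)\<^sup>2 + \<epsilon>))"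
    by (intro sum.cong) (auto simp: g_def d_def)
  finally have 3: "(\<Sum>p\<in>root_pairs. 2 * g (fst p) (snd p)) = 4 * (\<Sum>b\<in>UNIV - {j}. (x $ j - x $ b) / ((x $ j - x $ b)\<^sup>2 + \<epsilon>))" by simp
  have "(L has_real_derivative (- x $ j + 2 * k * (\<Sum>b\<in>UNIV - {j}. (x $ j - x $ b) / ((x $ j - x $ b)\<^sup>2 + \<epsilon>)))) (at 0)"
    unfolding L_def
    by (rule derivative_eq_intros 1 2 refl | simp)+ (simp add: 3 d_def if_distrib cong: if_cong)
  from DERIV_fun_exp[OF this] have "((\<lambda>t. exp (L t)) has_real_derivative exp (L 0) * (- x $ j + 2 * k * (\<Sum>b\<in>UNIV - {j}. (x $ j - x $ b) / ((x $ j - x $ b)\<^sup>2 + \<epsilon>)))) (at 0)" .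
  moreover have "exp (L 0) = gaussw x * omega_reg k \<epsilon> x" using W[of 0] by simp
  ultimately show ?thesis unfolding W by (simp add: mult.commute)
qed

section \<open>The Gaussian functional on polynomials and the adjoint of the Dunkl operators\<close>

definition wt :: "real^'n::finite \<Rightarrow> real" where
  "wt x = gaussw x * omega k x"

lemma measurable_wt [measurable]: "wt \<in> borel_measurable borel"
  unfolding wt_def by measurable

lemma wt_nonneg: "wt x \<ge> 0"
  unfolding wt_def by (intro mult_nonneg_nonneg omega_nonneg less_imp_le[OF gaussw_pos])

lemma wt_swapv: "wt (swapv a b x) = wt x"
  by (simp add: wt_def omega_swapv gaussw_swapv)

lemma integrable_wt:
  fixes f :: "real^'n::finite \<Rightarrow> complex"
  assumes [measurable]: "f \<in> borel_measurable borel" and f: "expbdd f"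
  shows "integrable lborel (\<lambda>x. f x * of_real (wt x))"
proof -
  have "integrable lborel (\<lambda>x. gaussw x *\<^sub>R (f x * complex_of_real (omega k x)))"
    by (rule integrable_gauss) (auto intro!: expbdd_mult f expbdd_of_real expbdd_omega)
  thus ?thesis by (simp add: wt_def scaleR_conv_of_real mult_ac)
qed

lemma integrable_wt_cpoly: "cpoly p \<Longrightarrow> integrable lborel (\<lambda>x. p x * of_real (wt x))"
  by (intro integrable_wt cpoly_measurable cpoly_expbdd)

definition Lam :: "(real^'n::finite \<Rightarrow> complex) \<Rightarrow> complex" where
  "Lam p = (LINT x | lborel. p x * of_real (wt x))"

lemma Lam_add: "cpoly p \<Longrightarrow> cpoly q \<Longrightarrow> Lam (\<lambda>x. p x + q x) = Lam p + Lam q"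
  unfolding Lam_def distrib_right by (rule Bochner_Integration.integral_add) (auto intro: integrable_wt_cpoly)

lemma Lam_diff: "cpoly p \<Longrightarrow> cpoly q \<Longrightarrow> Lam (\<lambda>x. p x - q x) = Lam p - Lam q"
  unfolding Lam_def left_diff_distrib by (rule Bochner_Integration.integral_diff) (auto intro: integrable_wt_cpoly)

lemma Lam_cmult: "Lam (\<lambda>x. c * p x) = c * Lam p"
  unfolding Lam_def mult.assoc by simp

lemma Lam_sum: "finite A \<Longrightarrow> (\<And>i. i \<in> A \<Longrightarrow> cpoly (p i)) \<Longrightarrow> Lam (\<lambda>x. \<Sum>i\<in>A. p i x) = (\<Sum>i\<in>A. Lam (p i))"
  by (induction A rule: finite_induct) (auto simp: Lam_add cpoly_sum Lam_def[of "\<lambda>_. 0"])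

lemma Lam_swapv: "cpoly p \<Longrightarrow> Lam (\<lambda>x. p (swapv a b x)) = Lam p"
proof -
  assume "cpoly p"
  hence [measurable]: "p \<in> borel_measurable borel" by (rule cpoly_measurable)
  have "Lam (\<lambda>x. p (swapv a b x)) = (LINT x | lborel. (\<lambda>x. p x * of_real (wt x)) (swapv a b x))"
    by (simp add: Lam_def wt_swapv)
  also have "\<dots> = Lam p" unfolding Lam_def by (rule integral_swapv) measurable
  finally show ?thesis .
qed

text \<open>The integral of \<partial>_j (u W) vanishes, W being the Gaussian times the regularised
  weight. The logarithmic derivative of W contributes 2 k \<Sum> r_b u, where r_b is odd under the
  swap of j and b. As W is invariant under the swap, u may be replaced there by half the difference
  of u and its swapped version. In this form the singular part stays bounded as
  \<open>\<epsilon>\<close> tends to 0.\<close>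

lemma Lam_reg_zero:
  fixes u :: "real^'n::finite \<Rightarrow> complex"
  assumes u: "cpoly u" and \<epsilon>: "0 < \<epsilon>" "\<epsilon> \<le> 1"
  shows "(LINT x | lborel. (pd j u x - of_real (x $ j) * u x + of_real k * (\<Sum>b\<in>UNIV - {j}.
      of_real ((x $ j - x $ b) / ((x $ j - x $ b)\<^sup>2 + \<epsilon>)) * (u x - u (swapv j b x)))) * of_real (gaussw x * omega_reg k \<epsilon> x)) = 0"
proof -
  define W where "W x = gaussw x * omega_reg k \<epsilon> x" for x :: "real^'n"
  define r where "r b x = complex_of_real ((x $ j - x $ b) / ((x $ j - x $ b)\<^sup>2 + \<epsilon>))" for b and x :: "real^'n"
  have pos: "0 < t\<^sup>2 + \<epsilon>" for t :: real using \<epsilon> by (simp add: add_nonneg_pos)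
  have contO: "continuous_on UNIV (omega_reg k \<epsilon> :: real^'n \<Rightarrow> real)" by (rule continuous_on_omega_reg[OF \<epsilon>(1)])
  have contr: "continuous_on UNIV (r b)" for b
    unfolding r_def using pos by (intro continuous_intros) (auto simp: less_le)
  have contW: "continuous_on UNIV W" unfolding W_def using contO by (intro continuous_intros)
  note [measurable] = borel_measurable_continuous_onI[OF contO] borel_measurable_continuous_onI[OF contr]
     borel_measurable_continuous_onI[OF contW] cpoly_measurable[OF u] cpoly_measurable[OF cpoly_pd[OF u]]
  have eb_r: "expbdd (r b)" for b
  proof (rule expbdd_mono)
    show "expbdd (\<lambda>x. complex_of_real (1 / \<epsilon>) * (of_real (x $ j) - of_real (x $ b)))"
      by (intro cpoly_expbdd cpoly_cmult cpoly_diff cpoly_nth)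
    fix x
    have "\<bar>x $ j - x $ b\<bar> / ((x $ j - x $ b)\<^sup>2 + \<epsilon>) \<le> \<bar>x $ j - x $ b\<bar> / \<epsilon>"
      using \<epsilon> by (intro divide_left_mono mult_pos_pos pos) auto
    thus "norm (r b x) \<le> norm (complex_of_real (1 / \<epsilon>) * (of_real (x $ j) - of_real (x $ b)))"
      unfolding r_def norm_of_real of_real_diff[symmetric] norm_mult using \<epsilon> pos[of "x $ j - x $ b"] by simp
  qed
  have int: "integrable lborel (\<lambda>x. f x * of_real (W x))" if [measurable]: "f \<in> borel_measurable borel" and f: "expbdd f" for f :: "real^'n \<Rightarrow> complex"
  proof -
    have "integrable lborel (\<lambda>x. gaussw x *\<^sub>R (f x * complex_of_real (omega_reg k \<epsilon> x)))"
      by (rule integrable_gauss) (auto intro!: expbdd_mult f expbdd_of_real expbdd_omega_reg \<epsilon>)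
    thus ?thesis by (simp add: W_def scaleR_conv_of_real mult_ac)
  qed
  note eb = cpoly_expbdd[OF u] cpoly_expbdd[OF cpoly_pd[OF u]] cpoly_expbdd[OF cpoly_coord[OF u]] cpoly_expbdd[OF cpoly_swapv[OF u]]
  define dv where "dv x = (pd j u x - of_real (x $ j) * u x + 2 * of_real k * (\<Sum>b\<in>UNIV - {j}. r b x * u x)) * of_real (W x)" for x
  have "integral\<^sup>L lborel dv = 0"
  proof (rule integral_pd_zero)
    show "continuous_on UNIV dv" unfolding dv_def
      by (intro continuous_intros cpoly_continuous cpoly_pd u contr contW)
    show "integrable lborel (\<lambda>x. u x * of_real (W x))" by (rule int) (auto intro: eb)
    show "integrable lborel dv" unfolding dv_def
    proof (rule int)
      have "expbdd (\<lambda>x. pd j u x + (-1) * (of_real (x $ j) * u x) + 2 * of_real k * (\<Sum>b\<in>UNIV - {j}. r b x * u x))"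
        by (intro expbdd_add expbdd_mult expbdd_sum eb_r eb expbdd_bounded[OF order_refl]) auto
      thus "expbdd (\<lambda>x. pd j u x - of_real (x $ j) * u x + 2 * of_real k * (\<Sum>b\<in>UNIV - {j}. r b x * u x))" by simp
    qed measurable
    fix x
    have "((\<lambda>t. complex_of_real (W (x + t *\<^sub>R axis j 1))) has_vector_derivative
       of_real ((- x $ j + 2 * k * (\<Sum>b\<in>UNIV - {j}. (x $ j - x $ b) / ((x $ j - x $ b)\<^sup>2 + \<epsilon>))) * W x)) (at 0)"
      unfolding W_def by (rule has_vector_derivative_of_real) (use gauss_omega_reg_has_pd[OF \<epsilon>(1)] in \<open>simp add: has_real_derivative_iff_has_vector_derivative\<close>)
    from has_vector_derivative_mult[OF cpoly_has_pd[OF u, of x j] this]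
    have "((\<lambda>t. u (x + t *\<^sub>R axis j 1) * of_real (W (x + t *\<^sub>R axis j 1))) has_vector_derivative
        (u x * of_real ((- x $ j + 2 * k * (\<Sum>b\<in>UNIV - {j}. (x $ j - x $ b) / ((x $ j - x $ b)\<^sup>2 + \<epsilon>))) * W x) + pd j u x * of_real (W x))) (at 0)"
      by simp
    also have "(u x * of_real ((- x $ j + 2 * k * (\<Sum>b\<in>UNIV - {j}. (x $ j - x $ b) / ((x $ j - x $ b)\<^sup>2 + \<epsilon>))) * W x) + pd j u x * of_real (W x)) = dv x"
      unfolding dv_def sum_distrib_right[symmetric] by (simp add: r_def algebra_simps)
    finally show "((\<lambda>t. u (x + t *\<^sub>R axis j 1) * of_real (W (x + t *\<^sub>R axis j 1))) has_vector_derivative dv x) (at 0)" .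
  qed
  moreover have "integral\<^sup>L lborel dv = (LINT x | lborel. (pd j u x - of_real (x $ j) * u x + of_real k * (\<Sum>b\<in>UNIV - {j}. r b x * (u x - u (swapv j b x)))) * of_real (W x))"
  proof -
    have I1: "integrable lborel (\<lambda>x. (pd j u x - of_real (x $ j) * u x) * of_real (W x))"
      by (rule int) (auto intro!: cpoly_expbdd cpoly_diff cpoly_pd cpoly_coord u)
    have I2: "integrable lborel (\<lambda>x. (r b x * u x) * of_real (W x))" for b
      by (rule int) (auto intro!: expbdd_mult eb_r eb)
    have I3: "integrable lborel (\<lambda>x. (r b x * u (swapv j b x)) * of_real (W x))" for b
      by (rule int) (auto intro!: expbdd_mult eb_r eb)
    have sw: "(LINT x | lborel. r b x * u (swapv j b x) * of_real (W x)) = - (LINT x | lborel. r b x * u x * of_real (W x))" if "b \<noteq> j" for b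
    proof -
      have r_sw: "r b (swapv j b x) = - r b x" for x
      proof -
        have e: "(x $ b - x $ j) / ((x $ b - x $ j)\<^sup>2 + \<epsilon>) = - ((x $ j - x $ b) / ((x $ j - x $ b)\<^sup>2 + \<epsilon>))"
          unfolding power2_commute[of "x $ b" "x $ j"] by (simp add: minus_divide_left)
        show ?thesis unfolding r_def by (simp only: swapv_nth tr_left tr_right e of_real_minus)
      qed
      have W_sw: "W (swapv j b x) = W x" for x by (simp add: W_def gaussw_swapv omega_reg_swapv)
      have "(LINT x | lborel. r b x * u x * of_real (W x)) = (LINT x | lborel. (\<lambda>x. r b x * u x * of_real (W x)) (swapv j b x))"
        by (rule integral_swapv[symmetric]) measurable
      also have "\<dots> = - (LINT x | lborel. r b x * u (swapv j b x) * of_real (W x))"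
        by (simp add: r_sw W_sw)
      finally show ?thesis by simp
    qed
    have "integral\<^sup>L lborel dv = (LINT x | lborel. (pd j u x - of_real (x $ j) * u x) * of_real (W x) + of_real k * (\<Sum>b\<in>UNIV - {j}. 2 * (r b x * u x * of_real (W x))))"
      unfolding dv_def by (intro arg_cong[where f = "integral\<^sup>L lborel"] ext) (simp add: sum_distrib_right sum_distrib_left algebra_simps)
    also have "\<dots> = (LINT x | lborel. (pd j u x - of_real (x $ j) * u x) * of_real (W x)) + of_real k * (\<Sum>b\<in>UNIV - {j}. 2 * (LINT x | lborel. r b x * u x * of_real (W x)))"
      using I1 I2 by simp
    also have "(\<Sum>b\<in>UNIV - {j}. 2 * (LINT x | lborel. r b x * u x * of_real (W x))) = (\<Sum>b\<in>UNIV - {j}. (LINT x | lborel. r b x * u x * of_real (W x)) - (LINT x | lborel. r b x * u (swapv j b x) * of_real (W x)))"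
      by (intro sum.cong refl) (simp add: sw)
    also have "(LINT x | lborel. (pd j u x - of_real (x $ j) * u x) * of_real (W x)) + of_real k * \<dots> =
       (LINT x | lborel. (pd j u x - of_real (x $ j) * u x) * of_real (W x) + of_real k * (\<Sum>b\<in>UNIV - {j}. r b x * u x * of_real (W x) - r b x * u (swapv j b x) * of_real (W x)))"
      using I1 I2 I3 by simp
    also have "\<dots> = (LINT x | lborel. (pd j u x - of_real (x $ j) * u x + of_real k * (\<Sum>b\<in>UNIV - {j}. r b x * (u x - u (swapv j b x)))) * of_real (W x))"
      by (intro arg_cong[where f = "integral\<^sup>L lborel"] ext) (simp add: distrib_right sum_distrib_right sum_distrib_left sum_subtractf algebra_simps)
    finally show ?thesis .
  qed
  ultimately show ?thesis by (simp add: W_def r_def)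
qed

text \<open>The limit of \<open>Lam_reg_zero\<close>. With t = x_j - x_b and t q the difference of u
  and its swapped version, the regularised quotient is q t^2/(t^2 + \<epsilon>): bounded by |q| for
  all \<open>\<epsilon>\<close> and convergent to the divided difference off the
  hyperplanes.\<close>

lemma Lam_dunkl_op:
  fixes u :: "real^'n::finite \<Rightarrow> complex"
  assumes u: "cpoly u"
  shows "Lam (T j u) = Lam (\<lambda>x. of_real (x $ j) * u x)"
proof -
  define \<epsilon> where "\<epsilon> n = 1 / real (Suc n)" for n
  have \<epsilon>: "0 < \<epsilon> n" "\<epsilon> n \<le> 1" for n by (auto simp: \<epsilon>_def)
  have \<epsilon>0: "\<epsilon> \<longlonglongrightarrow> 0" unfolding \<epsilon>_def by (rule LIMSEQ_Suc[OF lim_1_over_n])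
  define r where "r n b x = complex_of_real ((x $ j - x $ b) / ((x $ j - x $ b)\<^sup>2 + \<epsilon> n))" for n b and x :: "real^'n"
  define h where "h n x = (pd j u x - of_real (x $ j) * u x + of_real k * (\<Sum>b\<in>UNIV - {j}. r n b x * (u x - u (swapv j b x)))) * of_real (gaussw x * omega_reg k (\<epsilon> n) x)" for n x
  have h0: "integral\<^sup>L lborel (h n) = 0" for n
    unfolding h_def r_def by (rule Lam_reg_zero[OF u \<epsilon>])
  from divdiff_poly_family[OF u, of j]
  obtain q where q: "cpoly (q b)" and q_eq: "u x - u (swapv j b x) = of_real (x $ j - x $ b) * q b x" if "b \<noteq> j" for b x
    by auto
  have contO: "continuous_on UNIV (omega_reg k (\<epsilon> n) :: real^'n \<Rightarrow> real)" for n by (rule continuous_on_omega_reg[OF \<epsilon>(1)])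
  note [measurable] = borel_measurable_continuous_onI[OF contO] cpoly_measurable[OF u] cpoly_measurable[OF cpoly_pd[OF u]] cpoly_measurable[OF cpoly_dunkl_op[OF u]]
  define B where "B x = norm (pd j u x) + norm (of_real (x $ j) * u x) + k * (\<Sum>b\<in>UNIV - {j}. norm (q b x))" for x
  have "(\<lambda>n. integral\<^sup>L lborel (h n)) \<longlonglongrightarrow> (LINT x | lborel. (T j u x - of_real (x $ j) * u x) * of_real (wt x))"
  proof (rule integral_dominated_convergence[where w = "\<lambda>x. gaussw x *\<^sub>R (B x * wbound x)"])
    show "integrable lborel (\<lambda>x. gaussw x *\<^sub>R (B x * wbound x))"
    proof (rule integrable_gauss)
      have "(\<lambda>x. norm (q b x)) \<in> borel_measurable borel" if "b \<noteq> j" for b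
        using cpoly_measurable[OF q[OF that]] by measurable
      hence [measurable]: "(\<lambda>x. \<Sum>b\<in>UNIV - {j}. norm (q b x)) \<in> borel_measurable borel" by (intro borel_measurable_sum) auto
      show "(\<lambda>x. B x * wbound x) \<in> borel_measurable borel" unfolding B_def by measurable
      show "expbdd (\<lambda>x. B x * wbound x)" unfolding B_def
        by (intro expbdd_mult expbdd_add expbdd_sum expbdd_norm expbdd_wbound cpoly_expbdd cpoly_pd cpoly_coord u q expbdd_bounded[OF order_refl]) auto
    qed
    show "(\<lambda>x. (T j u x - of_real (x $ j) * u x) * of_real (wt x)) \<in> borel_measurable lborel" by measurable
    show "h n \<in> borel_measurable lborel" for n unfolding h_def r_def by measurable
    show "AE x in lborel. norm (h n x) \<le> gaussw x *\<^sub>R (B x * wbound x)" for n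
    proof (rule AE_I2)
      fix x
      have "norm (r n b x * (u x - u (swapv j b x))) \<le> norm (q b x)" if "b \<noteq> j" for b
      proof -
        define t where "t = x $ j - x $ b"
        have p: "0 < t\<^sup>2 + \<epsilon> n" using \<epsilon>(1)[of n] by (simp add: add_nonneg_pos)
        have "norm (r n b x * (u x - u (swapv j b x))) = \<bar>t / (t\<^sup>2 + \<epsilon> n) * t\<bar> * norm (q b x)"
          unfolding q_eq[OF that] r_def t_def[symmetric] by (simp only: norm_mult norm_of_real abs_mult mult.assoc)
        also have "t / (t\<^sup>2 + \<epsilon> n) * t = t\<^sup>2 / (t\<^sup>2 + \<epsilon> n)" by (simp add: power2_eq_square)
        also have "\<bar>t\<^sup>2 / (t\<^sup>2 + \<epsilon> n)\<bar> \<le> 1" using p \<epsilon>(1)[of n] by simp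
        finally show ?thesis by (simp add: mult_right_mono)
      qed
      hence "norm (\<Sum>b\<in>UNIV - {j}. r n b x * (u x - u (swapv j b x))) \<le> (\<Sum>b\<in>UNIV - {j}. norm (q b x))"
        by (intro sum_norm_le) auto
      hence "norm (pd j u x - of_real (x $ j) * u x + of_real k * (\<Sum>b\<in>UNIV - {j}. r n b x * (u x - u (swapv j b x)))) \<le> B x"
        unfolding B_def using k_nonneg
        by (intro norm_triangle_mono norm_triangle_ineq4) (auto simp: norm_mult intro!: mult_left_mono)
      moreover have "0 \<le> omega_reg k (\<epsilon> n) x" by (simp add: omega_reg_def)
      ultimately have "norm (pd j u x - of_real (x $ j) * u x + of_real k * (\<Sum>b\<in>UNIV - {j}. r n b x * (u x - u (swapv j b x)))) * omega_reg k (\<epsilon> n) x \<le> B x * wbound x"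
        using omega_reg_le_wbound[OF \<epsilon>, of n x] by (intro mult_mono) (auto intro: order_trans[OF norm_ge_zero])
      hence "gaussw x * (norm (pd j u x - of_real (x $ j) * u x + of_real k * (\<Sum>b\<in>UNIV - {j}. r n b x * (u x - u (swapv j b x)))) * omega_reg k (\<epsilon> n) x) \<le> gaussw x * (B x * wbound x)"
        by (rule mult_left_mono) (rule less_imp_le[OF gaussw_pos])
      thus "norm (h n x) \<le> gaussw x *\<^sub>R (B x * wbound x)"
        unfolding h_def norm_mult norm_of_real abs_mult real_scaleR_def
          abs_of_nonneg[OF omega_reg_nonneg] abs_of_pos[OF gaussw_pos] by (simp only: mult.left_commute)
    qed
    show "AE x in lborel. (\<lambda>n. h n x) \<longlonglongrightarrow> (T j u x - of_real (x $ j) * u x) * of_real (wt x)"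
      using AE_regular
    proof eventually_elim
      fix x :: "real^'n" assume reg: "\<forall>i j. i \<noteq> j \<longrightarrow> x $ i \<noteq> x $ j"
      have "(\<lambda>n. h n x) \<longlonglongrightarrow> (pd j u x - of_real (x $ j) * u x + of_real k * (\<Sum>b\<in>UNIV - {j}. of_real ((x $ j - x $ b) / ((x $ j - x $ b)\<^sup>2 + 0)) * (u x - u (swapv j b x)))) * of_real (gaussw x * omega k x)"
        unfolding h_def r_def using reg by (intro tendsto_intros \<epsilon>0 omega_reg_tendsto) auto
      also have "(\<Sum>b\<in>UNIV - {j}. of_real ((x $ j - x $ b) / ((x $ j - x $ b)\<^sup>2 + 0)) * (u x - u (swapv j b x))) = (\<Sum>b\<in>UNIV - {j}. divdiff j b u x)"
      proof (rule sum.cong[OF refl])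
        fix b assume "b \<in> UNIV - {j}"
        hence ne: "x $ j \<noteq> x $ b" using reg by auto
        have "of_real (t / (t\<^sup>2 + 0)) * z = z / complex_of_real t" for t z by (simp add: power2_eq_square)
        thus "of_real ((x $ j - x $ b) / ((x $ j - x $ b)\<^sup>2 + 0)) * (u x - u (swapv j b x)) = divdiff j b u x"
          using ne by (simp only: divdiff_def if_False)
      qed
      finally show "(\<lambda>n. h n x) \<longlonglongrightarrow> (T j u x - of_real (x $ j) * u x) * of_real (wt x)"
        by (simp add: dunkl_op_def wt_def algebra_simps)
    qed
  qed
  hence "(LINT x | lborel. (T j u x - of_real (x $ j) * u x) * of_real (wt x)) = 0"
    unfolding h0 by (simp add: LIMSEQ_const_iff)
  hence "Lam (\<lambda>x. T j u x - of_real (x $ j) * u x) = 0" by (simp add: Lam_def)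
  thus ?thesis by (subst (asm) Lam_diff) (auto intro: cpoly_dunkl_op u cpoly_coord)
qed

text \<open>$T_j$ is antisymmetric for the weight \<open>omega\<close>: the defect in the Leibniz rule,
  $k \sum_b (p - \sigma_{jb} p)(q - \sigma_{jb} q) / (x_j - x_b)$, is odd under $\sigma_{jb}$ and integrates to $0$.\<close>

lemma Lam_antisym:
  fixes p q :: "real^'n::finite \<Rightarrow> complex"
  assumes p: "cpoly p" and q: "cpoly q"
  shows "Lam (\<lambda>x. T j p x * q x) + Lam (\<lambda>x. p x * T j q x) = Lam (\<lambda>x. of_real (x $ j) * (p x * q x))"
proof -
  from divdiff_poly_family[OF p, of j]
  obtain P where P: "cpoly (P b)" and P_eq: "p x - p (swapv j b x) = of_real (x $ j - x $ b) * P b x" if "b \<noteq> j" for b x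
    by auto
  \<comment> \<open>Off the hyperplane this equals the Leibniz defect (p - \<sigma> p)(q - \<sigma>
    q)/(x_j - x_b); being a polynomial, it is integrable against the Gaussian weight.\<close>
  define s where "s b x = P b x * (q x - q (swapv j b x))" for b x
  have s_poly: "cpoly (s b)" if "b \<noteq> j" for b
    unfolding s_def by (intro cpoly_mult P that cpoly_diff q cpoly_swapv)
  have s0: "Lam (s b) = 0" if "b \<noteq> j" for b
  proof -
    define h where "h x = (p x - p (swapv j b x)) * (q x - q (swapv j b x)) / of_real (x $ j - x $ b) * of_real (wt x)" for x
    note [measurable] = cpoly_measurable[OF p] cpoly_measurable[OF q] cpoly_measurable[OF s_poly[OF that]]
    have "Lam (s b) = integral\<^sup>L lborel h" unfolding Lam_def
    proof (rule integral_cong_AE)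
      show "AE x in lborel. s b x * complex_of_real (wt x) = h x" using AE_regular
      proof eventually_elim
        fix x :: "real^'n" assume reg: "\<forall>i j. i \<noteq> j \<longrightarrow> x $ i \<noteq> x $ j"
        hence "complex_of_real (x $ j - x $ b) \<noteq> 0" using that by auto
        thus "s b x * complex_of_real (wt x) = h x" unfolding h_def P_eq[OF that] s_def by simp
      qed
      show "h \<in> borel_measurable lborel" unfolding h_def by measurable
    qed measurable
    also have "\<dots> = 0"
    proof (rule integral_odd_swapv[of _ j b])
      show "h \<in> borel_measurable borel" unfolding h_def by measurable
      fix x
      have 1: "h (swapv j b x) = (p (swapv j b x) - p x) * (q (swapv j b x) - q x) / complex_of_real (x $ b - x $ j) * of_real (wt x)"
        by (simp add: h_def wt_swapv)
      have 2: "complex_of_real (x $ b - x $ j) = - complex_of_real (x $ j - x $ b)" by simp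
      have 3: "(p (swapv j b x) - p x) * (q (swapv j b x) - q x) = (p x - p (swapv j b x)) * (q x - q (swapv j b x))"
        by (simp add: algebra_simps)
      show "h (swapv j b x) = - h x"
        unfolding 1 2 3 unfolding h_def by (simp del: of_real_diff)
    qed
    finally show ?thesis .
  qed
  note [measurable] = cpoly_measurable[OF p] cpoly_measurable[OF q] cpoly_measurable[OF cpoly_dunkl_op[OF p]] cpoly_measurable[OF cpoly_dunkl_op[OF q]]
     cpoly_measurable[OF cpoly_dunkl_op[OF cpoly_mult[OF p q]]]
  have sp: "cpoly (\<lambda>x. of_real k * (\<Sum>b\<in>UNIV - {j}. s b x))"
    by (intro cpoly_cmult cpoly_sum s_poly) auto
  note [measurable] = cpoly_measurable[OF sp]
  have "Lam (\<lambda>x. T j p x * q x) + Lam (\<lambda>x. p x * T j q x) = Lam (\<lambda>x. T j p x * q x + p x * T j q x)"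
    by (rule Lam_add[symmetric]) (intro cpoly_mult cpoly_dunkl_op p q)+
  also have "\<dots> = Lam (\<lambda>x. T j (\<lambda>x. p x * q x) x + of_real k * (\<Sum>b\<in>UNIV - {j}. s b x))"
    unfolding Lam_def
  proof (rule integral_cong_AE)
    show "AE x in lborel. (T j p x * q x + p x * T j q x) * complex_of_real (wt x) =
       (T j (\<lambda>x. p x * q x) x + of_real k * (\<Sum>b\<in>UNIV - {j}. s b x)) * complex_of_real (wt x)" using AE_regular
    proof eventually_elim
      fix x :: "real^'n" assume reg: "\<forall>i j. i \<noteq> j \<longrightarrow> x $ i \<noteq> x $ j"
      have "divdiff j b p x * q x + p x * divdiff j b q x = divdiff j b (\<lambda>x. p x * q x) x + s b x" if "b \<noteq> j" for b
      proof -
        define t where "t = complex_of_real (x $ j - x $ b)"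
        have t: "t \<noteq> 0" using reg that unfolding t_def by auto
        have "divdiff j b f x = (f x - f (swapv j b x)) / t" for f
          using reg that by (auto simp: divdiff_def t_def)
        moreover have "s b x = (p x - p (swapv j b x)) * (q x - q (swapv j b x)) / t"
          unfolding s_def P_eq[OF that] t_def[symmetric] using t by simp
        ultimately show ?thesis by (simp add: add_divide_distrib[symmetric] algebra_simps diff_divide_distrib[symmetric])
      qed
      hence "(\<Sum>b\<in>UNIV - {j}. divdiff j b p x * q x + p x * divdiff j b q x) = (\<Sum>b\<in>UNIV - {j}. divdiff j b (\<lambda>x. p x * q x) x + s b x)"
        by (intro sum.cong) auto
      hence "(\<Sum>b\<in>UNIV - {j}. divdiff j b p x) * q x + p x * (\<Sum>b\<in>UNIV - {j}. divdiff j b q x) = (\<Sum>b\<in>UNIV - {j}. divdiff j b (\<lambda>x. p x * q x) x) + (\<Sum>b\<in>UNIV - {j}. s b x)"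
        by (simp add: sum.distrib sum_distrib_left sum_distrib_right)
      from arg_cong[OF this, of "\<lambda>z. of_real k * z"]
      have "T j p x * q x + p x * T j q x = T j (\<lambda>x. p x * q x) x + of_real k * (\<Sum>b\<in>UNIV - {j}. s b x)"
        unfolding dunkl_op_def pd_mult[OF p q] by (simp add: algebra_simps)
      thus "(T j p x * q x + p x * T j q x) * complex_of_real (wt x) =
       (T j (\<lambda>x. p x * q x) x + of_real k * (\<Sum>b\<in>UNIV - {j}. s b x)) * complex_of_real (wt x)" by simp
    qed
  qed measurable
  also have "\<dots> = Lam (T j (\<lambda>x. p x * q x)) + of_real k * (\<Sum>b\<in>UNIV - {j}. Lam (s b))"
    by (subst Lam_add; (subst Lam_cmult)?; (subst Lam_sum)?) (auto intro!: cpoly_dunkl_op cpoly_mult p q sp s_poly)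
  also have "\<dots> = Lam (\<lambda>x. of_real (x $ j) * (p x * q x))"
    by (simp add: s0 Lam_dunkl_op cpoly_mult p q)
  finally show ?thesis .
qed

end

section \<open>Uniqueness for the Fourier transform\<close>

lemma integrable_pair_bounded:
  fixes h1 h2 :: "real^'n::finite \<Rightarrow> complex" and B :: "(real^'n) \<times> (real^'n) \<Rightarrow> complex"
  assumes h1: "integrable lborel h1" and h2: "integrable lborel h2"
    and [measurable]: "B \<in> borel_measurable borel" and bound: "\<And>z. norm (B z) \<le> C"
  shows "integrable (lborel \<Otimes>\<^sub>M lborel) (\<lambda>(x, y). h1 x * h2 y * B (x, y))"
proof -
  have [measurable]: "h1 \<in> borel_measurable borel" "h2 \<in> borel_measurable borel" using h1 h2 by auto
  have 1: "integrable (lborel \<Otimes>\<^sub>M lborel) (\<lambda>(x, y). h1 x * h2 y)"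
  proof (rule lborel_pair.Fubini_integrable)
    show "integrable lborel (\<lambda>x. \<integral>y. norm (case (x, y) of (x, y) \<Rightarrow> h1 x * h2 y) \<partial>lborel)"
      using h1 by (simp add: norm_mult)
    show "AE x in lborel. integrable lborel (\<lambda>y. case (x, y) of (x, y) \<Rightarrow> h1 x * h2 y)"
      using h2 by simp
  qed measurable
  have [measurable]: "(\<lambda>(x, y). h1 x * h2 y * B (x, y)) \<in> borel_measurable (lborel \<Otimes>\<^sub>M lborel)"
  proof -
    have "B \<in> borel_measurable (lborel \<Otimes>\<^sub>M lborel)" by (simp add: lborel_prod)
    moreover have "(\<lambda>(x, y). h1 x * h2 y) \<in> borel_measurable (lborel \<Otimes>\<^sub>M lborel)" by measurable
    ultimately have "(\<lambda>z. (case z of (x, y) \<Rightarrow> h1 x * h2 y) * B z) \<in> borel_measurable (lborel \<Otimes>\<^sub>M lborel)"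
      by (rule borel_measurable_times[rotated])
    thus ?thesis by (simp add: case_prod_unfold)
  qed
  show ?thesis
  proof (rule Bochner_Integration.integrable_bound)
    show "integrable (lborel \<Otimes>\<^sub>M lborel) (\<lambda>z. of_real C * (case z of (x, y) \<Rightarrow> h1 x * h2 y))"
      by (rule Bochner_Integration.integrable_mult_right[OF 1])
    have C0: "C \<ge> 0" using bound[of "(0, 0)"] order_trans[OF norm_ge_zero] by blast
    show "AE z in lborel \<Otimes>\<^sub>M lborel. norm (case z of (x, y) \<Rightarrow> h1 x * h2 y * B (x, y)) \<le> norm (of_real C * (case z of (x, y) \<Rightarrow> h1 x * h2 y))"
    proof (rule AE_I2)
      fix z :: "(real^'n) \<times> (real^'n)"
      show "norm (case z of (x, y) \<Rightarrow> h1 x * h2 y * B (x, y)) \<le> norm (of_real C * (case z of (x, y) \<Rightarrow> h1 x * h2 y))"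
        using mult_left_mono[OF bound[of z], of "norm (h1 (fst z) * h2 (snd z))"] C0
        by (simp add: case_prod_unfold norm_mult mult_ac)
    qed
  qed measurable
qed

text \<open>The coupling \<open>B\<close> will be a character, a Gaussian or the kernel
  \<open>K\<close>. All of these are bounded, so integrability of the two factors justifies the
  exchange.\<close>

lemma fubini_bounded:
  fixes h1 h2 :: "real^'n::finite \<Rightarrow> complex" and B :: "(real^'n) \<times> (real^'n) \<Rightarrow> complex"
  assumes "integrable lborel h1" "integrable lborel h2" "B \<in> borel_measurable borel" "\<And>z. norm (B z) \<le> C"
  shows "(LINT x | lborel. h1 x * (LINT y | lborel. h2 y * B (x, y))) = (LINT y | lborel. h2 y * (LINT x | lborel. h1 x * B (x, y)))"
proof -
  have "(LINT y | lborel. (LINT x | lborel. h1 x * h2 y * B (x, y))) = (LINT x | lborel. (LINT y | lborel. h1 x * h2 y * B (x, y)))"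
    by (rule lborel_pair.Fubini_integral) (rule integrable_pair_bounded[OF assms])
  moreover have "(LINT x | lborel. h1 x * h2 y * B (x, y)) = h2 y * (LINT x | lborel. h1 x * B (x, y))" for y
    by (subst integral_mult_right_zero[symmetric]) (simp only: mult_ac)
  moreover have "(LINT y | lborel. h1 x * h2 y * B (x, y)) = h1 x * (LINT y | lborel. h2 y * B (x, y))" for x
    by (subst integral_mult_right_zero[symmetric]) (simp only: mult_ac)
  ultimately show ?thesis by simp
qed

lemma integrable_mult_bounded:
  fixes h B :: "'a \<Rightarrow> complex"
  assumes "integrable M h" "B \<in> borel_measurable M" "\<And>x. norm (B x) \<le> C"
  shows "integrable M (\<lambda>x. h x * B x)"
proof (rule Bochner_Integration.integrable_bound)
  have "h \<in> borel_measurable M" using assms(1) by auto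
  thus "(\<lambda>x. h x * B x) \<in> borel_measurable M" using assms(2) by measurable
  show "integrable M (\<lambda>x. of_real C * h x)" using assms(1) by simp
  show "AE x in M. norm (h x * B x) \<le> norm (of_real C * h x)"
  proof (rule AE_I2)
    fix x
    have "norm (B x) \<le> \<bar>C\<bar>" using assms(3)[of x] by linarith
    thus "norm (h x * B x) \<le> norm (of_real C * h x)"
      using mult_left_mono[of "norm (B x)" "\<bar>C\<bar>" "norm (h x)"] by (simp add: norm_mult mult.commute)
  qed
qed

lemma has_vector_derivative_at_iff_quotient:
  fixes f :: "real \<Rightarrow> 'a::real_normed_vector"
  shows "(f has_vector_derivative D) (at a) \<longleftrightarrow> ((\<lambda>t. (f t - f a) /\<^sub>R (t - a)) \<longlongrightarrow> D) (at a)"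
proof -
  have "(f has_vector_derivative D) (at a) \<longleftrightarrow> ((\<lambda>t. norm (f t - f a - (t - a) *\<^sub>R D) / norm (t - a)) \<longlongrightarrow> 0) (at a)"
    unfolding has_vector_derivative_def has_derivative_iff_norm by (simp add: bounded_linear_scaleR_left)
  also have "\<dots> \<longleftrightarrow> ((\<lambda>t. norm ((f t - f a) /\<^sub>R (t - a) - D)) \<longlongrightarrow> 0) (at a)"
  proof (rule filterlim_cong[OF refl refl])
    show "\<forall>\<^sub>F t in at a. norm (f t - f a - (t - a) *\<^sub>R D) / norm (t - a) = norm ((f t - f a) /\<^sub>R (t - a) - D)"
      unfolding eventually_at_filter
    proof (rule always_eventually, intro allI impI)
      fix t assume "t \<noteq> a"
      hence "(f t - f a) /\<^sub>R (t - a) - D = (f t - f a - (t - a) *\<^sub>R D) /\<^sub>R (t - a)"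
        by (simp add: scaleR_diff_right)
      thus "norm (f t - f a - (t - a) *\<^sub>R D) / norm (t - a) = norm ((f t - f a) /\<^sub>R (t - a) - D)"
        by (simp add: divide_inverse mult.commute)
    qed
  qed
  also have "\<dots> \<longleftrightarrow> ((\<lambda>t. (f t - f a) /\<^sub>R (t - a)) \<longlongrightarrow> D) (at a)"
    by (simp add: tendsto_norm_zero_iff LIM_zero_iff)
  finally show ?thesis .
qed

text \<open>Dominated convergence along sequences: by the mean value inequality the bound
  \<open>g\<close> on the derivatives also dominates the difference quotients.\<close>

lemma has_vector_derivative_integral:
  fixes f f' :: "real \<Rightarrow> 'a \<Rightarrow> complex"
  assumes \<delta>: "\<delta> > 0"
    and der: "\<And>t x. \<bar>t\<bar> < \<delta> \<Longrightarrow> ((\<lambda>t. f t x) has_vector_derivative f' t x) (at t)"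
    and bound: "\<And>t x. \<bar>t\<bar> < \<delta> \<Longrightarrow> norm (f' t x) \<le> g x"
    and g: "integrable M g" and f: "\<And>t. integrable M (f t)" and f': "f' 0 \<in> borel_measurable M"
  shows "((\<lambda>t. integral\<^sup>L M (f t)) has_vector_derivative integral\<^sup>L M (f' 0)) (at 0)"
proof -
  have lip: "norm (f t x - f 0 x) \<le> g x * \<bar>t\<bar>" if t: "\<bar>t\<bar> < \<delta>" for t x
  proof -
    have "norm (f t x - f 0 x) \<le> g x * norm (t - 0)"
    proof (rule differentiable_bound[where f = "\<lambda>t. f t x" and S = "{-\<delta><..<\<delta>}" and f' = "\<lambda>t h. h *\<^sub>R f' t x"])
      fix s assume s: "s \<in> {-\<delta><..<\<delta>}"
      show "((\<lambda>t. f t x) has_derivative (\<lambda>h. h *\<^sub>R f' s x)) (at s within {-\<delta><..<\<delta>})"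
        using der[of s x] s by (auto simp: has_vector_derivative_def abs_less_iff intro: has_derivative_at_withinI)
      show "onorm (\<lambda>h. h *\<^sub>R f' s x) \<le> g x"
      proof (rule onorm_le)
        fix h :: real
        show "norm (h *\<^sub>R f' s x) \<le> g x * norm h"
          using mult_right_mono[OF bound[of s x], of "\<bar>h\<bar>"] s by (simp add: abs_less_iff mult.commute)
      qed
    qed (use t \<delta> in \<open>auto simp: abs_less_iff\<close>)
    thus ?thesis by simp
  qed
  have der0: "((\<lambda>t. (f t x - f 0 x) /\<^sub>R t) \<longlongrightarrow> f' 0 x) (at 0)" for x
    using der[of 0 x] \<delta> by (simp add: has_vector_derivative_at_iff_quotient)
  have "((\<lambda>t. (integral\<^sup>L M (f t) - integral\<^sup>L M (f 0)) /\<^sub>R t) \<longlongrightarrow> integral\<^sup>L M (f' 0)) (at 0)"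
    unfolding tendsto_at_iff_sequentially comp_def
  proof (intro allI impI)
    fix X :: "nat \<Rightarrow> real" assume X: "\<forall>i. X i \<in> UNIV - {0}" "X \<longlonglongrightarrow> 0"
    from X(2) \<delta> have "eventually (\<lambda>n. \<bar>X n\<bar> < \<delta>) sequentially"
      by (auto dest!: tendstoD[of _ _ _ \<delta>])
    then obtain N where N: "\<And>n. n \<ge> N \<Longrightarrow> \<bar>X n\<bar> < \<delta>" by (auto simp: eventually_sequentially)
    have "(\<lambda>n. (LINT x | M. (f (X (n + N)) x - f 0 x) /\<^sub>R X (n + N))) \<longlonglongrightarrow> integral\<^sup>L M (f' 0)"
    proof (rule integral_dominated_convergence[where w = g])
      show "AE x in M. norm ((f (X (n + N)) x - f 0 x) /\<^sub>R X (n + N)) \<le> g x" for n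
      proof (rule AE_I2)
        fix x
        have "X (n + N) \<noteq> 0" using X(1) by auto
        thus "norm ((f (X (n + N)) x - f 0 x) /\<^sub>R X (n + N)) \<le> g x"
          using lip[OF N[of "n + N"], of x] by (simp add: divide_simps mult.commute)
      qed
      show "AE x in M. (\<lambda>n. (f (X (n + N)) x - f 0 x) /\<^sub>R X (n + N)) \<longlonglongrightarrow> f' 0 x"
      proof (rule AE_I2)
        fix x
        have "(\<lambda>n. (f (X n) x - f 0 x) /\<^sub>R X n) \<longlonglongrightarrow> f' 0 x"
          using der0[of x] X unfolding tendsto_at_iff_sequentially comp_def by blast
        thus "(\<lambda>n. (f (X (n + N)) x - f 0 x) /\<^sub>R X (n + N)) \<longlonglongrightarrow> f' 0 x"
          by (rule LIMSEQ_ignore_initial_segment)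
      qed
    qed (use f f' g in auto)
    moreover have "(LINT x | M. (f (X (n + N)) x - f 0 x) /\<^sub>R X (n + N)) = (integral\<^sup>L M (f (X (n + N))) - integral\<^sup>L M (f 0)) /\<^sub>R X (n + N)" for n
      using f by simp
    ultimately have "(\<lambda>n. (integral\<^sup>L M (f (X (n + N))) - integral\<^sup>L M (f 0)) /\<^sub>R X (n + N)) \<longlonglongrightarrow> integral\<^sup>L M (f' 0)" by (simp only:)
    thus "(\<lambda>n. (integral\<^sup>L M (f (X n)) - integral\<^sup>L M (f 0)) /\<^sub>R X n) \<longlonglongrightarrow> integral\<^sup>L M (f' 0)"
      by (rule LIMSEQ_offset)
  qed
  thus ?thesis by (simp add: has_vector_derivative_at_iff_quotient)
qed

lemma gaussw_minus [simp]: "gaussw (- x) = gaussw x"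
  by (simp add: gaussw_def)

text \<open>The characteristic function of the normal law, taken in each coordinate, writes the
  Gaussian as a superposition of characters with an integrable density.\<close>

lemma gaussw_fourier:
  defines "\<Phi> \<equiv> (\<lambda>u :: real^'n::finite. \<Prod>i\<in>UNIV. complex_of_real (std_normal_density (u $ i)))"
  shows "integrable lborel \<Phi>"
    and "complex_of_real (gaussw v) = (LINT u | lborel. \<Phi> u * exp (\<i> * of_real (u \<bullet> v)))"
proof -
  have i1: "integrable lborel (\<lambda>t. complex_of_real (std_normal_density t))" by simp
  show "integrable lborel \<Phi>" unfolding \<Phi>_def by (rule product_integral_vec(1)[OF i1])
  have i2: "integrable lborel (\<lambda>t. complex_of_real (std_normal_density t) * exp (\<i> * of_real (t * r)))" for r
    by (rule integrable_mult_bounded[OF i1, where C = 1]) auto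
  have c: "(LINT t | lborel. complex_of_real (std_normal_density t) * exp (\<i> * of_real (t * r))) = of_real (exp (- r\<^sup>2 / 2))" for r
  proof -
    have "char std_normal_distribution r = of_real (exp (- r\<^sup>2 / 2))"
      using char_std_normal_distribution by (simp add: fun_eq_iff)
    moreover have "char std_normal_distribution r = (LINT t | lborel. std_normal_density t *\<^sub>R iexp (r * t))"
      unfolding char_def by (subst integral_density) auto
    ultimately show ?thesis by (simp add: scaleR_conv_of_real mult_ac)
  qed
  have "(LINT u | lborel. \<Phi> u * exp (\<i> * of_real (u \<bullet> v))) =
     (LINT u | lborel. (\<Prod>i\<in>UNIV. complex_of_real (std_normal_density (u $ i)) * exp (\<i> * of_real (u $ i * v $ i))))"
    by (simp add: \<Phi>_def inner_vec_def prod.distrib exp_sum[symmetric] sum_distrib_left)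
  also have "\<dots> = (\<Prod>i\<in>UNIV. LINT t | lborel. complex_of_real (std_normal_density t) * exp (\<i> * of_real (t * v $ i)))"
    by (rule product_integral_vec(2)[OF i2])
  also have "\<dots> = (\<Prod>i\<in>UNIV. of_real (exp (- (v $ i)\<^sup>2 / 2)))"
    by (simp only: c)
  also have "\<dots> = complex_of_real (gaussw v)"
    unfolding gaussw_def norm2_vec of_real_prod[symmetric] exp_sum[OF finite, symmetric] by (simp add: sum_negf sum_divide_distrib)
  finally show "complex_of_real (gaussw v) = (LINT u | lborel. \<Phi> u * exp (\<i> * of_real (u \<bullet> v)))" ..
qed

lemma integral_affine_vec:
  fixes f :: "real^'n::finite \<Rightarrow> complex"
  assumes [measurable]: "f \<in> borel_measurable borel" and "\<sigma> > 0"
  shows "integral\<^sup>L lborel f = of_real (\<sigma> ^ CARD('n)) * (LINT z | lborel. f (x + \<sigma> *\<^sub>R z))"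
proof -
  have "integral\<^sup>L lborel f = integral\<^sup>L (density (distr lborel borel (\<lambda>z. x + \<sigma> *\<^sub>R z)) (\<lambda>_. ennreal (\<sigma> ^ CARD('n)))) f"
    using lborel_affine[of \<sigma> x] assms(2) by simp
  also have "\<dots> = (LINT z | distr lborel borel (\<lambda>z. x + \<sigma> *\<^sub>R z). (\<sigma> ^ CARD('n)) *\<^sub>R f z)"
    by (subst integral_density) (use assms(2) in auto)
  also have "\<dots> = (LINT z | lborel. (\<sigma> ^ CARD('n)) *\<^sub>R f (x + \<sigma> *\<^sub>R z))"
    by (subst integral_distr) auto
  finally show ?thesis by (simp add: scaleR_conv_of_real)
qed

text \<open>Gaussians are superpositions of characters, so H integrates to 0 against every
  translated and scaled Gaussian. Averaging the centres over a box and shrinking the width yields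
  the indicator of the box in the limit, and boxes generate the Borel sets.\<close>

lemma fourier_unique_AE:
  fixes H :: "real^'n::finite \<Rightarrow> complex"
  assumes H: "integrable lborel H" and F: "\<And>\<xi>. (LINT x | lborel. H x * exp (\<i> * of_real (\<xi> \<bullet> x))) = 0"
  shows "AE x in lborel. H x = 0"
proof -
  have [measurable]: "H \<in> borel_measurable borel" using H by auto
  have gauss_int: "integrable lborel (\<lambda>z :: real^'n. complex_of_real (gaussw z))"
    using integrable_gauss[of "\<lambda>_::real^'n. 1::complex"] by (simp add: expbdd_bounded[of _ 1] scaleR_conv_of_real)
  have conv0: "(LINT x | lborel. H x * of_real (gaussw ((x - a) /\<^sub>R \<sigma>))) = 0" for a \<sigma>
  proof -
    define \<Phi> where "\<Phi> = (\<lambda>u :: real^'n. \<Prod>i\<in>UNIV. complex_of_real (std_normal_density (u $ i)))"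
    have G: "integrable lborel \<Phi>" "complex_of_real (gaussw v) = (LINT u | lborel. \<Phi> u * exp (\<i> * of_real (u \<bullet> v)))" for v
      unfolding \<Phi>_def by (rule gaussw_fourier)+
    \<comment> \<open>Translating and scaling the argument only multiplies the Fourier integral by a
      phase and changes the frequency.\<close>
    have z: "(LINT x | lborel. H x * (\<lambda>(x, u). exp (\<i> * of_real (u \<bullet> ((x - a) /\<^sub>R \<sigma>)))) (x, u)) = 0" for u
    proof -
      have "(LINT x | lborel. H x * (\<lambda>(x, u). exp (\<i> * of_real (u \<bullet> ((x - a) /\<^sub>R \<sigma>)))) (x, u))
         = (LINT x | lborel. exp (- \<i> * of_real (u \<bullet> (a /\<^sub>R \<sigma>))) * (H x * exp (\<i> * of_real ((u /\<^sub>R \<sigma>) \<bullet> x))))"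
        by (intro arg_cong[where f = "integral\<^sup>L lborel"] ext)
           (simp add: inner_diff_right right_diff_distrib exp_diff exp_minus field_simps)
      thus ?thesis using F[of "u /\<^sub>R \<sigma>"] by simp
    qed
    have "(LINT x | lborel. H x * of_real (gaussw ((x - a) /\<^sub>R \<sigma>))) =
      (LINT x | lborel. H x * (LINT u | lborel. \<Phi> u * (\<lambda>(x, u). exp (\<i> * of_real (u \<bullet> ((x - a) /\<^sub>R \<sigma>)))) (x, u)))"
      unfolding G(2) by simp
    also have "\<dots> = (LINT u | lborel. \<Phi> u * (LINT x | lborel. H x * (\<lambda>(x, u). exp (\<i> * of_real (u \<bullet> ((x - a) /\<^sub>R \<sigma>)))) (x, u)))"
    proof (rule fubini_bounded[OF H G(1), where C = 1])
      show "(\<lambda>(x, u). exp (\<i> * of_real (u \<bullet> ((x - a) /\<^sub>R \<sigma>)))) \<in> borel_measurable borel"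
        unfolding case_prod_unfold by (intro borel_measurable_continuous_onI continuous_intros)
    qed (auto simp: case_prod_unfold)
    also have "\<dots> = 0" unfolding z by simp
    finally show ?thesis .
  qed
  have box0: "(LINT x | lborel. indicator (box l u) x *\<^sub>R H x) = 0" for l u
  proof -
    have ind_int: "integrable lborel (\<lambda>a :: real^'n. indicator (box l u) a :: complex)"
    proof -
      have "integrable lborel (\<lambda>a :: real^'n. complex_of_real (indicator (box l u) a))"
        by (intro integrable_of_real integrable_real_indicator) (simp, rule emeasure_lborel_box_finite)
      moreover have "(\<lambda>a :: real^'n. complex_of_real (indicator (box l u) a)) = indicator (box l u)"
        by (simp add: fun_eq_iff indicator_def)
      ultimately show ?thesis by simp
    qed
    \<comment> \<open>Up to a power of the width, this is the indicator of the box convolved with a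
      Gaussian of width 1/(n + 1). The rescaled variable keeps the Gaussian fixed, so that it serves
      as the dominating function in the limit.\<close>
    define M where "M n x = (LINT z | lborel. complex_of_real (gaussw z) * indicator (box l u) (x + (1 / real (Suc n)) *\<^sub>R z))" for n x
    have HM: "(LINT x | lborel. H x * M n x) = 0" for n
    proof -
      define \<sigma> where "\<sigma> = 1 / real (Suc n)"
      have \<sigma>: "\<sigma> > 0" by (simp add: \<sigma>_def)
      have "0 = (LINT a | lborel. indicator (box l u) a * (LINT x | lborel. H x * of_real (gaussw ((x - a) /\<^sub>R \<sigma>))))"
        by (simp add: conv0)
      also have "\<dots> = (LINT x | lborel. H x * (LINT a | lborel. indicator (box l u) a * (\<lambda>(a, x). of_real (gaussw ((x - a) /\<^sub>R \<sigma>))) (a, x)))"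
        unfolding case_prod_conv
      proof (rule fubini_bounded[where B = "\<lambda>(a, x). of_real (gaussw ((x - a) /\<^sub>R \<sigma>))" and C = 1, OF ind_int H, unfolded case_prod_conv])
        show "(\<lambda>(a, x). complex_of_real (gaussw ((x - a) /\<^sub>R \<sigma>))) \<in> borel_measurable borel"
          unfolding case_prod_unfold gaussw_def by (intro borel_measurable_continuous_onI continuous_intros) auto
      qed (auto simp: case_prod_unfold gaussw_def)
      also have "\<dots> = (LINT x | lborel. of_real (\<sigma> ^ CARD('n)) * (H x * M n x))"
      proof (intro arg_cong[where f = "integral\<^sup>L lborel"] ext)
        fix x :: "real^'n"
        have [measurable]: "(\<lambda>a. complex_of_real (gaussw ((x - a) /\<^sub>R \<sigma>))) \<in> borel_measurable borel"
          unfolding gaussw_def by (intro borel_measurable_continuous_onI continuous_intros) auto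
        have "(LINT a | lborel. indicator (box l u) a * complex_of_real (gaussw ((x - a) /\<^sub>R \<sigma>))) =
           of_real (\<sigma> ^ CARD('n)) * (LINT z | lborel. indicator (box l u) (x + \<sigma> *\<^sub>R z) * complex_of_real (gaussw ((x - (x + \<sigma> *\<^sub>R z)) /\<^sub>R \<sigma>)))"
          by (rule integral_affine_vec[OF _ \<sigma>]) measurable
        also have "(\<lambda>z. indicator (box l u) (x + \<sigma> *\<^sub>R z) * complex_of_real (gaussw ((x - (x + \<sigma> *\<^sub>R z)) /\<^sub>R \<sigma>)))
          = (\<lambda>z. complex_of_real (gaussw z) * indicator (box l u) (x + \<sigma> *\<^sub>R z))"
          using \<sigma> by (auto simp: mult.commute)
        finally show "H x * (LINT a | lborel. indicator (box l u) a * (\<lambda>(a, x). complex_of_real (gaussw ((x - a) /\<^sub>R \<sigma>))) (a, x))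
          = of_real (\<sigma> ^ CARD('n)) * (H x * M n x)"
          by (simp add: M_def \<sigma>_def mult_ac)
      qed
      also have "\<dots> = of_real (\<sigma> ^ CARD('n)) * (LINT x | lborel. H x * M n x)" by simp
      finally show ?thesis using \<sigma> by simp
    qed
    define g0 where "g0 = (LINT z | lborel. gaussw (z :: real^'n))"
    have g_int: "integrable lborel (\<lambda>z :: real^'n. gaussw z)" using integrable_gauss_exp[of 0] by simp
    have g0: "g0 > 0"
    proof -
      have "g0 \<noteq> 0"
      proof
        assume "g0 = 0"
        hence "AE z in lborel. gaussw (z :: real^'n) = 0"
          using integral_nonneg_eq_0_iff_AE[OF g_int] by (auto simp: g0_def less_imp_le)
        hence "AE z in (lborel :: (real^'n) measure). False" by eventually_elim (simp add: gaussw_def)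
        thus False by (simp add: eventually_False ae_filter_eq_bot_iff)
      qed
      moreover have "g0 \<ge> 0" unfolding g0_def by (intro integral_nonneg_AE) (auto simp: less_imp_le)
      ultimately show ?thesis by simp
    qed
    have ind_meas [measurable]: "(\<lambda>z :: (real^'n) \<times> (real^'n). indicator (box l u) (fst z + \<sigma> *\<^sub>R snd z) :: complex) \<in> borel_measurable borel" for \<sigma>
    proof -
      have "(\<lambda>z :: (real^'n) \<times> (real^'n). fst z + \<sigma> *\<^sub>R snd z) \<in> borel_measurable borel"
        by (intro borel_measurable_continuous_onI continuous_intros)
      thus ?thesis by (rule measurable_compose) measurable
    qed
    have M_bound: "norm (M n x) \<le> g0" for n x
    proof -
      have "norm (M n x) \<le> (LINT z | lborel. norm (complex_of_real (gaussw z) * indicator (box l u) (x + (1 / real (Suc n)) *\<^sub>R z)))"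
        unfolding M_def by (rule integral_norm_bound)
      also have "\<dots> \<le> g0" unfolding g0_def
        by (rule integral_mono_AE') (use g_int in \<open>auto simp: norm_mult indicator_def less_imp_le\<close>)
      finally show ?thesis .
    qed
    have M_meas [measurable]: "M n \<in> borel_measurable borel" for n
    proof -
      have "(\<lambda>(x, z). complex_of_real (gaussw z) * indicator (box l u) (x + (1 / real (Suc n)) *\<^sub>R z)) \<in> borel_measurable (borel \<Otimes>\<^sub>M lborel)"
        
      proof -
        have "(\<lambda>z :: (real^'n) \<times> (real^'n). complex_of_real (gaussw (snd z)) * indicator (box l u) (fst z + (1 / real (Suc n)) *\<^sub>R snd z)) \<in> borel_measurable borel"
          by (intro borel_measurable_times ind_meas borel_measurable_continuous_onI) (auto simp: gaussw_def intro!: continuous_intros)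
        moreover have "sets (borel \<Otimes>\<^sub>M lborel) = sets (borel :: ((real^'n) \<times> (real^'n)) measure)"
          by (simp add: borel_prod[symmetric] cong: sets_pair_measure_cong)
        ultimately show ?thesis by (simp add: case_prod_unfold cong: measurable_cong_sets)
      qed
      thus ?thesis unfolding M_def by (rule lborel.borel_measurable_lebesgue_integral)
    qed
    \<comment> \<open>Convergence can fail only on the frontier of the box, which is a null set
      because the box is convex.\<close>
    have lim: "(\<lambda>n. M n x) \<longlonglongrightarrow> (LINT z | lborel. complex_of_real (gaussw (z :: real^'n)) * indicator (box l u) x)" if x: "x \<notin> frontier (box l u)" for x
      unfolding M_def
    proof (rule integral_dominated_convergence[where w = "\<lambda>z :: real^'n. gaussw z"])
      show "AE z in lborel. (\<lambda>n. complex_of_real (gaussw z) * indicator (box l u) (x + (1 / real (Suc n)) *\<^sub>R z)) \<longlonglongrightarrow> complex_of_real (gaussw z) * indicator (box l u) x"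
      proof (rule AE_I2)
        fix z :: "real^'n"
        have l: "(\<lambda>n. x + (1 / real (Suc n)) *\<^sub>R z) \<longlonglongrightarrow> x + 0 *\<^sub>R z"
          by (intro tendsto_intros LIMSEQ_Suc[OF lim_1_over_n])
        have "eventually (\<lambda>n. indicator (box l u) (x + (1 / real (Suc n)) *\<^sub>R z) = (indicator (box l u) x :: complex)) sequentially"
        proof (cases "x \<in> box l u")
          case True
          thus ?thesis using topological_tendstoD[OF l open_box, of l u] by (auto elim!: eventually_mono)
        next
          case False
          hence "x \<notin> closure (box l u)" using x by (auto simp: frontier_def interior_open[OF open_box])
          hence "eventually (\<lambda>n. x + (1 / real (Suc n)) *\<^sub>R z \<in> - closure (box l u)) sequentially"
            using topological_tendstoD[OF l, of "- closure (box l u)"] by auto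
          thus ?thesis by (rule eventually_mono) (use False closure_subset[of "box l u"] in \<open>auto simp: indicator_def\<close>)
        qed
        hence "(\<lambda>n. indicator (box l u) (x + (1 / real (Suc n)) *\<^sub>R z)) \<longlonglongrightarrow> (indicator (box l u) x :: complex)"
          by (rule tendsto_eventually)
        thus "(\<lambda>n. complex_of_real (gaussw z) * indicator (box l u) (x + (1 / real (Suc n)) *\<^sub>R z)) \<longlonglongrightarrow> complex_of_real (gaussw z) * indicator (box l u) x"
          by (intro tendsto_intros)
      qed
      show "AE z in lborel. norm (complex_of_real (gaussw z) * indicator (box l u) (x + (1 / real (Suc n)) *\<^sub>R z)) \<le> gaussw z" for n
        by (intro AE_I2) (auto simp: norm_mult indicator_def less_imp_le)
    qed (use g_int in auto)
    have "(\<lambda>n. (LINT x | lborel. H x * M n x)) \<longlonglongrightarrow> (LINT x | lborel. H x * (of_real g0 * indicator (box l u) x))"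
    proof (rule integral_dominated_convergence[where w = "\<lambda>x. norm (H x) * g0"])
      show "AE x in lborel. (\<lambda>n. H x * M n x) \<longlonglongrightarrow> H x * (of_real g0 * indicator (box l u) x)"
      proof -
        have "frontier (box l u) \<in> null_sets lborel"
        proof -
          have "negligible (frontier (box l u))" by (rule negligible_convex_frontier) (rule convex_box)
          moreover have "frontier (box l u) \<in> sets borel" by (simp add: frontier_closed borel_closed)
          ultimately show ?thesis by (simp add: negligible_iff_null_sets null_sets_completion_iff)
        qed
        hence "AE x in lborel. x \<notin> frontier (box l u)" by (rule AE_not_in)
        thus ?thesis
        proof eventually_elim
          fix x assume "x \<notin> frontier (box l u)"
          from lim[OF this] have "(\<lambda>n. M n x) \<longlonglongrightarrow> of_real g0 * indicator (box l u) x" by (simp add: g0_def)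
          thus "(\<lambda>n. H x * M n x) \<longlonglongrightarrow> H x * (of_real g0 * indicator (box l u) x)" by (intro tendsto_intros)
        qed
      qed
      show "AE x in lborel. norm (H x * M n x) \<le> norm (H x) * g0" for n
        by (intro AE_I2) (simp add: norm_mult mult_left_mono M_bound)
    qed (use H in auto)
    hence "(LINT x | lborel. H x * (of_real g0 * indicator (box l u) x)) = 0"
      unfolding HM by (simp add: LIMSEQ_const_iff)
    moreover have "(LINT x | lborel. H x * (of_real g0 * indicator (box l u) x)) = of_real g0 * (LINT x | lborel. indicator (box l u) x *\<^sub>R H x)"
      by (subst integral_mult_right_zero[symmetric], intro arg_cong[where f = "integral\<^sup>L lborel"] ext) (simp add: indicator_def)
    ultimately show ?thesis using g0 by simp
  qed
  \<comment> \<open>Boxes are stable under intersection, so closure under complements and disjoint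
    unions is enough; the complement uses the hypothesis at frequency 0.\<close>
  have Borel0: "(LINT x | lborel. indicator A x *\<^sub>R H x) = 0" if "A \<in> sets lborel" for A
  proof -
    have "Int_stable (range (\<lambda>(a, b). box a b :: (real^'n) set))"
      by (auto simp: Int_stable_def box_Int_box)
    moreover have "range (\<lambda>(a, b). box a b :: (real^'n) set) \<subseteq> Pow UNIV" by simp
    moreover have "A \<in> sigma_sets UNIV (range (\<lambda>(a, b). box a b :: (real^'n) set))"
      using that by (simp add: borel_eq_box)
    ultimately show ?thesis
    proof (induction rule: sigma_sets_induct_disjoint)
      case (basic A) thus ?case using box0 by auto
    next
      case (compl A)
      hence [measurable]: "A \<in> sets borel" by (simp add: borel_eq_box)
      have "(LINT x | lborel. indicator (UNIV - A) x *\<^sub>R H x) = (LINT x | lborel. H x - indicator A x *\<^sub>R H x)"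
        by (intro arg_cong[where f = "integral\<^sup>L lborel"] ext) (simp add: indicator_def)
      also have "\<dots> = 0" using compl H F[of 0] by (simp add: integrable_mult_indicator)
      finally show ?case .
    next
      case (union A)
      hence [measurable]: "A i \<in> sets borel" for i by (auto simp: borel_eq_box)
      have "(LINT x : (\<Union>i. A i) | lborel. H x) = (\<Sum>i. (LINT x : A i | lborel. H x))"
      proof (rule lebesgue_integral_countable_add)
        show "set_integrable lborel (\<Union>i. A i) H" unfolding set_integrable_def using H by (intro integrable_mult_indicator) auto
      qed (use union in \<open>auto simp: disjoint_family_on_def\<close>)
      thus ?case using union by (simp add: set_lebesgue_integral_def)
    qed simp
  qed
  show ?thesis
    by (rule sigma_finite_measure.density_zero[OF sigma_finite_lborel H]) (use Borel0 in \<open>simp add: set_lebesgue_integral_def\<close>)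
qed

section \<open>The Dunkl transform\<close>

lemma exp_partial_sum_le:
  fixes r :: real
  assumes "r \<ge> 0"
  shows "(\<Sum>m<n. r ^ m / fact m) \<le> exp r"
proof -
  have s: "(\<lambda>m. r ^ m / fact m) sums exp r"
    using exp_converges[of r] by (simp add: field_simps)
  show ?thesis
    using sum_le_suminf[OF sums_summable[OF s], of "{..<n}"] sums_unique[OF s] assms by simp
qed

context dunkl
begin

text \<open>The weight is carried by the argument \<open>h\<close> instead of the integral. The
  kernel is E(x, iy) with a plus sign; transform and inverse differ by a reflection of the
  variable.\<close>

definition dunkl_transform :: "(real^'n::finite \<Rightarrow> complex) \<Rightarrow> real^'n \<Rightarrow> complex" where
  "dunkl_transform h y = (LINT x | lborel. h x * K x y)"

lemma K_bounded_ex: "\<exists>C\<ge>0. \<forall>x y. norm (K x (y :: real^'n::finite)) \<le> C"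
  using K_bounded by (intro exI[of _ "sqrt (real (CARD('n \<Rightarrow> 'n)))"]) auto

lemma continuous_dunkl_transform:
  fixes h :: "real^'n::finite \<Rightarrow> complex"
  assumes h: "integrable lborel h"
  shows "continuous_on UNIV (dunkl_transform h)"
proof (subst continuous_on_eq_continuous_at; (intro ballI)?)
  fix y :: "real^'n"
  obtain C where C: "C \<ge> 0" "\<And>x y. norm (K x (y :: real^'n)) \<le> C" using K_bounded_ex by blast
  have [measurable]: "h \<in> borel_measurable borel" using h by auto
  show "isCont (dunkl_transform h) y"
  proof (rule continuous_at_sequentiallyI)
    fix u assume u: "u \<longlonglongrightarrow> y"
    show "(\<lambda>n. dunkl_transform h (u n)) \<longlonglongrightarrow> dunkl_transform h y"
      unfolding dunkl_transform_def
    proof (rule integral_dominated_convergence[where w = "\<lambda>x. norm (h x) * C"])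
      show "AE x in lborel. (\<lambda>n. h x * K x (u n)) \<longlonglongrightarrow> h x * K x y"
      proof (rule AE_I2)
        fix x :: "real^'n"
        have "isCont (\<lambda>y. K x y) y"
          using continuous_on_K[of UNIV "\<lambda>_. x" "\<lambda>y. y"] by (simp add: continuous_on_eq_continuous_at)
        hence "(\<lambda>n. K x (u n)) \<longlonglongrightarrow> K x y" using u by (rule isCont_tendsto_compose)
        thus "(\<lambda>n. h x * K x (u n)) \<longlonglongrightarrow> h x * K x y" by (intro tendsto_intros)
      qed
      show "AE x in lborel. norm (h x * K x (u n)) \<le> norm (h x) * C" for n
        using C by (intro AE_I2) (simp add: norm_mult mult_left_mono)
    qed (use h in auto)
  qed
qed simp

text \<open>By \<open>e_bound\<close> the partial sums of the kernel are dominated by exp(Y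
  \<open>l1norm x\<close>), which is integrable against the Gaussian weight. Statements about
  transforms thus become statements about \<open>Lam\<close> in each degree.\<close>

lemma Lam_K_sums:
  fixes p :: "real^'n::finite \<Rightarrow> complex"
  assumes p: "cpoly p"
  shows "(\<lambda>m. \<i> ^ m * Lam (\<lambda>x. p x * of_real (e m x y))) sums dunkl_transform (\<lambda>x. p x * of_real (wt x)) y"
  unfolding sums_def
proof -
  define Y where "Y = (\<Sum>i\<in>UNIV. \<bar>y $ i\<bar>)"
  have Y0: "Y \<ge> 0" by (simp add: Y_def sum_nonneg)
  note [measurable] = cpoly_measurable[OF p]
  have "(\<lambda>n. LINT x | lborel. (\<Sum>m<n. \<i> ^ m * (p x * of_real (e m x y) * of_real (wt x)))) \<longlonglongrightarrow> dunkl_transform (\<lambda>x. p x * of_real (wt x)) y"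
    unfolding dunkl_transform_def
  proof (rule integral_dominated_convergence[where w = "\<lambda>x. norm (p x) * exp (Y * l1norm x) * wt x"])
    have "integrable lborel (\<lambda>x. gaussw x *\<^sub>R (norm (p x) * exp (Y * l1norm x) * omega k x))"
    proof (rule integrable_gauss)
      have "expbdd (\<lambda>x :: real^'n. exp (Y * l1norm x))" by (rule expbddI[of 1 Y]) (use Y0 in auto)
      thus "expbdd (\<lambda>x. norm (p x) * exp (Y * l1norm x) * omega k x)"
        by (intro expbdd_mult expbdd_omega expbdd_norm cpoly_expbdd p)
    qed measurable
    thus "integrable lborel (\<lambda>x. norm (p x) * exp (Y * l1norm x) * wt x)" by (simp add: wt_def mult_ac)
    show "AE x in lborel. norm (\<Sum>m<n. \<i> ^ m * (p x * of_real (e m x y) * of_real (wt x))) \<le> norm (p x) * exp (Y * l1norm x) * wt x" for n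
    proof (rule AE_I2)
      fix x :: "real^'n"
      have "norm (\<Sum>m<n. \<i> ^ m * (p x * of_real (e m x y) * of_real (wt x))) \<le> (\<Sum>m<n. norm (p x) * wt x * ((Y * l1norm x) ^ m / fact m))"
      proof (rule sum_norm_le)
        fix m
        have "\<bar>e m x y\<bar> \<le> (l1norm x * Y) ^ m / fact m"
          unfolding Y_def by (rule e_bound) (rule nth_le_l1norm)
        hence "norm (p x) * wt x * \<bar>e m x y\<bar> \<le> norm (p x) * wt x * ((Y * l1norm x) ^ m / fact m)"
          by (intro mult_left_mono) (auto simp: wt_nonneg mult.commute)
        thus "norm (\<i> ^ m * (p x * of_real (e m x y) * of_real (wt x))) \<le> norm (p x) * wt x * ((Y * l1norm x) ^ m / fact m)"
          by (simp add: norm_mult norm_power wt_nonneg mult_ac)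
      qed
      also have "\<dots> = norm (p x) * wt x * (\<Sum>m<n. (Y * l1norm x) ^ m / fact m)" by (simp add: sum_distrib_left)
      also have "\<dots> \<le> norm (p x) * wt x * exp (Y * l1norm x)"
      proof (rule mult_left_mono)
        show "(\<Sum>m<n. (Y * l1norm x) ^ m / fact m) \<le> exp (Y * l1norm x)"
          using Y0 by (intro exp_partial_sum_le) simp
      qed (simp add: wt_nonneg)
      finally show "norm (\<Sum>m<n. \<i> ^ m * (p x * of_real (e m x y) * of_real (wt x))) \<le> norm (p x) * exp (Y * l1norm x) * wt x"
        by (simp add: mult_ac)
    qed
    show "AE x in lborel. (\<lambda>n. \<Sum>m<n. \<i> ^ m * (p x * of_real (e m x y) * of_real (wt x))) \<longlonglongrightarrow> p x * of_real (wt x) * K x y"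
    proof (rule AE_I2)
      fix x :: "real^'n"
      from sums_mult[OF K_sums[of x y], of "p x * of_real (wt x)"]
      show "(\<lambda>n. \<Sum>m<n. \<i> ^ m * (p x * of_real (e m x y) * of_real (wt x))) \<longlonglongrightarrow> p x * of_real (wt x) * K x y"
        by (simp add: sums_def mult_ac)
    qed
  qed measurable
  moreover have "(LINT x | lborel. (\<Sum>m<n. \<i> ^ m * (p x * of_real (e m x y) * of_real (wt x)))) = (\<Sum>m<n. \<i> ^ m * Lam (\<lambda>x. p x * of_real (e m x y)))" for n
  proof -
    have "integrable lborel (\<lambda>x. p x * of_real (e m x y) * of_real (wt x))" for m
      by (rule integrable_wt_cpoly) (intro cpoly_mult p cpoly_e)
    thus ?thesis by (simp add: Lam_def)
  qed
  ultimately show "(\<lambda>n. \<Sum>m<n. \<i> ^ m * Lam (\<lambda>x. p x * of_real (e m x y))) \<longlonglongrightarrow> dunkl_transform (\<lambda>x. p x * of_real (wt x)) y"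
    by simp
qed

section \<open>Transforms of polynomials times the Gaussian\<close>

abbreviation cc :: "'n::finite itself \<Rightarrow> complex" where "cc \<equiv> \<lambda>t. of_real (c_const k t)"

lemma Lam_one: "Lam (\<lambda>_::real^'n::finite. 1) = cc TYPE('n)"
  unfolding Lam_def c_const_def wt_def gaussw_def mult_1_left integral_complex_of_real ..

text \<open>\<open>Lam\<close> is applied to the recursion: invariance of the weight kills the
  reflection differences, and \<open>Lam_dunkl_op\<close> converts each factor x_j into T_j.\<close>

lemma Lam_e_rec: "of_nat (Suc m) * Lam (\<lambda>x. of_real (e (Suc m) x y)) = (\<Sum>j\<in>UNIV. of_real (y $ j) * Lam (T j (\<lambda>x. of_real (e m x y))))"
  for y :: "real^'n::finite"
proof -
  let ?E = "\<lambda>m x. complex_of_real (e m x y)"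
  have L: "of_nat (Suc m) * ?E (Suc m) x + of_real (k / 2) * (\<Sum>a\<in>UNIV. \<Sum>b\<in>UNIV. ?E (Suc m) x - ?E (Suc m) (swapv a b x)) = (\<Sum>j\<in>UNIV. of_real (y $ j) * (of_real (x $ j) * ?E m x))" for x
    using arg_cong[OF e_recursion[of m x y], of complex_of_real]
    by (simp add: inner_vec_def sum_distrib_left sum_distrib_right mult_ac)
  have d: "cpoly (\<lambda>x. ?E (Suc m) x - ?E (Suc m) (swapv a b x))" for a b
    by (intro cpoly_diff cpoly_e) (rule cpoly_swapv[OF cpoly_e])
  have d0: "Lam (\<lambda>x. ?E (Suc m) x - ?E (Suc m) (swapv a b x)) = 0" for a b
    using Lam_swapv[OF cpoly_e[of "Suc m" y], of a b] cpoly_swapv[OF cpoly_e[of "Suc m" y], of a b]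
    by (subst Lam_diff) (auto intro: cpoly_e)
  have "Lam (\<lambda>x. of_nat (Suc m) * ?E (Suc m) x + of_real (k / 2) * (\<Sum>a\<in>UNIV. \<Sum>b\<in>UNIV. ?E (Suc m) x - ?E (Suc m) (swapv a b x)))
     = of_nat (Suc m) * Lam (?E (Suc m)) + of_real (k / 2) * (\<Sum>a\<in>UNIV. \<Sum>b\<in>UNIV. Lam (\<lambda>x. ?E (Suc m) x - ?E (Suc m) (swapv a b x)))"
    by (subst Lam_add, intro cpoly_cmult cpoly_e, intro cpoly_cmult cpoly_sum d)
       (simp only: Lam_cmult Lam_sum[OF finite] cpoly_sum d)
  hence "of_nat (Suc m) * Lam (?E (Suc m)) = Lam (\<lambda>x. \<Sum>j\<in>UNIV. of_real (y $ j) * (of_real (x $ j) * ?E m x))"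
    unfolding L by (simp add: d0)
  also have "\<dots> = (\<Sum>j\<in>UNIV. of_real (y $ j) * Lam (\<lambda>x. of_real (x $ j) * ?E m x))"
    by (subst Lam_sum) (auto intro!: cpoly_cmult[OF cpoly_coord[OF cpoly_e]] simp: Lam_cmult)
  also have "\<dots> = (\<Sum>j\<in>UNIV. of_real (y $ j) * Lam (T j (?E m)))"
    by (simp add: Lam_dunkl_op[OF cpoly_e])
  finally show ?thesis .
qed

text \<open>The eigenvalue equations turn \<open>Lam_e_rec\<close> into a two-step recursion with
  factor |y|^2/(m + 2), starting from c_k in degree 0 and from 0 in degree 1.\<close>

lemma Lam_e_even: "Lam (\<lambda>x. of_real (e (2 * l) x y)) = cc TYPE('n) * of_real (((norm y)\<^sup>2 / 2) ^ l / fact l)"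
  and Lam_e_odd: "Lam (\<lambda>x. of_real (e (Suc (2 * l)) x y)) = 0" for y :: "real^'n::finite"
proof -
  have e0: "(\<lambda>x. complex_of_real (e 0 x y)) = (\<lambda>_. 1)" by simp
  have step: "of_nat (Suc (Suc m)) * Lam (\<lambda>x. of_real (e (Suc (Suc m)) x y)) = of_real ((norm y)\<^sup>2) * Lam (\<lambda>x. of_real (e m x y))" for m
  proof -
    have Tfun: "T j (\<lambda>x. of_real (e (Suc m) x y)) = (\<lambda>x. of_real (y $ j) * of_real (e m x y))" for j
      using dunkl_op_e[of j m y] by (simp add: fun_eq_iff)
    show ?thesis unfolding Lam_e_rec Tfun Lam_cmult norm2_vec
      by (simp add: sum_distrib_right power2_eq_square mult.assoc)
  qed
  show "Lam (\<lambda>x. of_real (e (2 * l) x y)) = cc TYPE('n) * of_real (((norm y)\<^sup>2 / 2) ^ l / fact l)"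
  proof (induction l)
    case 0 show ?case by (simp add: Lam_one)
  next
    case (Suc l)
    have "of_nat (2 * Suc l) * Lam (\<lambda>x. of_real (e (2 * Suc l) x y)) = of_real ((norm y)\<^sup>2) * (cc TYPE('n) * of_real (((norm y)\<^sup>2 / 2) ^ l / fact l))"
      using step[of "2 * l"] Suc by simp
    hence "Lam (\<lambda>x. of_real (e (2 * Suc l) x y)) = of_real ((norm y)\<^sup>2) * (cc TYPE('n) * of_real (((norm y)\<^sup>2 / 2) ^ l / fact l)) / of_nat (2 * Suc l)"
      by (metis nonzero_mult_div_cancel_left of_nat_eq_0_iff mult_eq_0_iff nat.distinct(1) zero_neq_numeral)
    also have "\<dots> = cc TYPE('n) * of_real (((norm y)\<^sup>2 / 2) ^ Suc l / fact (Suc l))"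
      by (simp add: field_simps del: of_nat_Suc) (simp add: field_simps)
    finally show ?case .
  qed
  show "Lam (\<lambda>x. of_real (e (Suc (2 * l)) x y)) = 0"
  proof (induction l)
    case 0
    have "T j (\<lambda>x. complex_of_real (e 0 x y)) = (\<lambda>_. 0)" for j by (simp add: fun_eq_iff)
    thus ?case using Lam_e_rec[of 0 y] by (simp add: Lam_def[of "\<lambda>_. 0"])
  next
    case (Suc l) thus ?case using step[of "Suc (2 * l)"] by (simp del: of_nat_Suc)
  qed
qed

text \<open>Odd degrees vanish, and i^(2l) = (-1)^l turns the series of exp(|y|^2/2) into that of
  the Gaussian.\<close>

lemma dunkl_transform_gauss: "dunkl_transform (\<lambda>x. of_real (wt x)) y = cc TYPE('n) * of_real (gaussw y)" for y :: "real^'n::finite"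
proof -
  let ?a = "\<lambda>m. \<i> ^ m * Lam (\<lambda>x. of_real (e m x y))"
  have "?a sums dunkl_transform (\<lambda>x. of_real (wt x)) y"
    using Lam_K_sums[OF cpoly_const[of 1], of y] by simp
  moreover have "?a m = 0" if "m \<notin> range (\<lambda>l. 2 * l)" for m
  proof -
    from that have "odd m" by (auto elim!: evenE)
    then obtain l where "m = Suc (2 * l)" by (auto elim!: oddE)
    thus ?thesis by (simp add: Lam_e_odd)
  qed
  ultimately have s1: "(\<lambda>l. ?a (2 * l)) sums dunkl_transform (\<lambda>x. of_real (wt x)) y"
    by (subst sums_mono_reindex[of "\<lambda>l. 2 * l"]) (auto simp: strict_mono_def)
  have eq: "?a (2 * l) = cc TYPE('n) * ((of_real (- (norm y)\<^sup>2 / 2)) ^ l /\<^sub>R fact l)" for l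
  proof -
    have g: "z * (v * of_real (X / Y)) = v * ((z * of_real X) /\<^sub>R Y)" for z v :: complex and X Y :: real
      by (simp add: scaleR_conv_of_real divide_inverse mult_ac)
    have a: "\<i> ^ (2 * l) = (-1 :: complex) ^ l" by (simp add: power_mult)
    have b: "complex_of_real (- (norm y)\<^sup>2 / 2) ^ l = (-1) ^ l * of_real (((norm y)\<^sup>2 / 2) ^ l)"
    proof -
      have r: "(- (norm y)\<^sup>2 / 2) ^ l = (-1) ^ l * ((norm y)\<^sup>2 / 2) ^ l"
        using power_minus[of "(norm y)\<^sup>2 / 2" l] by simp
      show ?thesis using arg_cong[OF r, of complex_of_real] by simp
    qed
    show ?thesis by (simp only: Lam_e_even a b g)
  qed
  have s2: "(\<lambda>l. cc TYPE('n) * (complex_of_real (- (norm y)\<^sup>2 / 2) ^ l /\<^sub>R fact l)) sums (cc TYPE('n) * exp (of_real (- (norm y)\<^sup>2 / 2)))"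
    by (intro sums_mult exp_converges)
  from sums_unique2[OF s1[unfolded eq] s2] show ?thesis by (simp only: gaussw_def exp_of_real)
qed

lemma gaussw_has_pd: "((\<lambda>t. complex_of_real (gaussw (y + t *\<^sub>R axis j 1))) has_vector_derivative of_real (- y $ j * gaussw y)) (at 0)"
proof -
  define d where "d i = (if i = j then 1 else 0 :: real)" for i
  have sd: "(\<Sum>i\<in>UNIV. d i * y $ i) = y $ j"
    by (subst sum.remove[of _ j]) (auto simp: d_def intro!: sum.neutral)
  have "((\<lambda>t. \<Sum>i\<in>UNIV. (y $ i + t * d i)\<^sup>2) has_real_derivative (\<Sum>i\<in>UNIV. 2 * (d i * y $ i))) (at 0)"
    by (rule DERIV_sum) (auto intro!: derivative_eq_intros)
  hence "((\<lambda>t. \<Sum>i\<in>UNIV. (y $ i + t * d i)\<^sup>2) has_real_derivative 2 * y $ j) (at 0)"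
    unfolding sum_distrib_left[symmetric] sd .
  from DERIV_fun_exp[OF DERIV_cdivide[OF DERIV_minus[OF this], of 2]]
  have "((\<lambda>t. exp (- (\<Sum>i\<in>UNIV. (y $ i + t * d i)\<^sup>2) / 2)) has_real_derivative (- y $ j * gaussw y)) (at 0)"
    by (simp add: gaussw_def norm2_vec mult.commute)
  moreover have "gaussw (y + t *\<^sub>R axis j 1) = exp (- (\<Sum>i\<in>UNIV. (y $ i + t * d i)\<^sup>2) / 2)" for t
    unfolding gaussw_def norm2_vec by (simp add: axis_def d_def)
  ultimately show ?thesis
    by (intro has_vector_derivative_of_real) (simp add: has_real_derivative_iff_has_vector_derivative)
qed

text \<open>Differentiation under the integral, where symmetry of \<open>K\<close> makes
  \<open>K_has_pd\<close> available in the spectral variable. In operator terms, T_j of the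
  transform of h is i times the transform of x_j h.\<close>

lemma dunkl_transform_has_pd:
  fixes h :: "real^'n::finite \<Rightarrow> complex"
  assumes h: "integrable lborel h" and hj: "integrable lborel (\<lambda>x. of_real (x $ j) * h x)"
    and reg: "\<And>b. b \<noteq> j \<Longrightarrow> y $ j \<noteq> y $ b"
  shows "((\<lambda>t. dunkl_transform h (y + t *\<^sub>R axis j 1)) has_vector_derivative
     (\<i> * dunkl_transform (\<lambda>x. of_real (x $ j) * h x) y
       - of_real k * (\<Sum>b\<in>UNIV - {j}. (dunkl_transform h y - dunkl_transform h (swapv j b y)) / of_real (y $ j - y $ b)))) (at 0)"
proof -
  obtain C where C: "C \<ge> 0" "\<And>x y. norm (K x (y :: real^'n)) \<le> C" using K_bounded_ex by blast
  have [measurable]: "h \<in> borel_measurable borel" using h by auto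
  define \<delta> where "\<delta> = Min (insert 1 ((\<lambda>b. \<bar>y $ j - y $ b\<bar> / 2) ` (UNIV - {j})))"
  have \<delta>: "\<delta> > 0" unfolding \<delta>_def using reg by (subst Min_gr_iff) auto
  have \<delta>_le: "2 * \<delta> \<le> \<bar>y $ j - y $ b\<bar>" if "b \<noteq> j" for b
  proof -
    have "\<delta> \<le> \<bar>y $ j - y $ b\<bar> / 2" unfolding \<delta>_def using that by (intro Min_le) auto
    thus ?thesis by simp
  qed
  define z where "z t = y + t *\<^sub>R axis j 1" for t
  have z_j: "z t $ j = y $ j + t" and z_b: "b \<noteq> j \<Longrightarrow> z t $ b = y $ b" for t b
    by (auto simp: z_def axis_def)
  have gap: "\<delta> \<le> \<bar>z t $ j - z t $ b\<bar>" if "\<bar>t\<bar> < \<delta>" "b \<noteq> j" for t b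
    using \<delta>_le[OF that(2)] that by (auto simp: z_j z_b)
  define D where "D t x = h x * (\<i> * of_real (x $ j) * K x (z t) - of_real k * (\<Sum>b\<in>UNIV - {j}. (K x (z t) - K x (swapv j b (z t))) / of_real (z t $ j - z t $ b)))" for t x
  define g where "g x = norm (of_real (x $ j) * h x) * C + norm (h x) * (k * (\<Sum>b\<in>UNIV - {j}. 2 * C / \<delta>))" for x
  have "((\<lambda>t. LINT x | lborel. h x * K x (z t)) has_vector_derivative integral\<^sup>L lborel (D 0)) (at 0)"
  proof (rule has_vector_derivative_integral[OF \<delta>, where f' = D and g = g])
    fix t :: real and x assume t: "\<bar>t\<bar> < \<delta>"
    have "((\<lambda>s. K (z t + s *\<^sub>R axis j 1) x) has_vector_derivative
      (\<i> * of_real (x $ j) * K (z t) x - of_real k * (\<Sum>b\<in>UNIV - {j}. (K (z t) x - K (swapv j b (z t)) x) / of_real (z t $ j - z t $ b)))) (at 0)"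
      by (rule K_has_pd) (use gap[OF t] \<delta> in fastforce)
    moreover have "z t + s *\<^sub>R axis j 1 = z (t + s)" for s by (simp add: z_def scaleR_add_left)
    ultimately have "((\<lambda>s. K x (z (t + s))) has_vector_derivative
      (\<i> * of_real (x $ j) * K x (z t) - of_real k * (\<Sum>b\<in>UNIV - {j}. (K x (z t) - K x (swapv j b (z t))) / of_real (z t $ j - z t $ b)))) (at 0)" (is "(_ has_vector_derivative ?D) _")
      by (simp add: K_sym[of _ x])
    hence "((\<lambda>s. K x (z s)) has_vector_derivative ?D) (at t)"
      using vector_diff_chain_at[of "\<lambda>s. s - t" 1 t "\<lambda>s. K x (z (t + s))" ?D]
      by (simp add: o_def derivative_eq_intros has_vector_derivative_diff_const)
    thus "((\<lambda>t. h x * K x (z t)) has_vector_derivative D t x) (at t)"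
      unfolding D_def by (rule has_vector_derivative_mult_right)
    have "norm (\<Sum>b\<in>UNIV - {j}. (K x (z t) - K x (swapv j b (z t))) / of_real (z t $ j - z t $ b)) \<le> (\<Sum>b\<in>UNIV - {j}. 2 * C / \<delta>)"
    proof (rule sum_norm_le)
      fix b assume b: "b \<in> UNIV - {j}"
      have "norm (K x (z t) - K x (swapv j b (z t))) \<le> C + C"
        by (intro norm_triangle_le_diff add_mono C)
      hence "norm (K x (z t) - K x (swapv j b (z t))) / \<bar>z t $ j - z t $ b\<bar> \<le> (2 * C) / \<delta>"
        using gap[OF t, of b] b \<delta> C by (intro frac_le) auto
      thus "norm ((K x (z t) - K x (swapv j b (z t))) / of_real (z t $ j - z t $ b)) \<le> 2 * C / \<delta>"
        by (simp add: norm_divide del: of_real_diff)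
    qed
    hence 1: "norm (of_real k * (\<Sum>b\<in>UNIV - {j}. (K x (z t) - K x (swapv j b (z t))) / of_real (z t $ j - z t $ b))) \<le> k * (\<Sum>b\<in>UNIV - {j}. 2 * C / \<delta>)"
      unfolding norm_mult norm_of_real abs_of_nonneg[OF k_nonneg] by (rule mult_left_mono[OF _ k_nonneg])
    have 2: "norm (\<i> * of_real (x $ j) * K x (z t)) \<le> \<bar>x $ j\<bar> * C"
      by (simp add: norm_mult mult_left_mono C)
    have "norm (D t x) \<le> norm (h x) * (\<bar>x $ j\<bar> * C + k * (\<Sum>b\<in>UNIV - {j}. 2 * C / \<delta>))"
      unfolding D_def norm_mult[of "h x"]
      by (intro mult_left_mono norm_ge_zero order_trans[OF norm_triangle_ineq4] add_mono 1 2)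
    thus "norm (D t x) \<le> g x" by (simp add: g_def norm_mult distrib_left mult_ac)
  next
    show "integrable lborel g" unfolding g_def using h hj
      by (intro Bochner_Integration.integrable_add integrable_mult_left integrable_norm) auto
    show "integrable lborel (\<lambda>x. h x * K x (z t))" for t
      by (rule integrable_mult_bounded[OF h _ C(2)]) measurable
    show "D 0 \<in> borel_measurable lborel" unfolding D_def by measurable
  qed
  moreover have "integral\<^sup>L lborel (D 0) = \<i> * dunkl_transform (\<lambda>x. of_real (x $ j) * h x) y
       - of_real k * (\<Sum>b\<in>UNIV - {j}. (dunkl_transform h y - dunkl_transform h (swapv j b y)) / of_real (y $ j - y $ b))"
  proof -
    have z0: "z 0 = y" by (simp add: z_def)
    have i1: "integrable lborel (\<lambda>x. h x * K x v)" for v by (rule integrable_mult_bounded[OF h _ C(2)]) measurable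
    have i2: "integrable lborel (\<lambda>x. of_real (x $ j) * h x * K x y)" by (rule integrable_mult_bounded[OF hj _ C(2)]) measurable
    have "integral\<^sup>L lborel (D 0) = (LINT x | lborel. \<i> * (of_real (x $ j) * h x * K x y) - of_real k * (\<Sum>b\<in>UNIV - {j}. (h x * K x y - h x * K x (swapv j b y)) / of_real (y $ j - y $ b)))"
      unfolding D_def z0 by (intro arg_cong[where f = "integral\<^sup>L lborel"] ext) 
        (simp add: right_diff_distrib sum_distrib_left mult_ac)
    also have "\<dots> = \<i> * (LINT x | lborel. of_real (x $ j) * h x * K x y) - of_real k * (\<Sum>b\<in>UNIV - {j}. ((LINT x | lborel. h x * K x y) - (LINT x | lborel. h x * K x (swapv j b y))) / of_real (y $ j - y $ b))"
      using i1 i2 by (simp del: of_real_diff)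
    finally show ?thesis by (simp add: dunkl_transform_def)
  qed
  ultimately show ?thesis by (simp add: dunkl_transform_def z_def)
qed

text \<open>Both directions go into one induction because they must share the witness: passing from
  p to x_j p replaces q by i (y_j q - T_j q). Forwards this comes from T_j acting on transforms,
  backwards from the antisymmetry of T_j.\<close>

lemma dunkl_transform_pair:
  fixes p :: "real^'n::finite \<Rightarrow> complex"
  assumes "cpoly p"
  shows "\<exists>q. cpoly q \<and> (\<forall>y. dunkl_transform (\<lambda>x. p x * of_real (wt x)) y = cc TYPE('n) * q y * of_real (gaussw y))
     \<and> (\<forall>x. dunkl_transform (\<lambda>y. q y * of_real (wt y)) (- x) = cc TYPE('n) * p x * of_real (gaussw x))"
  using assms
proof (induction rule: cpoly.induct)
  case (cpoly_const v)
  have "dunkl_transform (\<lambda>x. v * complex_of_real (wt x)) y = cc TYPE('n) * v * of_real (gaussw y)" for y :: "real^'n"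
    using dunkl_transform_gauss[of y] by (simp add: dunkl_transform_def mult.assoc mult.left_commute)
  thus ?case by (intro exI[of _ "\<lambda>_. v"]) (auto intro: cpoly.cpoly_const)
next
  case (cpoly_add p1 p2)
  then obtain q1 q2 where q: "cpoly q1" "cpoly q2"
    "\<And>y. dunkl_transform (\<lambda>x. p1 x * of_real (wt x)) y = cc TYPE('n) * q1 y * of_real (gaussw y)"
    "\<And>y. dunkl_transform (\<lambda>x. p2 x * of_real (wt x)) y = cc TYPE('n) * q2 y * of_real (gaussw y)"
    "\<And>x. dunkl_transform (\<lambda>y. q1 y * of_real (wt y)) (- x) = cc TYPE('n) * p1 x * of_real (gaussw x)"
    "\<And>x. dunkl_transform (\<lambda>y. q2 y * of_real (wt y)) (- x) = cc TYPE('n) * p2 x * of_real (gaussw x)" by blast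
  obtain C where C: "\<And>x y. norm (K x (y :: real^'n)) \<le> C" using K_bounded_ex by blast
  have add: "dunkl_transform (\<lambda>x. (f1 x + f2 x) * of_real (wt x)) y = dunkl_transform (\<lambda>x. f1 x * of_real (wt x)) y + dunkl_transform (\<lambda>x. f2 x * of_real (wt x)) y"
    if "cpoly f1" "cpoly f2" for f1 f2 and y :: "real^'n"
  proof -
    have "integrable lborel (\<lambda>x. f x * of_real (wt x) * K x y)" if "cpoly f" for f :: "real^'n \<Rightarrow> complex"
      by (rule integrable_mult_bounded[OF integrable_wt_cpoly[OF that] _ C]) measurable
    thus ?thesis using that by (simp add: dunkl_transform_def distrib_right)
  qed
  show ?case
    by (intro exI[of _ "\<lambda>y. q1 y + q2 y"] conjI allI cpoly.cpoly_add q(1,2); subst add)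
       (simp_all only: cpoly_add.hyps q distrib_left distrib_right)
next
  case (cpoly_coord p j)
  then obtain q where q: "cpoly q" and pq: "\<And>y. dunkl_transform (\<lambda>x. p x * of_real (wt x)) y = cc TYPE('n) * q y * of_real (gaussw y)"
    and qp: "\<And>x. dunkl_transform (\<lambda>y. q y * of_real (wt y)) (- x) = cc TYPE('n) * p x * of_real (gaussw x)" by blast
  \<comment> \<open>Chosen so that T_j maps q times the Gaussian to -r times the Gaussian: the
    Gaussian is symmetric, and its derivative brings down -y_j.\<close>
  define r where "r y = of_real (y $ j) * q y - T j q y" for y
  have r: "cpoly r" unfolding r_def by (intro cpoly_diff cpoly.cpoly_coord cpoly_dunkl_op q)
  \<comment> \<open>The derivative of a transform is available only off the hyperplanes; continuity
    of both sides extends the identity.\<close>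
  have "dunkl_transform (\<lambda>x. of_real (x $ j) * p x * of_real (wt x)) y = cc TYPE('n) * (\<i> * r y) * of_real (gaussw y)" for y
  proof (rule continuous_eq_regular)
    show "continuous_on UNIV (dunkl_transform (\<lambda>x. of_real (x $ j) * p x * of_real (wt x)))"
      by (rule continuous_dunkl_transform[OF integrable_wt_cpoly]) (rule cpoly.cpoly_coord[OF cpoly_coord.hyps])
    show "continuous_on UNIV (\<lambda>y. cc TYPE('n) * (\<i> * r y) * of_real (gaussw y))"
      by (intro continuous_intros cpoly_continuous[OF r])
    fix y :: "real^'n" assume reg: "\<And>i j. i \<noteq> j \<Longrightarrow> y $ i \<noteq> y $ j"
    have d1: "((\<lambda>t. dunkl_transform (\<lambda>x. p x * of_real (wt x)) (y + t *\<^sub>R axis j 1)) has_vector_derivative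
     (\<i> * dunkl_transform (\<lambda>x. of_real (x $ j) * (p x * of_real (wt x))) y
       - of_real k * (\<Sum>b\<in>UNIV - {j}. (dunkl_transform (\<lambda>x. p x * of_real (wt x)) y - dunkl_transform (\<lambda>x. p x * of_real (wt x)) (swapv j b y)) / of_real (y $ j - y $ b)))) (at 0)"
    proof (rule dunkl_transform_has_pd)
      show "integrable lborel (\<lambda>x. p x * complex_of_real (wt x))" by (rule integrable_wt_cpoly[OF cpoly_coord.hyps])
      show "integrable lborel (\<lambda>x. of_real (x $ j) * (p x * complex_of_real (wt x)))"
        using integrable_wt_cpoly[OF cpoly.cpoly_coord[OF cpoly_coord.hyps, of j]] by (simp add: mult.assoc)
    qed (use reg in auto)
    have "((\<lambda>t. q (y + t *\<^sub>R axis j 1) * of_real (gaussw (y + t *\<^sub>R axis j 1))) has_vector_derivative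
       (q y * of_real (- y $ j * gaussw y) + pd j q y * of_real (gaussw y))) (at 0)"
      using has_vector_derivative_mult[OF cpoly_has_pd[OF q, of y j] gaussw_has_pd[of y j]] by simp
    from has_vector_derivative_mult_right[OF this, of "cc TYPE('n)"]
    have d2: "((\<lambda>t. dunkl_transform (\<lambda>x. p x * of_real (wt x)) (y + t *\<^sub>R axis j 1)) has_vector_derivative
       cc TYPE('n) * (q y * of_real (- y $ j * gaussw y) + pd j q y * of_real (gaussw y))) (at 0)"
      unfolding pq by (simp add: mult.assoc)
    define S where "S = (\<Sum>b\<in>UNIV - {j}. divdiff j b q y)"
    have "(\<Sum>b\<in>UNIV - {j}. (dunkl_transform (\<lambda>x. p x * of_real (wt x)) y - dunkl_transform (\<lambda>x. p x * of_real (wt x)) (swapv j b y)) / of_real (y $ j - y $ b))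
      = cc TYPE('n) * of_real (gaussw y) * S"
      unfolding S_def sum_distrib_left
    proof (rule sum.cong[OF refl])
      fix b assume "b \<in> UNIV - {j}"
      hence ne: "y $ j \<noteq> y $ b" using reg[of j b] by auto
      show "(dunkl_transform (\<lambda>x. p x * of_real (wt x)) y - dunkl_transform (\<lambda>x. p x * of_real (wt x)) (swapv j b y)) / of_real (y $ j - y $ b)
        = cc TYPE('n) * of_real (gaussw y) * divdiff j b q y"
        unfolding pq gaussw_swapv using ne by (simp add: divdiff_def right_diff_distrib left_diff_distrib diff_divide_distrib mult_ac del: of_real_diff)
    qed
    with vector_derivative_unique_at[OF d1 d2]
    have "\<i> * dunkl_transform (\<lambda>x. of_real (x $ j) * (p x * of_real (wt x))) y
       = cc TYPE('n) * (q y * of_real (- y $ j * gaussw y) + pd j q y * of_real (gaussw y)) + of_real k * (cc TYPE('n) * of_real (gaussw y) * S)"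
      by (simp add: diff_eq_eq)
    also have "\<dots> = - (cc TYPE('n) * r y * of_real (gaussw y))"
      unfolding r_def dunkl_op_def S_def[symmetric] by (simp add: algebra_simps)
    finally have "- \<i> * (\<i> * dunkl_transform (\<lambda>x. of_real (x $ j) * (p x * of_real (wt x))) y) = \<i> * (cc TYPE('n) * r y * of_real (gaussw y))"
      by (simp only: mult_minus_left mult_minus_right minus_minus)
    thus "dunkl_transform (\<lambda>x. of_real (x $ j) * p x * of_real (wt x)) y = cc TYPE('n) * (\<i> * r y) * of_real (gaussw y)"
      by (simp add: mult_ac)
  qed
  moreover have "dunkl_transform (\<lambda>y. (\<i> * r y) * of_real (wt y)) (- x) = cc TYPE('n) * (of_real (x $ j) * p x) * of_real (gaussw x)" for x
  proof -
    let ?x = "- x"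
    let ?E = "\<lambda>m y. complex_of_real (e m y ?x)"
    \<comment> \<open>Antisymmetry moves T_j from q onto the kernel component, where it acts as the
      scalar -x_j and lowers the degree by one. The term y_j q of r absorbs the right-hand side of
      \<open>Lam_antisym\<close>.\<close>
    have L: "Lam (\<lambda>y. r y * ?E m y) = Lam (\<lambda>y. q y * T j (?E m) y)" for m
    proof -
      have "Lam (\<lambda>y. r y * ?E m y) = Lam (\<lambda>y. of_real (y $ j) * (q y * ?E m y) - T j q y * ?E m y)"
        by (simp add: r_def left_diff_distrib mult.assoc)
      also have "\<dots> = Lam (\<lambda>y. of_real (y $ j) * (q y * ?E m y)) - Lam (\<lambda>y. T j q y * ?E m y)"
        by (rule Lam_diff) (intro cpoly.cpoly_coord cpoly_mult cpoly_dunkl_op q cpoly_e)+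
      also have "\<dots> = Lam (\<lambda>y. q y * T j (?E m) y)"
      proof -
        have gen: "a + b = c \<Longrightarrow> c - a = b" for a b c :: complex by auto
        show ?thesis by (rule gen[OF Lam_antisym[OF q cpoly_e]])
      qed
      finally show ?thesis .
    qed
    have L0: "Lam (\<lambda>y. r y * ?E 0 y) = 0" unfolding L by (simp add: Lam_def)
    have LS: "Lam (\<lambda>y. r y * ?E (Suc m) y) = of_real (?x $ j) * Lam (\<lambda>y. q y * ?E m y)" for m
      unfolding L dunkl_op_e Lam_cmult[symmetric] by (simp add: mult_ac)
    have "(\<lambda>m. \<i> ^ m * Lam (\<lambda>y. r y * ?E m y)) sums dunkl_transform (\<lambda>y. r y * of_real (wt y)) ?x"
      by (rule Lam_K_sums[OF r])
    hence "(\<lambda>m. \<i> ^ Suc m * Lam (\<lambda>y. r y * ?E (Suc m) y)) sums dunkl_transform (\<lambda>y. r y * of_real (wt y)) ?x"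
      using L0 by (subst sums_Suc_iff) simp
    moreover have "(\<lambda>m. \<i> * of_real (?x $ j) * (\<i> ^ m * Lam (\<lambda>y. q y * ?E m y))) sums (\<i> * of_real (?x $ j) * dunkl_transform (\<lambda>y. q y * of_real (wt y)) ?x)"
      by (rule sums_mult[OF Lam_K_sums[OF q]])
    moreover have "(\<lambda>m. \<i> ^ Suc m * Lam (\<lambda>y. r y * ?E (Suc m) y)) = (\<lambda>m. \<i> * of_real (?x $ j) * (\<i> ^ m * Lam (\<lambda>y. q y * ?E m y)))"
      unfolding LS by (simp add: mult_ac)
    ultimately have "dunkl_transform (\<lambda>y. r y * of_real (wt y)) ?x = \<i> * of_real (?x $ j) * dunkl_transform (\<lambda>y. q y * of_real (wt y)) ?x"
      by (simp add: sums_unique2)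
    hence "dunkl_transform (\<lambda>y. r y * of_real (wt y)) ?x = - \<i> * of_real (x $ j) * (cc TYPE('n) * p x * of_real (gaussw x))"
      unfolding qp by simp
    moreover have "dunkl_transform (\<lambda>y. (\<i> * r y) * of_real (wt y)) (- x) = \<i> * dunkl_transform (\<lambda>y. r y * of_real (wt y)) ?x"
      unfolding dunkl_transform_def mult.assoc by simp
    ultimately show ?thesis by (simp add: mult_ac)
  qed
  ultimately show ?case
    by (intro exI[of _ "\<lambda>y. \<i> * r y"] conjI allI) (auto intro: cpoly_cmult r)
qed

section \<open>Inversion for integrable functions\<close>

lemma c_const_pos: "c_const k TYPE('n::finite) > 0"
proof -
  have i: "integrable lborel (wt :: real^'n \<Rightarrow> real)"
    using integrable_gauss[of "omega k :: real^'n \<Rightarrow> real"] expbdd_omega by (simp add: wt_def[abs_def])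
  have c: "c_const k TYPE('n) = integral\<^sup>L lborel (wt :: real^'n \<Rightarrow> real)"
    by (simp add: c_const_def wt_def[abs_def] gaussw_def)
  have "integral\<^sup>L lborel (wt :: real^'n \<Rightarrow> real) \<noteq> 0"
  proof
    assume "integral\<^sup>L lborel (wt :: real^'n \<Rightarrow> real) = 0"
    hence "AE x in lborel. wt (x :: real^'n) = 0"
      using integral_nonneg_eq_0_iff_AE[OF i] by (simp add: wt_nonneg)
    hence "AE x in (lborel :: (real^'n) measure). False"
      using AE_regular
    proof eventually_elim
      fix x :: "real^'n" assume "wt x = 0" "\<forall>i j. i \<noteq> j \<longrightarrow> x $ i \<noteq> x $ j"
      thus False using omega_pos[of x k] gaussw_pos[of x] by (auto simp: wt_def)
    qed
    thus False by (simp add: eventually_False ae_filter_eq_bot_iff)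
  qed
  moreover have "integral\<^sup>L lborel (wt :: real^'n \<Rightarrow> real) \<ge> 0" by (intro integral_nonneg_AE) (simp add: wt_nonneg)
  ultimately show ?thesis unfolding c by simp
qed

text \<open>Exponential integrability dominates the Taylor sums of exp(i \<langle>\<xi>,
  x\<rangle>), so the Fourier transform of H is a limit of moments. Under slower decay vanishing
  moments do not determine H in general.\<close>

lemma moments_zero_AE:
  fixes H :: "real^'n::finite \<Rightarrow> complex"
  assumes [measurable]: "H \<in> borel_measurable borel"
    and exp_int: "\<And>b. integrable lborel (\<lambda>x. norm (H x) * exp (b * l1norm x))"
    and mom: "\<And>p. cpoly p \<Longrightarrow> (LINT x | lborel. H x * p x) = 0"
  shows "AE x in lborel. H x = 0"
proof (rule fourier_unique_AE)
  show "integrable lborel H" using exp_int[of 0] by (simp add: integrable_norm_iff)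
  fix \<xi> :: "real^'n"
  define b where "b = (\<Sum>i\<in>UNIV. \<bar>\<xi> $ i\<bar>)"
  have b0: "b \<ge> 0" by (simp add: b_def sum_nonneg)
  have le: "\<bar>\<xi> \<bullet> x\<bar> \<le> b * l1norm x" for x
  proof -
    have "\<bar>\<xi> \<bullet> x\<bar> \<le> (\<Sum>i\<in>UNIV. \<bar>\<xi> $ i * x $ i\<bar>)" unfolding inner_vec_def by (simp add: sum_abs)
    also have "\<dots> \<le> (\<Sum>i\<in>UNIV. \<bar>\<xi> $ i\<bar> * l1norm x)"
      by (intro sum_mono) (simp add: abs_mult mult_left_mono nth_le_l1norm)
    finally show ?thesis by (simp add: b_def sum_distrib_right)
  qed
  define s where "s n x = (\<Sum>m<n. (\<i> * of_real (\<xi> \<bullet> x)) ^ m / fact m)" for n x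
  have lin: "cpoly (\<lambda>x. complex_of_real (\<xi> \<bullet> x))"
  proof -
    have "cpoly (\<lambda>x. \<Sum>i\<in>UNIV. of_real (\<xi> $ i) * complex_of_real (x $ i))" by (intro cpoly_sum cpoly_cmult cpoly_nth)
    thus ?thesis by (simp add: inner_vec_def)
  qed
  have pw: "cpoly (\<lambda>x. complex_of_real (\<xi> \<bullet> x) ^ m)" for m
    by (induction m) (auto intro: cpoly_const cpoly_mult lin)
  have s_poly: "cpoly (s n)" for n
  proof -
    have "cpoly (\<lambda>x. \<Sum>m<n. (\<i> ^ m / fact m) * complex_of_real (\<xi> \<bullet> x) ^ m)" by (intro cpoly_sum cpoly_cmult pw)
    thus ?thesis unfolding s_def by (simp add: power_mult_distrib)
  qed
  note [measurable] = cpoly_measurable[OF s_poly]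
  have "(\<lambda>n. LINT x | lborel. H x * s n x) \<longlonglongrightarrow> (LINT x | lborel. H x * exp (\<i> * of_real (\<xi> \<bullet> x)))"
  proof (rule integral_dominated_convergence[where w = "\<lambda>x. norm (H x) * exp (b * l1norm x)"])
    show "AE x in lborel. (\<lambda>n. H x * s n x) \<longlonglongrightarrow> H x * exp (\<i> * of_real (\<xi> \<bullet> x))"
    proof (rule AE_I2)
      fix x
      have "(\<lambda>n. s n x) \<longlonglongrightarrow> exp (\<i> * of_real (\<xi> \<bullet> x))"
        using exp_converges[of "\<i> * of_real (\<xi> \<bullet> x)"] by (simp add: s_def sums_def scaleR_conv_of_real divide_inverse mult.commute)
      thus "(\<lambda>n. H x * s n x) \<longlonglongrightarrow> H x * exp (\<i> * of_real (\<xi> \<bullet> x))" by (intro tendsto_intros)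
    qed
    show "AE x in lborel. norm (H x * s n x) \<le> norm (H x) * exp (b * l1norm x)" for n
    proof (rule AE_I2)
      fix x
      have "norm (s n x) \<le> (\<Sum>m<n. (b * l1norm x) ^ m / fact m)"
        unfolding s_def by (rule sum_norm_le) (auto simp: norm_divide norm_power norm_mult intro!: divide_right_mono power_mono le)
      also have "\<dots> \<le> exp (b * l1norm x)"
        using b0 by (intro exp_partial_sum_le) simp
      finally show "norm (H x * s n x) \<le> norm (H x) * exp (b * l1norm x)" by (simp add: norm_mult mult_left_mono)
    qed
  qed (use exp_int in measurable)
  thus "(LINT x | lborel. H x * exp (\<i> * of_real (\<xi> \<bullet> x))) = 0"
    unfolding mom[OF s_poly] by (simp add: LIMSEQ_const_iff)
qed

text \<open>Completing the square in each coordinate bounds the exponent by b^2/2.\<close>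

lemma gauss_exp_bounded: "\<exists>C\<ge>0. \<forall>x :: real^'n::finite. gaussw x * exp (b * l1norm x) \<le> C"
proof (intro exI[of _ "exp (b\<^sup>2 / 2) ^ CARD('n)"] conjI allI)
  fix x :: "real^'n"
  have "gaussw x * exp (b * l1norm x) = (\<Prod>i\<in>UNIV. exp (b * \<bar>x $ i\<bar> - (x $ i)\<^sup>2 / 2))"
    unfolding gaussw_def l1norm_def norm2_vec exp_add[symmetric] exp_sum[OF finite, symmetric]
    by (simp add: sum_subtractf sum_distrib_left sum_divide_distrib)
  also have "\<dots> \<le> (\<Prod>i\<in>(UNIV::'n set). exp (b\<^sup>2 / 2))"
  proof (intro prod_mono conjI)
    fix i
    have "0 \<le> (b - \<bar>x $ i\<bar>)\<^sup>2" by simp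
    hence "b * \<bar>x $ i\<bar> - (x $ i)\<^sup>2 / 2 \<le> b\<^sup>2 / 2" by (simp add: power2_diff)
    thus "exp (b * \<bar>x $ i\<bar> - (x $ i)\<^sup>2 / 2) \<le> exp (b\<^sup>2 / 2)" by simp
  qed auto
  finally show "gaussw x * exp (b * l1norm x) \<le> exp (b\<^sup>2 / 2) ^ CARD('n)" by simp
qed auto

text \<open>\<open>\<gamma>\<close> plays the role of $g \omega_k$, which avoids dividing by the weight in the measurability arguments.\<close>

lemma dunkl_inversion:
  fixes \<gamma> :: "real^'n::finite \<Rightarrow> complex"
  assumes \<gamma>: "integrable lborel \<gamma>"
    and g: "integrable lborel (\<lambda>y. dunkl_transform \<gamma> (- y) * of_real (omega k y))"
  shows "AE x in lborel. dunkl_transform (\<lambda>y. dunkl_transform \<gamma> (- y) * of_real (omega k y)) x * of_real (omega k x)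
     = (cc TYPE('n))\<^sup>2 * \<gamma> x"
proof -
  define h where "h = (\<lambda>y. dunkl_transform \<gamma> (- y) * complex_of_real (omega k y))"
  define F where "F = dunkl_transform h"
  define c where "c = cc TYPE('n)"
  obtain C where C: "C \<ge> 0" "\<And>x y. norm (K x (y :: real^'n)) \<le> C" using K_bounded_ex by blast
  have h: "integrable lborel h" using g by (simp add: h_def)
  have Fcont: "continuous_on UNIV F" unfolding F_def by (rule continuous_dunkl_transform[OF h])
  have [measurable]: "F \<in> borel_measurable borel" "\<gamma> \<in> borel_measurable borel" "h \<in> borel_measurable borel"
    using borel_measurable_continuous_onI[OF Fcont] \<gamma> h by auto
  have F_bound: "norm (F x) \<le> C * (LINT y | lborel. norm (h y))" for x
  proof -
    have "norm (F x) \<le> (LINT y | lborel. norm (h y * K y x))" unfolding F_def dunkl_transform_def by (rule integral_norm_bound)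
    also have "\<dots> \<le> (LINT y | lborel. C * norm (h y))"
      by (rule integral_mono_AE') (use h C in \<open>auto simp: norm_mult mult.commute[of C] intro!: AE_I2 mult_left_mono\<close>)
    finally show ?thesis by simp
  qed
  \<comment> \<open>\<open>F\<close> is bounded and \<open>\<gamma>\<close> is integrable; the
    Gaussian factor gives their weighted difference the exponential moments that
    \<open>moments_zero_AE\<close> requires.\<close>
  define H where "H x = (F x * of_real (omega k x) - c\<^sup>2 * \<gamma> x) * of_real (gaussw x)" for x
  have [measurable]: "H \<in> borel_measurable borel" unfolding H_def by measurable
  have KB [measurable]: "(\<lambda>(x, y). K x (y :: real^'n)) \<in> borel_measurable borel"
    by (intro borel_measurable_continuous_onI) (simp add: case_prod_unfold continuous_on_K_UNIV)
  have "AE x in lborel. H x = 0"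
  proof (rule moments_zero_AE)
    fix b :: real
    obtain C' where C': "C' \<ge> 0" "\<And>x :: real^'n. gaussw x * exp (b * l1norm x) \<le> C'" using gauss_exp_bounded by blast
    define M where "M = C * (LINT y | lborel. norm (h y))"
    show "integrable lborel (\<lambda>x. norm (H x) * exp (b * l1norm x))"
    proof (rule Bochner_Integration.integrable_bound)
      have "expbdd (\<lambda>x :: real^'n. exp (\<bar>b\<bar> * l1norm x))" by (rule expbddI[of 1 "\<bar>b\<bar>"]) auto
      hence "integrable lborel (\<lambda>x :: real^'n. gaussw x *\<^sub>R (omega k x * exp (\<bar>b\<bar> * l1norm x)))"
        by (intro integrable_gauss expbdd_mult expbdd_omega) measurable
      thus "integrable lborel (\<lambda>x. M * (gaussw x *\<^sub>R (omega k x * exp (\<bar>b\<bar> * l1norm x))) + norm (c\<^sup>2) * C' * norm (\<gamma> x))"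
        using \<gamma> by (intro Bochner_Integration.integrable_add Bochner_Integration.integrable_mult_right integrable_norm)
      show "AE x in lborel. norm (norm (H x) * exp (b * l1norm x)) \<le> norm (M * (gaussw x *\<^sub>R (omega k x * exp (\<bar>b\<bar> * l1norm x))) + norm (c\<^sup>2) * C' * norm (\<gamma> x))"
      proof (rule AE_I2)
        fix x :: "real^'n"
        have M0: "M \<ge> 0" unfolding M_def using C by (intro mult_nonneg_nonneg integral_nonneg_AE) auto
        have "norm (F x * of_real (omega k x) - c\<^sup>2 * \<gamma> x) \<le> M * omega k x + norm (c\<^sup>2) * norm (\<gamma> x)"
          using F_bound[of x] omega_nonneg[of k x]
          by (intro order_trans[OF norm_triangle_ineq4] add_mono) (auto simp: norm_mult M_def intro!: mult_right_mono)
        hence "norm (H x) * exp (b * l1norm x) \<le> (M * omega k x + norm (c\<^sup>2) * norm (\<gamma> x)) * (gaussw x * exp (b * l1norm x))"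
          unfolding H_def norm_mult norm_of_real abs_of_pos[OF gaussw_pos] mult.assoc
          by (intro mult_right_mono mult_nonneg_nonneg) (auto simp: less_imp_le)
        also have "\<dots> = M * (gaussw x * (omega k x * exp (b * l1norm x))) + norm (c\<^sup>2) * norm (\<gamma> x) * (gaussw x * exp (b * l1norm x))"
          by (simp add: algebra_simps)
        also have "\<dots> \<le> M * (gaussw x * (omega k x * exp (\<bar>b\<bar> * l1norm x))) + norm (c\<^sup>2) * norm (\<gamma> x) * C'"
          by (intro add_mono mult_left_mono C' M0 omega_nonneg) (auto simp: less_imp_le mult_right_mono)
        finally show "norm (norm (H x) * exp (b * l1norm x)) \<le> norm (M * (gaussw x *\<^sub>R (omega k x * exp (\<bar>b\<bar> * l1norm x))) + norm (c\<^sup>2) * C' * norm (\<gamma> x))"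
          by (simp add: mult_ac)
      qed
    qed measurable
  next
    fix p :: "real^'n \<Rightarrow> complex" assume p: "cpoly p"
    note [measurable] = cpoly_measurable[OF p]
    obtain q where q: "cpoly q" "\<And>y. dunkl_transform (\<lambda>x. p x * of_real (wt x)) y = c * q y * of_real (gaussw y)"
      "\<And>x. dunkl_transform (\<lambda>y. q y * of_real (wt y)) (- x) = c * p x * of_real (gaussw x)"
      using dunkl_transform_pair[OF p] unfolding c_def by blast
    have "(LINT x | lborel. F x * (p x * of_real (wt x))) = (LINT x | lborel. (p x * of_real (wt x)) * (LINT y | lborel. h y * (\<lambda>(x, y). K x y) (x, y)))"
      by (simp add: F_def dunkl_transform_def mult_ac K_sym)
    also have "\<dots> = (LINT y | lborel. h y * (LINT x | lborel. (p x * of_real (wt x)) * (\<lambda>(x, y). K x y) (x, y)))"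
      by (rule fubini_bounded[OF integrable_wt_cpoly[OF p] h KB, where C = C]) (auto simp: C)
    also have "\<dots> = (LINT y | lborel. c * ((q y * of_real (wt y)) * dunkl_transform \<gamma> (- y)))"
    proof (intro arg_cong[where f = "integral\<^sup>L lborel"] ext)
      fix y
      have i: "(LINT x | lborel. (p x * of_real (wt x)) * (\<lambda>(x, y). K x y) (x, y)) = c * q y * of_real (gaussw y)"
        using q(2)[of y] by (simp only: dunkl_transform_def case_prod_conv)
      show "h y * (LINT x | lborel. (p x * of_real (wt x)) * (\<lambda>(x, y). K x y) (x, y)) = c * ((q y * of_real (wt y)) * dunkl_transform \<gamma> (- y))"
        unfolding i by (simp add: h_def wt_def mult_ac)
    qed
    also have "\<dots> = c * (LINT y | lborel. (q y * of_real (wt y)) * (LINT x | lborel. \<gamma> x * (\<lambda>(y, x). K x (- y)) (y, x)))"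
      by (simp add: dunkl_transform_def)
    also have "(LINT y | lborel. (q y * of_real (wt y)) * (LINT x | lborel. \<gamma> x * (\<lambda>(y, x). K x (- y)) (y, x)))
      = (LINT x | lborel. \<gamma> x * (LINT y | lborel. (q y * of_real (wt y)) * (\<lambda>(y, x). K x (- y)) (y, x)))"
    proof (rule fubini_bounded[OF integrable_wt_cpoly[OF q(1)] \<gamma>, where C = C])
      show "(\<lambda>(y, x). K x (- y :: real^'n)) \<in> borel_measurable borel"
        by (intro borel_measurable_continuous_onI) (auto simp: case_prod_unfold intro!: continuous_intros)
    qed (auto simp: C)
    also have "(\<lambda>x. \<gamma> x * (LINT y | lborel. (q y * of_real (wt y)) * (\<lambda>(y, x). K x (- y)) (y, x))) = (\<lambda>x. c * (\<gamma> x * (p x * of_real (gaussw x))))"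
    proof
      fix x :: "real^'n"
      have "K x (- y) = K y (- x)" for y :: "real^'n" by (metis K_minus K_sym)
      hence "(LINT y | lborel. (q y * of_real (wt y)) * (\<lambda>(y, x). K x (- y)) (y, x)) = dunkl_transform (\<lambda>y. q y * of_real (wt y)) (- x)"
        by (simp add: dunkl_transform_def)
      thus "\<gamma> x * (LINT y | lborel. (q y * of_real (wt y)) * (\<lambda>(y, x). K x (- y)) (y, x)) = c * (\<gamma> x * (p x * of_real (gaussw x)))"
        unfolding q(3) by (simp add: mult_ac)
    qed
    \<comment> \<open>One factor c comes from transforming p and one from transforming q back; the
      exchanges of integrals have shifted the inversion from \<open>\<gamma>\<close> onto the pair
      p, q.\<close>
    finally have e1: "(LINT x | lborel. F x * (p x * of_real (wt x))) = c\<^sup>2 * (LINT x | lborel. \<gamma> x * (p x * of_real (gaussw x)))"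
      by (simp add: power2_eq_square)
    have i1: "integrable lborel (\<lambda>x. F x * (p x * of_real (wt x)))"
    proof -
      have "integrable lborel (\<lambda>x. (p x * of_real (wt x)) * F x)"
        by (rule integrable_mult_bounded[OF integrable_wt_cpoly[OF p] _ F_bound]) measurable
      thus ?thesis by (simp add: mult.commute)
    qed
    have i2: "integrable lborel (\<lambda>x. \<gamma> x * (p x * of_real (gaussw x)))"
    proof -
      obtain Cp b where Cp: "Cp \<ge> 0" "\<And>x. norm (p x) \<le> Cp * exp (b * l1norm x)" using cpoly_expbdd[OF p] unfolding expbdd_def by blast
      obtain C' where C': "C' \<ge> 0" "\<And>x :: real^'n. gaussw x * exp (b * l1norm x) \<le> C'" using gauss_exp_bounded by blast
      have "norm (p x * of_real (gaussw x)) \<le> Cp * C'" for x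
      proof -
        have "norm (p x * of_real (gaussw x)) \<le> Cp * exp (b * l1norm x) * gaussw x"
          using Cp(2)[of x] by (simp add: norm_mult less_imp_le mult_right_mono)
        also have "\<dots> \<le> Cp * C'" using C'(2)[of x] Cp(1) by (simp add: mult.assoc mult.commute[of "exp _"] mult_left_mono)
        finally show ?thesis .
      qed
      thus ?thesis by (intro integrable_mult_bounded[OF \<gamma>, where C = "Cp * C'"]) auto
    qed
    have "(LINT x | lborel. H x * p x) = (LINT x | lborel. F x * (p x * of_real (wt x)) - c\<^sup>2 * (\<gamma> x * (p x * of_real (gaussw x))))"
      by (intro arg_cong[where f = "integral\<^sup>L lborel"] ext) (simp add: H_def wt_def algebra_simps)
    also have "\<dots> = 0" using i1 i2 e1 by simp
    finally show "(LINT x | lborel. H x * p x) = 0" .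
  qed measurable
  thus ?thesis
  proof eventually_elim
    fix x assume "H x = 0"
    thus "dunkl_transform (\<lambda>y. dunkl_transform \<gamma> (- y) * complex_of_real (omega k y)) x * complex_of_real (omega k x) = (cc TYPE('n))\<^sup>2 * \<gamma> x"
      using gaussw_pos[of x] by (simp add: H_def F_def h_def c_def)
  qed
qed

end

section \<open>The Laplace transform\<close>

text \<open>Passing to the closure of the open set is what later reaches the boundary of the
  orthant.\<close>

lemma continuous_AE_zero_open:
  fixes F :: "real^'n::finite \<Rightarrow> complex"
  assumes F: "continuous_on UNIV F" and U: "open U" and ae: "AE x in lborel. x \<in> U \<longrightarrow> F x = 0" and x: "x \<in> closure U"
  shows "F x = 0"
proof -
  have zero: "F x = 0" if "x \<in> U" for x
  proof (rule ccontr)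
    assume "F x \<noteq> 0"
    let ?V = "U \<inter> {x. F x \<noteq> 0}"
    have "open {x. F x \<noteq> 0}" by (rule open_Collect_neq[OF F continuous_on_const])
    hence oV: "open ?V" using U by blast
    hence "?V \<in> sets lborel" by simp
    moreover have "AE x in lborel. x \<notin> ?V" using ae by eventually_elim auto
    ultimately have "?V \<in> null_sets lborel" by (simp add: AE_iff_null_sets)
    hence "negligible ?V" by (simp add: negligible_iff_null_sets null_sets_completionI)
    moreover have "?V \<noteq> {}" using \<open>F x \<noteq> 0\<close> that by auto
    ultimately show False using open_not_negligible[OF oV] by blast
  qed
  have "closed {x. F x = 0}" by (rule closed_Collect_eq[OF F continuous_on_const])
  hence "closure U \<subseteq> {x. F x = 0}" using zero by (intro closure_minimal) auto
  thus ?thesis using x by blast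
qed

theorem theorem3p6:
  fixes k s :: real and f :: "real^'n::finite \<Rightarrow> complex"
  assumes "k \<ge> 0"
    and "loc_int_w k f"
    and "set_integrable lborel Rplus
           (\<lambda>x. f x * dunklA k (- x) (line_pt s 0) * complex_of_real (omega k x))"
    and "integrable lborel (\<lambda>y. laplaceA k f (line_pt s y) * complex_of_real (omega k y))"
  shows "\<exists>f0. continuous_on Rplus f0 \<and> (AE x in lborel. x \<in> Rplus \<longrightarrow> f x = f0 x) \<and>
           (\<forall>x :: real^'n.
              complex_of_real (1 / (c_const k TYPE('n))\<^sup>2) *
                (LINT y | lborel. laplaceA k f (line_pt s y) * dunklA k x (line_pt s y)
                                   * complex_of_real (omega k y))
              = (if x \<in> Rplus then f0 x else 0))"
proof -
  interpret dunkl k by standard (rule assms(1))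
  define c where "c = complex_of_real (c_const k TYPE('n))"
  have c0: "c \<noteq> 0" using c_const_pos[where ?'n = 'n] by (simp add: c_def)
  define E where "E x = exp (complex_of_real (s * (\<Sum>i\<in>UNIV. x $ i)))" for x :: "real^'n"
  have E_minus: "E (- x) * E x = 1" for x
    by (simp add: E_def exp_add[symmetric] sum_negf)
  have E0: "E x \<noteq> 0" for x by (simp add: E_def)
  have A: "dunklA k x (line_pt s y) = E x * K x y" for x y :: "real^'n"
    by (simp add: dunklA_line E_def)
  define \<gamma> where "\<gamma> x = indicator Rplus x *\<^sub>R (f x * E (- x) * complex_of_real (omega k x))" for x
  \<comment> \<open>At the real point of the line the kernel reduces to \<open>E (- x)\<close>,
    since \<open>K\<close> is 1 for y = 0. Existence of the Laplace transform at this single point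
    is therefore integrability of \<open>\<gamma>\<close>.\<close>
  have \<gamma>: "integrable lborel \<gamma>"
    using assms(3) unfolding set_integrable_def A K_zero_right mult_1_right by (simp add: \<gamma>_def[abs_def])
  \<comment> \<open>The Laplace kernel carries -x; \<open>K_minus\<close> moves the sign to the
    spectral variable, where the inversion lemma expects it.\<close>
  have lap: "laplaceA k f (line_pt s y) = dunkl_transform \<gamma> (- y)" for y
    unfolding laplaceA_def set_lebesgue_integral_def A dunkl_transform_def \<gamma>_def
    by (intro arg_cong[where f = "integral\<^sup>L lborel"] ext) (simp add: K_minus indicator_def)
  define h where "h y = dunkl_transform \<gamma> (- y) * complex_of_real (omega k y)" for y
  have h: "integrable lborel h" using assms(4) by (simp add: lap h_def[abs_def])
  define F where "F x = dunkl_transform h x / c\<^sup>2" for x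
  have Fcont: "continuous_on UNIV F"
    unfolding F_def using continuous_dunkl_transform[OF h] c0 by (intro continuous_intros) auto
  have FA: "AE x in lborel. F x = (if x \<in> Rplus then f x * E (- x) else 0)"
    using dunkl_inversion[OF \<gamma> h[unfolded h_def[abs_def]]] AE_regular
  proof eventually_elim
    fix x :: "real^'n"
    assume e: "dunkl_transform (\<lambda>y. dunkl_transform \<gamma> (- y) * complex_of_real (omega k y)) x * complex_of_real (omega k x) = (cc TYPE('n))\<^sup>2 * \<gamma> x"
      and reg: "\<forall>i j. i \<noteq> j \<longrightarrow> x $ i \<noteq> x $ j"
    \<comment> \<open>The weight is cancelled at points with distinct coordinates, where it is
      positive.\<close>
    have w0: "complex_of_real (omega k x) \<noteq> 0" using omega_pos[of x k] reg by simp
    have "dunkl_transform h x * complex_of_real (omega k x) = c\<^sup>2 * \<gamma> x"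
      using e by (simp add: h_def[abs_def] c_def)
    hence "F x * complex_of_real (omega k x) = \<gamma> x" using c0 by (simp add: F_def)
    also have "\<gamma> x = (if x \<in> Rplus then f x * E (- x) else 0) * complex_of_real (omega k x)" by (simp add: \<gamma>_def)
    finally show "F x = (if x \<in> Rplus then f x * E (- x) else 0)" using w0 by simp
  qed
  have F0: "F x = 0" if "x \<notin> Rplus" for x
  proof -
    from that obtain i where i: "x $ i \<le> 0" by (auto simp: Rplus_def not_less)
    \<comment> \<open>A point outside the orthant may lie on its boundary, so vanishing almost
      everywhere is used on an open half-space whose closure contains the point.\<close>
    let ?U = "{x :: real^'n. x $ i < 0}"
    have "open ?U" by (intro open_Collect_less continuous_intros)
    moreover have "AE x in lborel. x \<in> ?U \<longrightarrow> F x = 0"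
      using FA by eventually_elim (auto simp: Rplus_def not_less dest: less_asym)
    moreover have "x \<in> closure ?U"
    proof (rule Lim_in_closed_set[OF closed_closure])
      define u where "u n = x - (1 / real (Suc n)) *\<^sub>R axis i 1" for n
      show "eventually (\<lambda>n. u n \<in> closure ?U) sequentially"
      proof (rule always_eventually, rule allI)
        fix n
        have "x $ i < 1 / real (Suc n)" by (rule le_less_trans[OF i]) simp
        hence "u n \<in> ?U" by (simp add: u_def)
        thus "u n \<in> closure ?U" by (rule subsetD[OF closure_subset])
      qed
      have "u \<longlonglongrightarrow> x - 0 *\<^sub>R axis i 1" unfolding u_def
        by (intro tendsto_intros LIMSEQ_Suc[OF lim_1_over_n])
      thus "u \<longlonglongrightarrow> x" by simp
    qed simp
    ultimately show "F x = 0" by (rule continuous_AE_zero_open[OF Fcont])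
  qed
  show ?thesis
  \<comment> \<open>The factor \<open>E x\<close> undoes the \<open>E (- x)\<close> in
    \<open>F\<close>; it is also the factor that the kernel on the line contributes in front of the
    integral.\<close>
  proof (intro exI[of _ "\<lambda>x. E x * F x"] conjI allI)
    show "continuous_on Rplus (\<lambda>x. E x * F x)"
      unfolding E_def by (intro continuous_intros continuous_on_subset[OF Fcont]) auto
    show "AE x in lborel. x \<in> Rplus \<longrightarrow> f x = E x * F x"
      using FA by eventually_elim (use E_minus in \<open>simp add: mult_ac\<close>)
    fix x :: "real^'n"
    have "(LINT y | lborel. laplaceA k f (line_pt s y) * dunklA k x (line_pt s y) * complex_of_real (omega k y)) = (LINT y | lborel. E x * (h y * K y x))"
      by (intro arg_cong[where f = "integral\<^sup>L lborel"] ext) (simp add: lap A h_def K_sym[of x] mult_ac)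
    also have "\<dots> = E x * dunkl_transform h x" by (simp add: dunkl_transform_def)
    finally have "complex_of_real (1 / (c_const k TYPE('n))\<^sup>2) * (LINT y | lborel. laplaceA k f (line_pt s y) * dunklA k x (line_pt s y) * complex_of_real (omega k y)) = E x * F x"
      by (simp add: F_def c_def)
    thus "complex_of_real (1 / (c_const k TYPE('n))\<^sup>2) * (LINT y | lborel. laplaceA k f (line_pt s y) * dunklA k x (line_pt s y) * complex_of_real (omega k y)) = (if x \<in> Rplus then E x * F x else 0)"
      using F0[of x] by simp
  qed
qed

end
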